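(* Let $0<\alpha<d$ and $1<p\le q<\infty$ be such that $\frac1p-\frac1q\le\frac{\alpha}{d}$, and let $\Phi$ and $\Psi$ be Young functions with $\bar\Phi\in B_{p,q}$ and $\bar\Psi\in B_{q'}$. If $(U,V)$ is a pair of $n\times n$ matrix weights on $\mathbb{R}^d$ such that $$[U,V]_{p,q,\Phi,\Psi}=\sup_Q|Q|^{\frac{\alpha}{d}+\frac1q-\frac1p}\Big\|\big\|U(x)^{\frac1q}V(y)^{-\frac1p}\big\|_{\Phi_y,Q}\Big\|_{\Psi_x,Q}<\infty,$$ where the supremum is over all cubes $Q$, then $I_\alpha:L^p(V)\to L^q(U)$; that is, there is a constant $C<\infty$ with $\|I_\alpha f\|_{L^q(U)}\le C\|f\|_{L^p(V)}$ for all $f\in L^p(V)$.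
   Context: Cubes $Q\subset\mathbb{R}^d$ have edges parallel to the coordinate axes; $q'$ is the conjugate exponent of $q$. A matrix weight is an $n\times n$ self-adjoint matrix function $U$ on $\mathbb{R}^d$ with locally integrable entries such that $U(x)$ is positive definite for a.e. $x$; powers $U^r$ are defined by diagonalization. $|\cdot|_{\mathrm{op}}$ is the operator norm. $L^p(U)$ is the set of measurable $f:\mathbb{R}^d\to\mathbb{C}^n$ with $\|f\|_{L^p(U)}=\big(\int_{\mathbb{R}^d}|U(x)^{1/p}f(x)|^p\,dx\big)^{1/p}<\infty$. A Young function is a convex, increasing $\Phi:[0,\infty)\to[0,\infty)$ with $\Phi(0)=0$ and $\Phi(t)/t\to\infty$ as $t\to\infty$; its associate function is $\bar\Phi(t)=\sup_{s>0}\{st-\Phi(s)\}$. $\Phi\in B_p$ means $\int_1^\infty\frac{\Phi(t)}{t^p}\frac{dt}{t}<\infty$; $\Phi\in B_{p,q}$ means $\int_1^\infty \frac{\Phi(t)^{q/p}}{t^q}\frac{dt}{t}<\infty$. The localized Orlicz norm is $\|f\|_{\Phi,Q}=\inf\{\lambda>0:\frac1{|Q|}\int_Q\Phi(|f(x)|/\lambda)\,dx\le1\}$; for a matrix function $A$, $\|A\|_{\Phi,Q}=\||A|_{\mathrm{op}}\|_{\Phi,Q}$. The subscripts in $\|\cdot\|_{\Phi_y,Q}$ and $\|\cdot\|_{\Psi_x,Q}$ indicate the variable with respect to which the Orlicz norm is taken. The fractional integral operator, applied componentwise to vector-valued functions, is $I_\alpha f(x)=\int_{\mathbb{R}^d}\frac{f(y)}{|x-y|^{d-\alpha}}\,dy$.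 The conclusion is equivalent to the boundedness of $U^{1/q}I_\alpha V^{-1/p}:L^p(\mathbb{R}^d,\mathbb{C}^n)\to L^q(\mathbb{R}^d,\mathbb{C}^n)$. *)

theory Defs
  imports "HOL-Analysis.Analysis"
begin

section \<open>Matrix weights\<close>

definition adjoint_matrix :: "complex^'n^'n \<Rightarrow> complex^'n^'n" where
  "adjoint_matrix A = (\<chi> i j. cnj (A $ j $ i))"

definition self_adjoint :: "complex^'n^'n \<Rightarrow> bool" where
  "self_adjoint A \<longleftrightarrow> adjoint_matrix A = A"

definition unitary_matrix :: "complex^'n^'n \<Rightarrow> bool" where
  "unitary_matrix P \<longleftrightarrow> adjoint_matrix P ** P = mat 1 \<and> P ** adjoint_matrix P = mat 1"

(* The real inner product on complex^'n is the real part of the Hermitian one, and the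
   quadratic form of a self-adjoint matrix is real-valued. *)
definition positive_definite :: "complex^'n^'n \<Rightarrow> bool" where
  "positive_definite A \<longleftrightarrow> self_adjoint A \<and> (\<forall>v. v \<noteq> 0 \<longrightarrow> 0 < v \<bullet> (A *v v))"

definition real_diag :: "('n \<Rightarrow> real) \<Rightarrow> complex^'n^'n" where
  "real_diag l = (\<chi> i j. if i = j then complex_of_real (l i) else 0)"

(* Independent of the chosen diagonalization, so the description is proper for every
   self-adjoint A.  The value is the usual power only when A is positive definite; a matrix
   weight may fail this on a null set, where the value does not matter. *)
definition matrix_powr :: "complex^'n^'n \<Rightarrow> real \<Rightarrow> complex^'n^'n" where
  "matrix_powr A r = (THE B. \<exists>P l. unitary_matrix P \<and>
      A = P ** real_diag l ** adjoint_matrix P \<and>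
      B = P ** real_diag (\<lambda>i. l i powr r) ** adjoint_matrix P)"

definition op_norm :: "complex^'n^'n \<Rightarrow> real" where
  "op_norm A = onorm (\<lambda>v. A *v v)"

definition locally_integrable :: "(real^'d \<Rightarrow> complex) \<Rightarrow> bool" where
  "locally_integrable f \<longleftrightarrow> (\<forall>K. compact K \<longrightarrow> f absolutely_integrable_on K)"

definition matrix_weight :: "(real^'d \<Rightarrow> complex^'n^'n) \<Rightarrow> bool" where
  "matrix_weight U \<longleftrightarrow>
     (\<forall>x. self_adjoint (U x)) \<and>
     (\<forall>i j. locally_integrable (\<lambda>x. U x $ i $ j)) \<and>
     (AE x in lebesgue. positive_definite (U x))"

section \<open>Weighted Lebesgue spaces\<close>

definition Lp_integral ::
    "real \<Rightarrow> (real^'d \<Rightarrow> complex^'n^'n) \<Rightarrow> (real^'d \<Rightarrow> complex^'n) \<Rightarrow> ennreal" where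
  "Lp_integral p U f =
     (\<integral>\<^sup>+ x. ennreal (norm (matrix_powr (U x) (1 / p) *v f x) powr p) \<partial>lebesgue)"

definition Lp_space ::
    "real \<Rightarrow> (real^'d \<Rightarrow> complex^'n^'n) \<Rightarrow> (real^'d \<Rightarrow> complex^'n) set" where
  "Lp_space p U = {f. f \<in> borel_measurable lebesgue \<and> Lp_integral p U f < \<infinity>}"

(* Meaningful for members of Lp_space p U only: enn2real sends infinity to 0. *)
definition Lp_norm ::
    "real \<Rightarrow> (real^'d \<Rightarrow> complex^'n^'n) \<Rightarrow> (real^'d \<Rightarrow> complex^'n) \<Rightarrow> real" where
  "Lp_norm p U f = enn2real (Lp_integral p U f) powr (1 / p)"

section \<open>Young functions\<close>

(* A Young function is a function on the reals of which only the values on {0..} are used.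
   Increasing is meant in the weak sense, as for the associate function. *)
definition young_function :: "(real \<Rightarrow> real) \<Rightarrow> bool" where
  "young_function \<Phi> \<longleftrightarrow>
     convex_on {0..} \<Phi> \<and> mono_on {0..} \<Phi> \<and> \<Phi> 0 = 0 \<and>
     filterlim (\<lambda>t. \<Phi> t / t) at_top at_top"

definition young_associate :: "(real \<Rightarrow> real) \<Rightarrow> real \<Rightarrow> real" where
  "young_associate \<Phi> t = (SUP s\<in>{0<..}. s * t - \<Phi> s)"

definition B_class :: "real \<Rightarrow> (real \<Rightarrow> real) \<Rightarrow> bool" where
  "B_class p \<Phi> \<longleftrightarrow>
     (\<integral>\<^sup>+ t\<in>{1..}. ennreal (\<Phi> t / t powr p * (1 / t)) \<partial>lborel) < \<infinity>"

definition B_class2 :: "real \<Rightarrow> real \<Rightarrow> (real \<Rightarrow> real) \<Rightarrow> bool" where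
  "B_class2 p q \<Phi> \<longleftrightarrow>
     (\<integral>\<^sup>+ t\<in>{1..}. ennreal (\<Phi> t powr (q / p) / t powr q * (1 / t)) \<partial>lborel) < \<infinity>"

definition conj_exponent :: "real \<Rightarrow> real" where
  "conj_exponent q = q / (q - 1)"

section \<open>Localized Orlicz norms\<close>

definition cubes :: "(real^'d) set set" where
  "cubes = {Q. \<exists>a l. 0 < l \<and> Q = cbox a (a + (\<chi> i. l))}"

definition young_ennreal :: "(real \<Rightarrow> real) \<Rightarrow> ennreal \<Rightarrow> ennreal" where
  "young_ennreal \<Phi> t = (if t = \<infinity> then \<infinity> else ennreal (\<Phi> (enn2real t)))"

(* Functions and norms take values in [0,\<infinity>], because the norm in one variable of a function
   of two variables may be infinite at some points of the other variable.  The infimum of the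
   empty set is \<infinity>. *)
definition orlicz_norm ::
    "(real \<Rightarrow> real) \<Rightarrow> (real^'d) set \<Rightarrow> (real^'d \<Rightarrow> ennreal) \<Rightarrow> ennreal" where
  "orlicz_norm \<Phi> Q f = Inf {ennreal c | c. 0 < c \<and>
     (1 / emeasure lebesgue Q) *
       (\<integral>\<^sup>+ x\<in>Q. young_ennreal \<Phi> (f x / ennreal c) \<partial>lebesgue) \<le> 1}"

definition two_weight_bump ::
    "real \<Rightarrow> real \<Rightarrow> real \<Rightarrow> (real \<Rightarrow> real) \<Rightarrow> (real \<Rightarrow> real) \<Rightarrow>
     (real^'d \<Rightarrow> complex^'n^'n) \<Rightarrow> (real^'d \<Rightarrow> complex^'n^'n) \<Rightarrow> ennreal" where
  "two_weight_bump \<alpha> p q \<Phi> \<Psi> U V =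
     (SUP Q\<in>cubes.
        ennreal (measure lebesgue Q powr (\<alpha> / real CARD('d) + 1 / q - 1 / p)) *
        orlicz_norm \<Psi> Q (\<lambda>x. orlicz_norm \<Phi> Q (\<lambda>y.
          ennreal (op_norm (matrix_powr (U x) (1 / q) ** matrix_powr (V y) (- 1 / p))))))"

section \<open>The fractional integral\<close>

definition riesz_integrand :: "real \<Rightarrow> (real^'d \<Rightarrow> complex) \<Rightarrow> real^'d \<Rightarrow> real^'d \<Rightarrow> complex" where
  "riesz_integrand \<alpha> f x y = f y / complex_of_real (norm (x - y) powr (real CARD('d) - \<alpha>))"

definition riesz_defined :: "real \<Rightarrow> (real^'d \<Rightarrow> complex^'n) \<Rightarrow> real^'d \<Rightarrow> bool" where
  "riesz_defined \<alpha> f x \<longleftrightarrow>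
     (\<forall>i. integrable lebesgue (riesz_integrand \<alpha> (\<lambda>y. f y $ i) x))"

(* The Lebesgue integral is 0 by convention where the integrand is not integrable; see
   riesz_defined. *)
definition riesz_potential :: "real \<Rightarrow> (real^'d \<Rightarrow> complex^'n) \<Rightarrow> real^'d \<Rightarrow> complex^'n" where
  "riesz_potential \<alpha> f x =
     (\<chi> i. LINT y|lebesgue. riesz_integrand \<alpha> (\<lambda>y. f y $ i) x y)"

end

theory Submission
  imports Defs
begin

text \<open>
  Write \<open>f = V powr (-1/p) (V powr (1/p) f)\<close> and dominate the kernel of the fractional integral by a
  finite sum over dyadic cells \<open>Q\<close> and their neighbourhoods \<open>3 Q\<close>.  For a test function \<open>h\<close>, each cell
  contributes the integral over \<open>3 Q\<close> of \<open>N\<^sub>Q(f(y))\<close>, where \<open>N\<^sub>Q(v)\<close> is the average over \<open>Q\<close> of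
  \<open>h(x) |U(x) powr (1/q) v|\<close>.  A scalar stopping time does not suffice here, because \<open>U\<close> and \<open>V\<close> do not
  decouple; instead a cell is a stopping cell if \<open>N\<^sub>Q\<close> exceeds a multiple of \<open>N\<^sub>P\<close>, \<open>P\<close> being the last
  stopping cell above \<open>Q\<close>, in one of the finitely many directions of a basis that is well conditioned for
  the seminorm \<open>N\<^sub>P\<close>.  The stopping cells then satisfy a Carleson packing condition, whereas \<open>N\<^sub>Q\<close> is
  bounded by a multiple of \<open>N\<^sub>P\<close> in all directions for the other cells, over which the factor
  \<open>|Q| powr (\<alpha>/d)\<close> sums geometrically.  On each stopping cell Hoelder's inequality for Orlicz norms in both
  variables brings in the bump constant, and what remains is controlled by Carleson embeddings for the
  Orlicz averages of \<open>|V powr (1/p) f|\<close> and of \<open>h\<close>, which are where the \<open>B\<close>-conditions are used.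
\<close>

section \<open>Spectral calculus of self-adjoint matrices\<close>

text \<open>Constants must survive the removal of all truncations. The grid therefore starts at the
  outer truncation radius of the kernel, and the bound \<open>R\<close> on the data only secures
  finiteness; it never enters \<open>bilinear_const\<close>. The basis for \<open>N_P\<close> has to
  be well conditioned because \<open>N_P\<close> may be arbitrarily degenerate: only then does a
  test in finitely many directions control all vectors with a constant depending on the dimension
  alone. The stopping threshold is twice the dimension. The cells caught by one direction then fill
  at most the fraction 1 / (2 dim) of \<open>P\<close>, those caught by any direction at most one
  half, and summing over generations gives the packing constant 2. The powers of |Q| from the
  kernel, the averages and the bump leave |Q|^(1/p) for the norm of \<open>g\<close> and |Q|^(1 -
  1/q) for that of \<open>h\<close>. Young's inequality with q and q' then asks for one embedding
  with exponents (p, q) and one with (q', q'), which is what the two \<open>B\<close>-conditions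
  provide. One grid with neighbourhoods takes the place of several shifted grids; the price is that
  packing must also hold for translates of the stopping cells.\<close>

definition hprod :: "complex^'n \<Rightarrow> complex^'n \<Rightarrow> complex" where
  "hprod u v = (\<Sum>i\<in>UNIV. cnj (u$i) * v$i)"

lemma inner_eq_Re_hprod: "u \<bullet> v = Re (hprod u v)"
  by (simp add: hprod_def inner_vec_def inner_complex_def)

lemma hprod_add_right: "hprod u (v + w) = hprod u v + hprod u w"
  by (simp add: hprod_def sum.distrib algebra_simps)

lemma hprod_scaleR_right: "hprod u (c *\<^sub>R v) = of_real c * hprod u v"
  unfolding hprod_def sum_distrib_left
  by (rule sum.cong) (simp_all add: scaleR_conv_of_real[where 'a=complex] mult_ac)

lemma hprod_zero_right [simp]: "hprod u 0 = 0"
  by (simp add: hprod_def)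

lemma hprod_commute: "hprod v u = cnj (hprod u v)"
  by (simp add: hprod_def mult.commute)

lemma hprod_smult_left: "hprod (c *s u) v = cnj c * hprod u v"
  by (simp add: hprod_def sum_distrib_left mult_ac)

lemma hprod_smult_right: "hprod u (c *s v) = c * hprod u v"
  by (simp add: hprod_def sum_distrib_left mult_ac)

text \<open>With \<open>inner_eq_Re_hprod\<close>, Hermitian orthogonality to \<open>u\<close>
  becomes real orthogonality to both \<open>u\<close> and \<open>\<i> *s u\<close>; this lets real
  dimension theory count complex orthonormal sets.\<close>

lemma inner_imaginary_smult: "(\<i> *s u) \<bullet> v = Im (hprod u v)"
  by (simp add: inner_eq_Re_hprod hprod_smult_left)

lemma hprod_adjoint: "hprod u (A *v v) = hprod (adjoint_matrix A *v u) v"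
proof -
  have "hprod u (A *v v) = (\<Sum>i\<in>UNIV. \<Sum>j\<in>UNIV. cnj (u$i) * A$i$j * v$j)"
    by (simp add: hprod_def matrix_vector_mult_def sum_distrib_left mult_ac)
  also have "\<dots> = (\<Sum>j\<in>UNIV. \<Sum>i\<in>UNIV. cnj (u$i) * A$i$j * v$j)"
    by (rule sum.swap)
  also have "\<dots> = hprod (adjoint_matrix A *v u) v"
    by (simp add: hprod_def matrix_vector_mult_def adjoint_matrix_def sum_distrib_right
        sum_distrib_left mult_ac)
  finally show ?thesis .
qed

text \<open>Rayleigh quotient: a maximizer \<open>v\<close> of \<open>x \<bullet> f x\<close> on the
  unit sphere of \<open>W\<close> is an eigenvector, since otherwise moving \<open>v\<close> along
  the residual \<open>f v - l *\<^sub>R v\<close> would increase the quotient. Invariance of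
  \<open>W\<close> keeps the residual in \<open>W\<close>.\<close>

lemma symmetric_eigenvector_exists:
  fixes f :: "'a::euclidean_space \<Rightarrow> 'a"
  assumes f: "linear f" and sym: "\<And>u v. f u \<bullet> v = u \<bullet> f v"
    and W: "subspace W" "\<And>w. w \<in> W \<Longrightarrow> f w \<in> W" and ne: "W \<noteq> {0}"
  obtains v l where "v \<in> W" "norm v = 1" "f v = l *\<^sub>R v"
proof -
  let ?S = "W \<inter> sphere 0 1"
  obtain w0 where w0: "w0 \<in> W" "w0 \<noteq> 0"
    using ne subspace_0[OF W(1)] by blast
  have "(1 / norm w0) *\<^sub>R w0 \<in> ?S"
    using w0 W(1) by (auto simp: subspace_scale)
  moreover have "compact ?S"
    by (simp add: closed_Int_compact closed_subspace W(1))
  moreover have "continuous_on ?S (\<lambda>x. x \<bullet> f x)"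
    by (intro continuous_intros linear_continuous_on_compose[OF _ f])
  ultimately obtain v where v: "v \<in> ?S" "\<And>x. x \<in> ?S \<Longrightarrow> x \<bullet> f x \<le> v \<bullet> f v"
    using continuous_attains_sup[of ?S "\<lambda>x. x \<bullet> f x"] by blast
  define l where "l = v \<bullet> f v"
  have le: "w \<bullet> f w \<le> l * (w \<bullet> w)" if "w \<in> W" for w
  proof (cases "w = 0")
    case True
    then show ?thesis using f by (simp add: linear_0)
  next
    case False
    have "(1 / norm w) *\<^sub>R w \<in> ?S"
      using that False W(1) by (auto simp: subspace_scale)
    from v(2)[OF this] have "(1 / norm w) * ((1 / norm w) * (w \<bullet> f w)) \<le> l"
      using f by (simp add: l_def linear_cmul)
    then show ?thesis using False
      by (simp add: divide_simps power2_norm_eq_inner[symmetric] power2_eq_square split: if_splits)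
  qed
  define w where "w = f v - l *\<^sub>R v"
  have wW: "w \<in> W"
    using v(1) W by (simp add: w_def subspace_diff subspace_scale)
  have vv: "v \<bullet> v = 1"
    using v(1) by (simp add: norm_eq_1)
  define c where "c = l * (w \<bullet> w) - w \<bullet> f w"
  \<comment> \<open>The maximum property at \<open>v + t *\<^sub>R w\<close>, expanded: twice the
    first-order gain \<open>t * (w \<bullet> w)\<close> is at most \<open>t\<^sup>2 * c\<close>. A
    small \<open>t\<close> then forces \<open>w = 0\<close>.\<close>
  have t: "2 * (w \<bullet> w) \<le> t * c" if "t > 0" for t
  proof -
    have "v + t *\<^sub>R w \<in> W"
      using v(1) wW W(1) by (simp add: subspace_add subspace_scale)
    from le[OF this] have "l + 2 * t * (w \<bullet> f v) + t\<^sup>2 * (w \<bullet> f w) \<le> l + 2 * t * l * (w \<bullet> v) + t\<^sup>2 * l * (w \<bullet> w)"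
      using f vv sym[of v w] by (simp add: linear_add linear_cmul inner_add inner_commute l_def
          power2_eq_square algebra_simps)
    moreover
    have "w \<bullet> w = w \<bullet> f v - l * (w \<bullet> v)"
      by (subst (2) w_def) (simp add: inner_diff_right)
    then have "2 * t * (w \<bullet> f v) = 2 * t * (w \<bullet> w) + 2 * t * l * (w \<bullet> v)"
      by algebra
    ultimately have "2 * t * (w \<bullet> w) + t\<^sup>2 * (w \<bullet> f w) \<le> t\<^sup>2 * l * (w \<bullet> w)"
      by linarith
    then have "t * (2 * (w \<bullet> w)) \<le> t * (t * c)"
      by (simp add: c_def algebra_simps power2_eq_square)
    then show ?thesis using that by simp
  qed
  have "w \<bullet> w \<le> 0"
  proof (rule ccontr)
    assume "\<not> w \<bullet> w \<le> 0"
    then have pos: "w \<bullet> w > 0" by linarith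
    have c: "c > 0" using t[of 1] pos by linarith
    show False using t[of "w \<bullet> w / c"] pos c by simp
  qed
  then have "w = 0"
    by (metis inner_gt_zero_iff not_le)
  then have "f v = l *\<^sub>R v"
    unfolding w_def by simp
  then show ?thesis using that v(1) by auto
qed

definition eigen_orthonormal :: "complex^'n^'n \<Rightarrow> (complex^'n) set \<Rightarrow> bool" where
  "eigen_orthonormal A B \<longleftrightarrow> (\<forall>b\<in>B. \<forall>c\<in>B. hprod b c = (if b = c then 1 else 0)) \<and>
     (\<forall>b\<in>B. \<exists>l::real. A *v b = l *\<^sub>R b)"

text \<open>The vectors \<open>b\<close> and \<open>\<i> *s b\<close> are pairwise orthogonal over
  the reals, so k Hermitian orthonormal vectors span real dimension 2 k;
  \<open>DIM(complex^'n)\<close> is likewise twice \<open>CARD('n)\<close>.\<close>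

lemma eigen_orthonormal_realify:
  fixes B :: "(complex^'n) set"
  assumes "eigen_orthonormal A B"
  defines "C \<equiv> B \<union> (\<lambda>b. \<i> *s b) ` B"
  shows "independent C" "finite B" "card C = 2 * card B"
proof -
  have h: "hprod b c = (if b = c then 1 else 0)" if "b \<in> B" "c \<in> B" for b c
    using assms that by (auto simp: eigen_orthonormal_def)
  have inj: "inj_on (\<lambda>b. \<i> *s b) B"
    by (auto simp: inj_on_def vec_eq_iff)
  have ne: "\<i> *s b \<noteq> c" if "b \<in> B" "c \<in> B" for b c
    using h[OF that] h[OF that(2) that(2)] hprod_smult_left[of \<i> b c] by (auto split: if_splits simp: complex_eq_iff)
  have "pairwise orthogonal C"
    unfolding C_def pairwise_def orthogonal_def
    by (auto simp: inner_eq_Re_hprod hprod_smult_left hprod_smult_right h split: if_splits)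
  moreover have "0 \<notin> C"
  proof -
    have "b \<noteq> 0" if "b \<in> B" for b
      using h[OF that that] by auto
    moreover have "b = 0" if "\<i> *s b = 0" for b :: "complex^'n"
      using that by (simp add: vec_eq_iff)
    ultimately show ?thesis unfolding C_def by (metis Un_iff imageE)
  qed
  ultimately show ind: "independent C"
    by (rule pairwise_orthogonal_independent)
  then have "finite C" by (rule independent_imp_finite)
  then show fB: "finite B" by (simp add: C_def)
  have "B \<inter> (\<lambda>b. \<i> *s b) ` B = {}"
    using ne by blast
  then show "card C = 2 * card B"
    using fB by (simp add: C_def card_Un_disjoint card_image[OF inj])
qed

text \<open>An orthonormal set of eigenvectors of maximal size works: its Hermitian complement
  \<open>W\<close> is invariant under \<open>A\<close>, so a nonzero \<open>W\<close> would contain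
  a further unit eigenvector.\<close>

lemma self_adjoint_eigenbasis:
  fixes A :: "complex^'n^'n"
  assumes A: "self_adjoint A"
  obtains B where "eigen_orthonormal A B" "card B = CARD('n)"
proof -
  have hA: "hprod u (A *v v) = hprod (A *v u) v" for u v
    using A by (simp add: hprod_adjoint self_adjoint_def)
  \<comment> \<open>Any bound on the size would do; it serves only to make a maximal set
    exist.\<close>
  have bd: "card B \<le> 2 * CARD('n)" if "eigen_orthonormal A B" for B
    using independent_bound[OF eigen_orthonormal_realify(1)[OF that]]
      eigen_orthonormal_realify(3)[OF that] by simp
  have "eigen_orthonormal A {}" by (simp add: eigen_orthonormal_def)
  then obtain B where B: "eigen_orthonormal A B"
    and max: "\<And>B'. eigen_orthonormal A B' \<Longrightarrow> card B' \<le> card B"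
    using ex_has_greatest_nat[of "eigen_orthonormal A" "{}" card "Suc (2 * CARD('n))"] bd
    by (auto simp: less_Suc_eq_le)
  note r = eigen_orthonormal_realify[OF B]
  define W where "W = {v. \<forall>b\<in>B. hprod b v = 0}"
  have "W = {0}"
  proof (rule ccontr)
    assume ne: "W \<noteq> {0}"
    have sub: "subspace W"
      by (auto simp: W_def subspace_def hprod_add_right hprod_scaleR_right)
    have inv: "A *v w \<in> W" if "w \<in> W" for w
    proof -
      have "hprod b (A *v w) = 0" if b: "b \<in> B" for b
      proof -
        obtain l :: real where "A *v b = l *\<^sub>R b" using B b unfolding eigen_orthonormal_def by blast
        then have "hprod b (A *v w) = cnj (of_real l * hprod w b)"
          by (metis hA hprod_commute hprod_scaleR_right)
        also have "hprod w b = 0"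
          using \<open>w \<in> W\<close> b by (metis (mono_tags, lifting) W_def complex_cnj_zero hprod_commute mem_Collect_eq)
        finally show ?thesis by simp
      qed
      then show ?thesis by (simp add: W_def)
    qed
    have sym: "(A *v u) \<bullet> v = u \<bullet> (A *v v)" for u v
      by (simp add: inner_eq_Re_hprod hA)
    have lin: "linear ((*v) A)"
      by (auto intro!: linearI simp: matrix_vector_right_distrib vec_eq_iff matrix_vector_mult_def
          scaleR_sum_right)
    obtain v l where v: "v \<in> W" "norm v = 1" "A *v v = l *\<^sub>R v"
      using symmetric_eigenvector_exists[OF lin sym sub inv ne] by metis
    have vv: "hprod v v = 1"
    proof (rule complex_eqI)
      show "Re (hprod v v) = Re 1" using v(2) by (simp add: inner_eq_Re_hprod[symmetric] norm_eq_1)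
      show "Im (hprod v v) = Im 1" using hprod_commute[of v v] by (simp add: complex_eq_iff)
    qed
    have v0: "hprod b v = 0" "hprod v b = 0" if "b \<in> B" for b
      using v(1) that hprod_commute[of v b] by (auto simp: W_def)
    then have "v \<notin> B" using vv by force
    have "eigen_orthonormal A (insert v B)"
      using B vv v0 v(3) \<open>v \<notin> B\<close> unfolding eigen_orthonormal_def by auto
    from max[OF this] show False using \<open>v \<notin> B\<close> r(2) by simp
  qed
  \<comment> \<open>With \<open>W\<close> trivial, no nonzero vector is real-orthogonal to
    \<open>B\<close> and \<open>\<i> *s B\<close> together, so the realified set spans, and
    \<open>card B\<close> is exactly half of the real dimension.\<close>
  have "\<not> dim (B \<union> (\<lambda>b. \<i> *s b) ` B) < DIM(complex^'n)"
  proof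
    assume "dim (B \<union> (\<lambda>b. \<i> *s b) ` B) < DIM(complex^'n)"
    then obtain x where x: "x \<noteq> 0" "\<And>y. y \<in> span (B \<union> (\<lambda>b. \<i> *s b) ` B) \<Longrightarrow> orthogonal x y"
      using orthogonal_to_subspace_exists by blast
    have "hprod b x = 0" if "b \<in> B" for b
    proof (rule complex_eqI)
      show "Re (hprod b x) = Re 0"
        using x(2)[of b] that by (simp add: span_base inner_eq_Re_hprod[symmetric] orthogonal_def inner_commute)
      show "Im (hprod b x) = Im 0"
        using x(2)[of "\<i> *s b"] that
        by (simp add: span_base inner_imaginary_smult[symmetric] orthogonal_def inner_commute)
    qed
    then have "x \<in> W" by (simp add: W_def)
    then show False using x(1) \<open>W = {0}\<close> by auto
  qed
  then have "card B = CARD('n)"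
    using r dim_eq_card_independent[OF r(1)] independent_bound[OF r(1)] by simp
  then show ?thesis using that B by blast
qed

definition diagonalizes :: "complex^'n^'n \<Rightarrow> ('n \<Rightarrow> real) \<Rightarrow> complex^'n^'n \<Rightarrow> bool" where
  "diagonalizes P l A \<longleftrightarrow> unitary_matrix P \<and> A = P ** real_diag l ** adjoint_matrix P"

lemma self_adjoint_diagonalizable:
  fixes A :: "complex^'n^'n"
  assumes A: "self_adjoint A"
  obtains P l where "diagonalizes P l A"
proof -
  obtain B where B: "eigen_orthonormal A B" "card B = CARD('n)"
    using self_adjoint_eigenbasis[OF A] .
  have "finite B" using eigen_orthonormal_realify(2)[OF B(1)] .
  then obtain b where b: "bij_betw b (UNIV :: 'n set) B"
    using finite_same_card_bij[of "UNIV :: 'n set" B] B(2) by auto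
  have "\<forall>j. \<exists>l::real. A *v b j = l *\<^sub>R b j"
    using B(1) b by (auto simp: eigen_orthonormal_def bij_betw_def)
  then obtain l :: "'n \<Rightarrow> real" where l: "\<And>j. A *v b j = l j *\<^sub>R b j" by metis
  have o: "hprod (b i) (b j) = (if i = j then 1 else 0)" for i j
    using B(1) b by (auto simp: eigen_orthonormal_def bij_betw_def inj_on_def)
  define P :: "complex^'n^'n" where "P = (\<chi> i j. b j $ i)"
  have "adjoint_matrix P ** P = mat 1"
    using o by (simp add: vec_eq_iff matrix_matrix_mult_def adjoint_matrix_def P_def hprod_def mat_def)
  moreover from this have PP: "P ** adjoint_matrix P = mat 1"
    by (simp add: matrix_left_right_inverse)
  ultimately have u: "unitary_matrix P" by (simp add: unitary_matrix_def)
  have "A ** P = P ** real_diag l"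
  proof -
    have "(A ** P) $ i $ j = (P ** real_diag l) $ i $ j" for i j
    proof -
      have "(A ** P) $ i $ j = (A *v b j) $ i"
        by (simp add: matrix_matrix_mult_def matrix_vector_mult_def P_def)
      also have "\<dots> = of_real (l j) * b j $ i"
        by (simp add: l scaleR_conv_of_real[where 'a=complex])
      also have "\<dots> = (P ** real_diag l) $ i $ j"
        by (simp add: matrix_matrix_mult_def real_diag_def P_def if_distrib cong: if_cong)
      finally show ?thesis .
    qed
    then show ?thesis by (simp add: vec_eq_iff)
  qed
  then have "A = P ** real_diag l ** adjoint_matrix P"
    by (metis PP matrix_mul_assoc matrix_mul_rid)
  then show ?thesis using that u by (auto simp: diagonalizes_def)
qed


section \<open>Functional calculus of unitarily diagonalized matrices\<close>

definition unitary_conj :: "complex^'n^'n \<Rightarrow> ('n \<Rightarrow> real) \<Rightarrow> complex^'n^'n" where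
  "unitary_conj P l = P ** real_diag l ** adjoint_matrix P"

lemma unitary_conj_nth:
  "unitary_conj P l $ i $ j = (\<Sum>k\<in>UNIV. P $ i $ k * of_real (l k) * cnj (P $ j $ k))"
  by (simp add: unitary_conj_def matrix_matrix_mult_def real_diag_def adjoint_matrix_def
      if_distrib cong: if_cong)

lemma unitary_conj_add: "unitary_conj P a + unitary_conj P b = unitary_conj P (\<lambda>i. a i + b i)"
  by (simp add: vec_eq_iff unitary_conj_nth sum.distrib[symmetric] algebra_simps)

lemma unitary_conj_diff: "unitary_conj P a - unitary_conj P b = unitary_conj P (\<lambda>i. a i - b i)"
  by (simp add: vec_eq_iff unitary_conj_nth sum_subtractf[symmetric] algebra_simps)

lemma unitary_conj_scaleR: "c *\<^sub>R unitary_conj P a = unitary_conj P (\<lambda>i. c * a i)"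
  unfolding vec_eq_iff
  by (simp add: unitary_conj_nth scaleR_conv_of_real[where 'a=complex] sum_distrib_left mult_ac)

lemma unitary_conj_sum:
  "(\<Sum>k\<in>K. unitary_conj P (a k)) = unitary_conj P (\<lambda>i. \<Sum>k\<in>K. a k i)"
  by (induction K rule: infinite_finite_induct)
    (simp_all add: unitary_conj_add, simp_all add: vec_eq_iff unitary_conj_nth)

lemma unitary_conj_1:
  fixes P :: "complex^'n^'n"
  shows "unitary_matrix P \<Longrightarrow> unitary_conj P (\<lambda>i. 1) = mat 1"
proof -
  assume "unitary_matrix P"
  moreover have "real_diag (\<lambda>i. 1) = (mat 1 :: complex^'n^'n)"
    by (simp add: real_diag_def mat_def vec_eq_iff)
  ultimately show ?thesis unfolding unitary_conj_def unitary_matrix_def by simp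
qed

lemma real_diag_mult: "real_diag a ** real_diag b = real_diag (\<lambda>i. a i * b i)"
  by (simp add: vec_eq_iff matrix_matrix_mult_def real_diag_def if_distrib[of "\<lambda>x. _ * x"]
      if_distrib[of "\<lambda>x. x * _"] cong: if_cong)

lemma unitary_conj_mult:
  assumes "unitary_matrix P"
  shows "unitary_conj P a ** unitary_conj P b = unitary_conj P (\<lambda>i. a i * b i)"
proof -
  have "unitary_conj P a ** unitary_conj P b =
      P ** real_diag a ** (adjoint_matrix P ** P) ** real_diag b ** adjoint_matrix P"
    by (simp add: unitary_conj_def matrix_mul_assoc)
  also have "\<dots> = P ** (real_diag a ** real_diag b) ** adjoint_matrix P"
    using assms by (simp add: unitary_matrix_def matrix_mul_assoc)
  finally show ?thesis by (simp add: real_diag_mult unitary_conj_def)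
qed

text \<open>The matrix \<open>X = P'\<^sup>* P\<close> intertwines the two diagonal matrices, so \<open>X\<^sub>i\<^sub>j\<close> vanishes unless
  the \<open>i\<close>-th and the \<open>j\<close>-th eigenvalue agree.\<close>

lemma unitary_conj_functional_calculus:
  assumes P: "unitary_matrix P" and P': "unitary_matrix P'"
    and eq: "unitary_conj P l = unitary_conj P' l'"
  shows "unitary_conj P (\<lambda>i. f (l i)) = unitary_conj P' (\<lambda>i. f (l' i))"
proof -
  define X where "X = adjoint_matrix P' ** P"
  have PP: "P ** adjoint_matrix P = mat 1" "adjoint_matrix P ** P = mat 1"
    and PP': "P' ** adjoint_matrix P' = mat 1" "adjoint_matrix P' ** P' = mat 1"
    using P P' by (auto simp: unitary_matrix_def)
  have "adjoint_matrix P' ** unitary_conj P l ** P = adjoint_matrix P' ** unitary_conj P' l' ** P"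
    by (simp add: eq)
  moreover have "adjoint_matrix P' ** unitary_conj P l ** P = X ** real_diag l"
    unfolding unitary_conj_def X_def matrix_mul_assoc[symmetric] PP(2) by simp
  moreover have "adjoint_matrix P' ** unitary_conj P' l' ** P = real_diag l' ** X"
    unfolding unitary_conj_def X_def matrix_mul_assoc PP'(2) by simp
  ultimately have X: "X ** real_diag l = real_diag l' ** X" by simp
  have e: "X $ i $ j * of_real (l j) = of_real (l' i) * X $ i $ j" for i j
    using arg_cong[OF X, of "\<lambda>A. A $ i $ j"]
    by (simp add: matrix_matrix_mult_def real_diag_def if_distrib[of "\<lambda>x. _ * x"]
        if_distrib[of "\<lambda>x. x * _"] cong: if_cong)
  \<comment> \<open>A nonzero entry forces \<open>l j = l' i\<close>, and then \<open>f\<close>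
    takes the same value at both.\<close>
  have "X $ i $ j * of_real (f (l j)) = of_real (f (l' i)) * X $ i $ j" for i j
    using e[of i j] by (cases "X $ i $ j = 0") auto
  then have fX: "X ** real_diag (\<lambda>i. f (l i)) = real_diag (\<lambda>i. f (l' i)) ** X"
    by (simp add: vec_eq_iff matrix_matrix_mult_def real_diag_def if_distrib[of "\<lambda>x. _ * x"]
        if_distrib[of "\<lambda>x. x * _"] cong: if_cong)
  have "unitary_conj P (\<lambda>i. f (l i)) = P' ** (X ** real_diag (\<lambda>i. f (l i))) ** adjoint_matrix P"
    unfolding unitary_conj_def X_def matrix_mul_assoc PP'(1) by simp
  also have "\<dots> = unitary_conj P' (\<lambda>i. f (l' i))"
    unfolding fX unfolding unitary_conj_def X_def matrix_mul_assoc[symmetric] PP(1) by simp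
  finally show ?thesis .
qed

text \<open>Well-definedness of the description in \<open>matrix_powr\<close>: two diagonalizations
  of one matrix give the same value by \<open>unitary_conj_functional_calculus\<close> for
  \<open>\<lambda>x. x powr r\<close>.\<close>

lemma matrix_powr_unitary_conj:
  assumes "unitary_matrix P"
  shows "matrix_powr (unitary_conj P l) r = unitary_conj P (\<lambda>i. l i powr r)"
  unfolding matrix_powr_def unitary_conj_def[symmetric]
proof (rule the_equality)
  show "\<exists>P' l'. unitary_matrix P' \<and> unitary_conj P l = unitary_conj P' l' \<and>
      unitary_conj P (\<lambda>i. l i powr r) = unitary_conj P' (\<lambda>i. l' i powr r)"
    using assms by blast
next
  fix B
  assume "\<exists>P' l'. unitary_matrix P' \<and> unitary_conj P l = unitary_conj P' l' \<and>
      B = unitary_conj P' (\<lambda>i. l' i powr r)"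
  then obtain P' l' where "unitary_matrix P'" "unitary_conj P l = unitary_conj P' l'"
    and B: "B = unitary_conj P' (\<lambda>i. l' i powr r)" by blast
  from unitary_conj_functional_calculus[OF assms this(1,2), of "\<lambda>x. x powr r"]
  show "B = unitary_conj P (\<lambda>i. l i powr r)" by (simp add: B)
qed

lemma norm_vec_le_sum: "norm (x :: 'a::real_normed_vector ^ 'n) \<le> (\<Sum>i\<in>UNIV. norm (x $ i))"
  by (simp add: norm_vec_def L2_set_le_sum)

text \<open>A bound for the eigenvalues that is evidently continuous in the matrix; it fixes the
  scale of the binomial series below.\<close>

definition entry_norm :: "complex^'n^'n \<Rightarrow> real" where
  "entry_norm A = (\<Sum>i\<in>UNIV. \<Sum>j\<in>UNIV. norm (A $ i $ j))"

lemma entry_norm_nonneg: "0 \<le> entry_norm A"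
  by (simp add: entry_norm_def sum_nonneg)

lemma norm_matrix_vector_mult_le: "norm (A *v v) \<le> entry_norm A * norm v"
proof -
  have "norm ((A *v v) $ i) \<le> (\<Sum>j\<in>UNIV. norm (A $ i $ j)) * norm v" for i
    unfolding matrix_vector_mult_def
    by (auto simp: sum_distrib_right norm_mult intro!: sum_norm_le mult_left_mono Finite_Cartesian_Product.norm_nth_le)
  then have "(\<Sum>i\<in>UNIV. norm ((A *v v) $ i)) \<le> entry_norm A * norm v"
    by (simp add: entry_norm_def sum_distrib_right sum_mono)
  then show ?thesis using norm_vec_le_sum[of "A *v v"] by linarith
qed

text \<open>The columns of \<open>P\<close> are unit eigenvectors, so positivity and size of each
  \<open>l i\<close> can be read off by applying \<open>A\<close> to a column.\<close>

lemma positive_definite_unitary_conj: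
  fixes A :: "complex^'n^'n"
  assumes "positive_definite A"
  obtains P l where "unitary_matrix P" "A = unitary_conj P l" "\<And>i. 0 < l i" "\<And>i. l i \<le> entry_norm A"
proof -
  obtain P l where P: "unitary_matrix P" and A: "A = unitary_conj P l"
    using self_adjoint_diagonalizable[of A] assms
    unfolding positive_definite_def diagonalizes_def unitary_conj_def by metis
  have "0 < l i \<and> l i \<le> entry_norm A" for i
  proof -
    define v where "v = P *v axis i 1"
    have Pv: "adjoint_matrix P *v v = axis i 1"
      using P by (simp add: v_def unitary_matrix_def matrix_vector_mul_assoc)
    have "real_diag l *v axis i 1 = of_real (l i) *s (axis i 1 :: complex^'n)"
      by (simp add: vec_eq_iff matrix_vector_mult_def real_diag_def axis_def if_distrib[of "\<lambda>x. _ * x"]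
          if_distrib[of "\<lambda>x. x * _"] cong: if_cong)
    then have "A *v v = of_real (l i) *s v"
      by (simp add: A unitary_conj_def matrix_vector_mul_assoc[symmetric] Pv)
        (simp add: v_def vector_scalar_commute)
    then have Av: "A *v v = l i *\<^sub>R v"
      by (simp add: vec_eq_iff scaleR_conv_of_real[where 'a=complex])
    have "hprod v v = hprod (adjoint_matrix P *v v) (axis i 1)"
      by (simp add: hprod_adjoint[symmetric] v_def)
    also have "\<dots> = 1" unfolding Pv
      by (simp add: hprod_def axis_def if_distrib cong: if_cong)
    finally have vv: "v \<bullet> v = 1" by (simp add: inner_eq_Re_hprod)
    then have "v \<noteq> 0" by auto
    then have "0 < l i" using assms Av vv by (auto simp: positive_definite_def)
    moreover have "l i \<le> entry_norm A"
      using norm_matrix_vector_mult_le[of A v] vv \<open>0 < l i\<close> by (simp add: Av norm_eq_1[symmetric])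
    ultimately show ?thesis by simp
  qed
  then show ?thesis using that P A by blast
qed

lemma matrix_powr_add:
  assumes "positive_definite A"
  shows "matrix_powr A r ** matrix_powr A s = matrix_powr A (r + s)"
proof -
  obtain P l where P: "unitary_matrix P" and A: "A = unitary_conj P l"
    using positive_definite_unitary_conj[OF assms] by metis
  show ?thesis
    by (simp add: A matrix_powr_unitary_conj[OF P] unitary_conj_mult[OF P] powr_add)
qed

lemma matrix_powr_0: "positive_definite A \<Longrightarrow> matrix_powr A 0 = mat 1"
proof -
  assume "positive_definite A"
  then obtain P l where P: "unitary_matrix P" and A: "A = unitary_conj P l" and l: "\<And>i. 0 < l i"
    using positive_definite_unitary_conj by metis
  have "l i \<noteq> 0" for i using l[of i] by simp
  then show ?thesis by (simp add: A matrix_powr_unitary_conj[OF P] unitary_conj_1[OF P])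
qed

section \<open>Borel measurability of matrix powers\<close>

primrec matrix_pow :: "complex^'n^'n \<Rightarrow> nat \<Rightarrow> complex^'n^'n" where
  "matrix_pow A 0 = mat 1"
| "matrix_pow A (Suc k) = A ** matrix_pow A k"

lemma matrix_pow_unitary_conj:
  assumes "unitary_matrix P"
  shows "matrix_pow (unitary_conj P l) k = unitary_conj P (\<lambda>i. l i ^ k)"
  by (induction k) (simp_all add: unitary_conj_1[OF assms] unitary_conj_mult[OF assms])

text \<open>Partial sums of the binomial series for \<open>m powr r * (1 + z) powr r\<close> at
  \<open>z = A / m - 1\<close>, where \<open>m = 1 + entry_norm A\<close>. The added 1 keeps the
  eigenvalues of \<open>A / m\<close> strictly between 0 and 1 for positive definite
  \<open>A\<close>, and \<open>m\<close> away from 0.\<close>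

definition binomial_powr :: "real \<Rightarrow> nat \<Rightarrow> complex^'n^'n \<Rightarrow> complex^'n^'n" where
  "binomial_powr r K A = (1 + entry_norm A) powr r *\<^sub>R
     (\<Sum>k<K. (r gchoose k) *\<^sub>R matrix_pow ((1 / (1 + entry_norm A)) *\<^sub>R A - mat 1) k)"

lemma binomial_powr_tendsto:
  fixes A :: "complex^'n^'n"
  assumes "positive_definite A"
  shows "(\<lambda>K. binomial_powr r K A) \<longlonglongrightarrow> matrix_powr A r"
proof -
  obtain P l where P: "unitary_matrix P" and A: "A = unitary_conj P l"
    and l: "\<And>i. 0 < l i" "\<And>i. l i \<le> entry_norm A"
    using positive_definite_unitary_conj[OF assms] by blast
  define m where "m = 1 + entry_norm A"
  have m: "m > 0" "\<And>i. l i < m"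
    using l entry_norm_nonneg[of A] le_less_trans[OF l(2)] by (simp_all add: m_def)
  define z where "z i = l i / m - 1" for i
  have "(1 / m) *\<^sub>R A - mat 1 = unitary_conj P z"
    by (simp add: A unitary_conj_1[OF P, symmetric] unitary_conj_scaleR unitary_conj_diff z_def[abs_def])
  then have b: "binomial_powr r K A = unitary_conj P (\<lambda>i. m powr r * (\<Sum>k<K. (r gchoose k) * z i ^ k))" for K
    by (simp add: binomial_powr_def m_def[symmetric] matrix_pow_unitary_conj[OF P] unitary_conj_scaleR
        unitary_conj_sum)
  have lim: "(\<lambda>K. m powr r * (\<Sum>k<K. (r gchoose k) * z i ^ k)) \<longlonglongrightarrow> l i powr r" for i
  proof -
    have "0 < l i / m" "l i / m < 1"
      using m(1) m(2)[of i] l(1)[of i] by (simp_all add: divide_less_eq)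
    then have "\<bar>z i\<bar> < 1" by (simp add: z_def abs_less_iff)
    from gen_binomial_real[OF this, of r]
    have "(\<lambda>K. \<Sum>k<K. (r gchoose k) * z i ^ k) \<longlonglongrightarrow> (1 + z i) powr r"
      by (simp add: sums_def)
    then have "(\<lambda>K. m powr r * (\<Sum>k<K. (r gchoose k) * z i ^ k)) \<longlonglongrightarrow> m powr r * (1 + z i) powr r"
      by (rule tendsto_mult_left)
    also have "m powr r * (1 + z i) powr r = l i powr r"
    proof -
      have "m powr r * (1 + z i) powr r = (m * (1 + z i)) powr r"
        using m l(1)[of i] by (subst powr_mult) (simp_all add: z_def)
      then show ?thesis using m by (simp add: z_def)
    qed
    finally show ?thesis .
  qed
  have "(\<lambda>K. binomial_powr r K A) \<longlonglongrightarrow> unitary_conj P (\<lambda>i. l i powr r)"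
    unfolding b
    by (intro vec_tendstoI) (simp only: unitary_conj_nth, intro tendsto_sum tendsto_mult tendsto_const tendsto_of_real lim)
  then show ?thesis by (simp add: A matrix_powr_unitary_conj[OF P])
qed

lemma continuous_on_matrix_mult [continuous_intros]:
  fixes f g :: "'a::topological_space \<Rightarrow> complex^'n^'n"
  assumes "continuous_on S f" "continuous_on S g"
  shows "continuous_on S (\<lambda>x. f x ** g x)"
  unfolding matrix_matrix_mult_def by (intro continuous_intros assms)

lemma continuous_on_entry_norm [continuous_intros]:
  fixes f :: "'a::topological_space \<Rightarrow> complex^'n^'n"
  assumes "continuous_on S f"
  shows "continuous_on S (\<lambda>x. entry_norm (f x))"
  unfolding entry_norm_def by (intro continuous_intros assms)

lemma continuous_on_binomial_powr:
  "continuous_on S (binomial_powr r K :: complex^'n^'n \<Rightarrow> _)"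
proof -
  have p: "continuous_on S (\<lambda>A. matrix_pow (f A) k)" if "continuous_on S f"
    for f :: "complex^'n^'n \<Rightarrow> complex^'n^'n" and k
    proof (induction k)
    case 0
    show ?case by simp
  next
    case (Suc k)
    show ?case unfolding matrix_pow.simps by (rule continuous_on_matrix_mult[OF that Suc])
  qed
  have "1 + entry_norm A \<noteq> 0" for A :: "complex^'n^'n"
    using entry_norm_nonneg[of A] by linarith
  then show ?thesis
    unfolding binomial_powr_def by (intro continuous_intros p) auto
qed

text \<open>A measurable choice of diagonalizations is avoided: the power is a pointwise limit of
  continuous functions of the matrix.\<close>

lemma borel_measurable_matrix_powr:
  assumes A: "A \<in> borel_measurable M" and pd: "\<And>x. positive_definite (A x)"
  shows "(\<lambda>x. matrix_powr (A x) r) \<in> borel_measurable M"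
proof (rule borel_measurable_LIMSEQ_metric)
  show "(\<lambda>x. binomial_powr r K (A x)) \<in> borel_measurable M" for K
    by (rule borel_measurable_continuous_on[OF continuous_on_binomial_powr A])
  show "(\<lambda>K. binomial_powr r K (A x)) \<longlonglongrightarrow> matrix_powr (A x) r" for x
    by (rule binomial_powr_tendsto[OF pd])
qed

lemma op_norm_bound: "norm (A *v v) \<le> op_norm A * norm v"
  unfolding op_norm_def by (rule onorm) (simp add: matrix_vector_mul_bounded_linear)

section \<open>Young functions and Orlicz norms\<close>

lemma young_function_nonneg: "young_function \<Phi> \<Longrightarrow> 0 \<le> s \<Longrightarrow> 0 \<le> \<Phi> s"
  using mono_onD[of "{0..}" \<Phi> 0 s] by (simp add: young_function_def)

lemma young_function_mono: "young_function \<Phi> \<Longrightarrow> 0 \<le> s \<Longrightarrow> s \<le> t \<Longrightarrow> \<Phi> s \<le> \<Phi> t"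
  using mono_onD[of "{0..}" \<Phi> s t] by (simp add: young_function_def)

text \<open>Superlinear growth: from some \<open>s0\<close> on, \<open>\<Phi> s\<close> is at least
  \<open>s * t\<close>, and below \<open>s0\<close> the expression is bounded trivially. This is
  what gives the real supremum in \<open>young_associate\<close> its meaning.\<close>

lemma young_associate_bdd_above:
  assumes "young_function \<Phi>"
  shows "bdd_above ((\<lambda>s. s * t - \<Phi> s) ` {0<..})"
proof -
  have "eventually (\<lambda>s. t \<le> \<Phi> s / s) at_top"
    using assms unfolding young_function_def filterlim_at_top by blast
  then obtain s0 where s0: "\<And>s. s0 \<le> s \<Longrightarrow> t \<le> \<Phi> s / s"
    unfolding eventually_at_top_linorder by blast
  have "s * t - \<Phi> s \<le> \<bar>s0\<bar> * \<bar>t\<bar>" if "s > 0" for s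
  proof (cases "s0 \<le> s")
    case True
    then have "s * t \<le> \<Phi> s" using s0[of s] that by (simp add: field_simps)
    then show ?thesis using mult_nonneg_nonneg[of "\<bar>s0\<bar>" "\<bar>t\<bar>"] by linarith
  next
    case False
    then have "s * t \<le> \<bar>s0\<bar> * \<bar>t\<bar>"
      using that mult_left_mono[OF abs_ge_self[of t], of s] mult_right_mono[of s "\<bar>s0\<bar>" "\<bar>t\<bar>"]
      by linarith
    then show ?thesis using young_function_nonneg[OF assms, of s] that by linarith
  qed
  then show ?thesis by (intro bdd_aboveI2[where M = "\<bar>s0\<bar> * \<bar>t\<bar>"]) simp
qed

lemma young_associate_upper:
  assumes "young_function \<Phi>" "0 < s"
  shows "s * t - \<Phi> s \<le> young_associate \<Phi> t"
  unfolding young_associate_def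
  using cSUP_upper[of s "{0<..}" "\<lambda>s. s * t - \<Phi> s"] young_associate_bdd_above[OF assms(1)] assms(2)
  by simp

lemma young_associate_least:
  assumes "\<And>s. 0 < s \<Longrightarrow> s * t - \<Phi> s \<le> c"
  shows "young_associate \<Phi> t \<le> c"
  unfolding young_associate_def
  using cSUP_least[of "{0<..}" "\<lambda>s. s * t - \<Phi> s" c] assms
  by simp

text \<open>The supremum runs over \<open>s > 0\<close>, so the value 0 is approached from small
  \<open>s\<close>: convexity gives \<open>\<Phi> s \<le> s * \<Phi> 1\<close> for
  \<open>s \<le> 1\<close>, and \<open>s * (t - \<Phi> 1)\<close> tends to 0 with
  \<open>s\<close>.\<close>

lemma young_associate_nonneg:
  assumes Y: "young_function \<Phi>"
  shows "0 \<le> young_associate \<Phi> t"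
proof (rule ccontr)
  define a where "a = - young_associate \<Phi> t"
  define c where "c = \<bar>t - \<Phi> 1\<bar> + 1"
  assume "\<not> 0 \<le> young_associate \<Phi> t"
  then have a: "a > 0" by (simp add: a_def)
  have c: "c > 0" by (simp add: c_def)
  \<comment> \<open>Chosen so that \<open>s * c\<close> is at most half of \<open>a\<close>, whereas
    a supremum equal to \<open>- a\<close> would force it to be at least \<open>a\<close>.\<close>
  define s where "s = min 1 (a / (2 * c))"
  have s: "0 < s" "s \<le> 1" "s * c \<le> a / 2"
    using a c mult_right_mono[of s "a / (2 * c)" c] by (auto simp: s_def)
  have "\<Phi> ((1 - s) *\<^sub>R 0 + s *\<^sub>R 1) \<le> (1 - s) * \<Phi> 0 + s * \<Phi> 1"
    using Y s by (intro convex_onD[where A = "{0..}"]) (auto simp: young_function_def)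
  then have "\<Phi> s \<le> s * \<Phi> 1" using Y by (simp add: young_function_def)
  then have "s * (t - \<Phi> 1) \<le> - a"
    using young_associate_upper[OF Y s(1), of t] by (simp add: a_def algebra_simps)
  moreover have "s * (t - \<Phi> 1) \<ge> - (s * c)"
  proof -
    have "s * (- c) \<le> s * (t - \<Phi> 1)"
      using s(1) by (intro mult_left_mono) (auto simp: c_def)
    then show ?thesis by simp
  qed
  ultimately show False using s(3) a by linarith
qed

lemma young_associate_mono:
  assumes Y: "young_function \<Phi>" and "t \<le> u"
  shows "young_associate \<Phi> t \<le> young_associate \<Phi> u"
proof (rule young_associate_least)
  fix s :: real assume "0 < s"
  then show "s * t - \<Phi> s \<le> young_associate \<Phi> u"
    using young_associate_upper[OF Y, of s u] mult_left_mono[OF \<open>t \<le> u\<close>, of s] by linarith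
qed

text \<open>Stands in for convexity of the associate: since \<open>\<Phi>\<close> is nonnegative,
  the factor \<open>c \<le> 1\<close> can be pulled out of every competitor of the supremum.\<close>

lemma young_associate_scale:
  assumes Y: "young_function \<Phi>" and c: "0 \<le> c" "c \<le> 1"
  shows "young_associate \<Phi> (c * t) \<le> c * young_associate \<Phi> t"
proof (rule young_associate_least)
  fix s :: real assume s: "0 < s"
  have "c * \<Phi> s \<le> 1 * \<Phi> s"
    using c young_function_nonneg[OF Y, of s] s by (intro mult_right_mono) auto
  then have "s * (c * t) - \<Phi> s \<le> c * (s * t - \<Phi> s)" by (simp add: algebra_simps)
  also have "\<dots> \<le> c * young_associate \<Phi> t"
    using young_associate_upper[OF Y s, of t] c by (intro mult_left_mono)
  finally show "s * (c * t) - \<Phi> s \<le> c * young_associate \<Phi> t" .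
qed

lemma young_inequality:
  assumes Y: "young_function \<Phi>" and "0 \<le> s"
  shows "s * t \<le> \<Phi> s + young_associate \<Phi> t"
proof (cases "s = 0")
  case True
  moreover have "\<Phi> 0 = 0" using Y by (simp add: young_function_def)
  ultimately show ?thesis using young_associate_nonneg[OF Y, of t] by simp
next
  case False
  then show ?thesis using young_associate_upper[OF Y, of s t] \<open>0 \<le> s\<close> by simp
qed

lemma borel_measurable_young_associate [measurable]:
  "young_function \<Phi> \<Longrightarrow> young_associate \<Phi> \<in> borel_measurable borel"
  by (rule borel_measurable_mono, rule monoI, rule young_associate_mono)

lemma borel_measurable_young_ennreal:
  assumes Y: "young_function \<Phi>"
  shows "young_ennreal \<Phi> \<in> borel_measurable borel"
proof -
  have m: "mono (\<lambda>t. \<Phi> (max 0 t))"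
  proof (rule monoI)
    fix t u :: real assume "t \<le> u"
    then show "\<Phi> (max 0 t) \<le> \<Phi> (max 0 u)"
      by (intro young_function_mono[OF Y]) simp_all
  qed
  have "(\<lambda>t. \<Phi> (max 0 (enn2real t))) \<in> borel_measurable borel"
    by (rule measurable_compose[OF borel_measurable_enn2real[OF measurable_ident_sets[OF refl]]
          borel_measurable_mono[OF m]])
  then have "(\<lambda>t. ennreal (\<Phi> (max 0 (enn2real t)))) \<in> borel_measurable borel"
    by (rule measurable_compose[OF _ measurable_ennreal])
  then have "(\<lambda>t. ennreal (\<Phi> (enn2real t))) \<in> borel_measurable borel"
    by (simp only: max_absorb2[OF enn2real_nonneg])
  then show ?thesis
    unfolding young_ennreal_def[abs_def] by (intro measurable_If borel_measurable_const) simp_all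
qed

text \<open>Young's inequality for \<open>F y / c\<close> and \<open>G y / d\<close>, integrated;
  the factor 2 counts the two modulars, each at most the measure of \<open>Q\<close>. Admissible
  numbers \<open>c\<close> and \<open>d\<close> take the place of norms, so no infimum has to be
  attained. \<open>F\<close> is \<open>ennreal\<close>-valued because in the outer application it is
  itself an integral.\<close>

lemma orlicz_holder:
  fixes F :: "'a::euclidean_space \<Rightarrow> ennreal"
  assumes Y: "young_function \<Phi>"
    and F [measurable]: "F \<in> borel_measurable borel" and G [measurable]: "G \<in> borel_measurable borel"
    and G0: "\<And>y. 0 \<le> G y" and Q [measurable]: "Q \<in> sets borel"
    and c: "0 < c" and d: "0 < d"
    and IF: "(\<integral>\<^sup>+ y\<in>Q. young_ennreal \<Phi> (F y / ennreal c) \<partial>lborel) \<le> emeasure lborel Q"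
    and IG: "(\<integral>\<^sup>+ y\<in>Q. ennreal (young_associate \<Phi> (G y / d)) \<partial>lborel) \<le> emeasure lborel Q"
  shows "(\<integral>\<^sup>+ y\<in>Q. F y * ennreal (G y) \<partial>lborel) \<le> ennreal (2 * c * d) * emeasure lborel Q"
proof -
  define a where "a y = young_ennreal \<Phi> (F y / ennreal c)" for y
  define b where "b y = ennreal (young_associate \<Phi> (G y / d))" for y
  have Fc: "(\<lambda>y. F y / ennreal c) \<in> borel_measurable borel"
    and Gd: "(\<lambda>y. G y / d) \<in> borel_measurable borel"
    by measurable
  have [measurable]: "a \<in> borel_measurable borel"
    unfolding a_def[abs_def] by (rule measurable_compose[OF Fc borel_measurable_young_ennreal[OF Y]])
  have [measurable]: "b \<in> borel_measurable borel"
    unfolding b_def[abs_def]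
    by (rule measurable_compose[OF measurable_compose[OF Gd borel_measurable_young_associate[OF Y]] measurable_ennreal])
  have pw: "F y * ennreal (G y) \<le> ennreal (c * d) * (a y + b y)" for y
  proof (cases "F y")
    case (real f)
    have "f * G y = (c * d) * ((f / c) * (G y / d))" using c d by simp
    also have "\<dots> \<le> (c * d) * (\<Phi> (f / c) + young_associate \<Phi> (G y / d))"
      using c d real by (intro mult_left_mono young_inequality Y) auto
    finally have le: "ennreal (f * G y) \<le> ennreal ((c * d) * (\<Phi> (f / c) + young_associate \<Phi> (G y / d)))"
      by (rule ennreal_leI)
    have "0 \<le> \<Phi> (f / c)"
      using real c by (intro young_function_nonneg[OF Y]) auto
    then have "ennreal ((c * d) * (\<Phi> (f / c) + young_associate \<Phi> (G y / d))) =
        ennreal (c * d) * (ennreal (\<Phi> (f / c)) + ennreal (young_associate \<Phi> (G y / d)))"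
      using young_associate_nonneg[OF Y] c d
      by (subst ennreal_mult) (auto simp: ennreal_plus)
    moreover have "young_ennreal \<Phi> (F y / ennreal c) = ennreal (\<Phi> (f / c))"
      using real c by (simp add: young_ennreal_def divide_ennreal)
    moreover have "F y * ennreal (G y) = ennreal (f * G y)"
      using real G0[of y] by (simp add: ennreal_mult)
    ultimately show ?thesis using le by (simp only: a_def b_def)
  next
    case top
    then have "a y = \<infinity>" by (simp add: a_def young_ennreal_def ennreal_top_divide)
    then show ?thesis using c d by (simp add: ennreal_mult_top)
  qed
  have "(\<integral>\<^sup>+ y\<in>Q. F y * ennreal (G y) \<partial>lborel) \<le> (\<integral>\<^sup>+ y.
      ennreal (c * d) * (a y * indicator Q y + b y * indicator Q y) \<partial>lborel)"
  proof (rule nn_integral_mono)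
    fix y
    show "F y * ennreal (G y) * indicator Q y \<le> ennreal (c * d) * (a y * indicator Q y + b y * indicator Q y)"
      using pw[of y]
      by (cases "y \<in> Q") simp_all
  qed
  also have "\<dots> = ennreal (c * d) * ((\<integral>\<^sup>+ y\<in>Q. a y \<partial>lborel) + (\<integral>\<^sup>+ y\<in>Q. b y \<partial>lborel))"
  proof -
    have ai: "(\<lambda>y. a y * indicator Q y) \<in> borel_measurable lborel"
      and bi: "(\<lambda>y. b y * indicator Q y) \<in> borel_measurable lborel"
      by measurable
    show ?thesis
      unfolding nn_integral_cmult[OF borel_measurable_add[OF ai bi]] nn_integral_add[OF ai bi] ..
  qed
  also have "\<dots> \<le> ennreal (c * d) * (emeasure lborel Q + emeasure lborel Q)"
    by (intro mult_left_mono add_mono IF[folded a_def] IG[folded b_def] zero_le)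
  also have "\<dots> = ennreal (2 * c * d) * emeasure lborel Q"
  proof -
    have "2 * c * d = c * d + c * d" by simp
    then have "ennreal (2 * c * d) = ennreal (c * d) + ennreal (c * d)"
      using c d by (simp only: ennreal_plus mult_nonneg_nonneg less_imp_le)
    then show ?thesis by (simp only: distrib_left distrib_right)
  qed
  finally show ?thesis .
qed

text \<open>The real-valued counterpart of the Orlicz norm; it is used for bounded functions only, for
  which the infimum is over a nonempty set.\<close>

definition luxemburg :: "(real \<Rightarrow> real) \<Rightarrow> 'a::euclidean_space set \<Rightarrow> ('a \<Rightarrow> real) \<Rightarrow> real" where
  "luxemburg A T g = Inf {s. 0 < s \<and> (\<integral>\<^sup>+ x\<in>T. ennreal (A (g x / s)) \<partial>lborel) \<le> emeasure lborel T}"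

lemma luxemburg_nonneg:
  assumes "\<exists>s>0. (\<integral>\<^sup>+ x\<in>T. ennreal (A (g x / s)) \<partial>lborel) \<le> emeasure lborel T"
  shows "0 \<le> luxemburg A T g"
  unfolding luxemburg_def using assms by (intro cInf_greatest) (blast, simp)

text \<open>Monotonicity makes every number above the infimum admissible, so it does not matter
  whether the infimum is attained.\<close>

lemma luxemburg_less_imp:
  assumes A: "\<And>t u. 0 \<le> t \<Longrightarrow> t \<le> u \<Longrightarrow> A t \<le> A u" and g: "\<And>x. 0 \<le> g x"
    and ne: "\<exists>s>0. (\<integral>\<^sup>+ x\<in>T. ennreal (A (g x / s)) \<partial>lborel) \<le> emeasure lborel T"
    and s: "luxemburg A T g < s"
  shows "(\<integral>\<^sup>+ x\<in>T. ennreal (A (g x / s)) \<partial>lborel) \<le> emeasure lborel T"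
proof -
  define S where "S = {s. 0 < s \<and> (\<integral>\<^sup>+ x\<in>T. ennreal (A (g x / s)) \<partial>lborel) \<le> emeasure lborel T}"
  have "S \<noteq> {}" using ne unfolding S_def by blast
  then obtain u where "u \<in> S" "u < s"
    using cInf_lessD[of S s] s unfolding luxemburg_def S_def[symmetric] by blast
  then have u: "u < s" "0 < u" "(\<integral>\<^sup>+ x\<in>T. ennreal (A (g x / u)) \<partial>lborel) \<le> emeasure lborel T"
    unfolding S_def by simp_all
  have "(\<integral>\<^sup>+ x\<in>T. ennreal (A (g x / s)) \<partial>lborel) \<le> (\<integral>\<^sup>+ x\<in>T. ennreal (A (g x / u)) \<partial>lborel)"
  proof (rule nn_integral_mono)
    fix x
    have "g x / s \<le> g x / u"
      using u(1,2) g[of x] by (intro divide_left_mono) simp_all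
    then have "A (g x / s) \<le> A (g x / u)"
      using u(1,2) g[of x] by (intro A) simp_all
    then show "ennreal (A (g x / s)) * indicator T x \<le> ennreal (A (g x / u)) * indicator T x"
      by (intro mult_right_mono ennreal_leI) simp_all
  qed
  then show ?thesis using u(3) by (rule order_trans)
qed

lemma less_luxemburg_imp:
  assumes "0 < s" "s < luxemburg A T g"
  shows "emeasure lborel T < (\<integral>\<^sup>+ x\<in>T. ennreal (A (g x / s)) \<partial>lborel)"
proof (rule ccontr)
  assume "\<not> ?thesis"
  then have "luxemburg A T g \<le> s"
    unfolding luxemburg_def using assms(1)
    by (intro cInf_lower bdd_belowI[where m = 0]) simp_all
  with assms(2) show False by simp
qed

lemma luxemburg_exists:
  assumes Y: "young_function \<Phi>" and g: "\<And>x. 0 \<le> g x" "\<And>x. g x \<le> R" and T: "T \<in> sets borel"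
  shows "\<exists>s>0. (\<integral>\<^sup>+ x\<in>T. ennreal (young_associate \<Phi> (g x / s)) \<partial>lborel) \<le> emeasure lborel T"
proof -
  \<comment> \<open>With these choices \<open>g x / s\<close> is at most \<open>1 / b\<close>, and
    \<open>young_associate_scale\<close> bounds the associate there by its value at 1 divided by
    \<open>b\<close>, which is at most 1.\<close>
  define b where "b = young_associate \<Phi> 1 + 1"
  define s where "s = (R + 1) * b"
  have b: "b > 0" using young_associate_nonneg[OF Y, of 1] by (simp add: b_def)
  have R: "R + 1 > 0" using g[of undefined] by linarith
  have s: "s > 0" using b R by (simp add: s_def)
  have "young_associate \<Phi> (g x / s) \<le> 1" for x
  proof -
    have "g x / s \<le> (R + 1) / s"
      using g(2)[of x] s by (intro divide_right_mono) auto
    also have "\<dots> = (1 / b) * 1" using R by (simp add: s_def)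
    finally have "young_associate \<Phi> (g x / s) \<le> young_associate \<Phi> ((1 / b) * 1)"
      by (rule young_associate_mono[OF Y])
    also have "\<dots> \<le> (1 / b) * young_associate \<Phi> 1"
      using b young_associate_nonneg[OF Y, of 1] by (intro young_associate_scale[OF Y]) (auto simp: b_def)
    also have "\<dots> \<le> 1" using b by (simp add: b_def)
    finally show ?thesis .
  qed
  then have "(\<integral>\<^sup>+ x\<in>T. ennreal (young_associate \<Phi> (g x / s)) \<partial>lborel) \<le> (\<integral>\<^sup>+ x. indicator T x \<partial>lborel)"
    by (intro nn_integral_mono) (simp add: indicator_def)
  also have "\<dots> \<le> emeasure lborel T"
    using T by simp
  finally show ?thesis using s by blast
qed

section \<open>Seminorms and stopping cells\<close>

definition seminorm :: "('a::real_vector \<Rightarrow> real) \<Rightarrow> bool" where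
  "seminorm N \<longleftrightarrow> (\<forall>u v. N (u + v) \<le> N u + N v) \<and> (\<forall>c v. N (c *\<^sub>R v) = \<bar>c\<bar> * N v)"

lemma seminorm_add: "seminorm N \<Longrightarrow> N (u + v) \<le> N u + N v"
  and seminorm_scaleR: "seminorm N \<Longrightarrow> N (c *\<^sub>R v) = \<bar>c\<bar> * N v"
  by (simp_all add: seminorm_def)

lemma seminorm_0: "seminorm N \<Longrightarrow> N 0 = 0"
  using seminorm_scaleR[of N 0 0] by simp

lemma seminorm_minus: "seminorm N \<Longrightarrow> N (- v) = N v"
  using seminorm_scaleR[of N "-1" v] by simp

lemma seminorm_nonneg: "seminorm N \<Longrightarrow> 0 \<le> N v"
  using seminorm_add[of N v "- v"] seminorm_minus[of N v] seminorm_0[of N] by simp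

lemma seminorm_sum_le:
  assumes "seminorm N" "finite E"
  shows "N (\<Sum>e\<in>E. c e *\<^sub>R e) \<le> (\<Sum>e\<in>E. \<bar>c e\<bar> * N e)"
  using assms(2)
proof induction
  case (insert x E)
  then show ?case
    using seminorm_add[OF assms(1), of "c x *\<^sub>R x" "\<Sum>e\<in>E. c e *\<^sub>R e"]
    by (simp add: seminorm_scaleR[OF assms(1)])
qed (simp add: seminorm_0[OF assms(1)])

lemma seminorm_kernel_subspace: "seminorm N \<Longrightarrow> subspace {v. N v = 0}"
  unfolding subspace_def
  by (auto simp: seminorm_0 seminorm_scaleR)
    (metis add.right_neutral order_antisym seminorm_add seminorm_nonneg)

lemma seminorm_diff_kernel:
  assumes N: "seminorm N" and z: "N z = 0"
  shows "N (v - z) = N v"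
  using seminorm_add[OF N, of "v - z" z] seminorm_add[OF N, of v "- z"] z
  by (simp add: seminorm_minus[OF N])

lemma seminorm_continuous_on:
  fixes N :: "'a::euclidean_space \<Rightarrow> real"
  assumes N: "seminorm N"
  shows "continuous_on S N"
proof -
  define C where "C = (\<Sum>b\<in>Basis. N b) + 1"
  have C: "0 < C" by (simp add: C_def add_nonneg_pos sum_nonneg seminorm_nonneg[OF N])
  have le: "N v \<le> C * norm v" for v
  proof -
    have "N v = N (\<Sum>b\<in>Basis. (v \<bullet> b) *\<^sub>R b)" by (simp add: euclidean_representation)
    also have "\<dots> \<le> (\<Sum>b\<in>Basis. \<bar>v \<bullet> b\<bar> * N b)" by (rule seminorm_sum_le[OF N]) simp
    also have "\<dots> \<le> (\<Sum>b\<in>Basis. norm v * N b)"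
      by (intro sum_mono mult_right_mono seminorm_nonneg[OF N] Basis_le_norm)
    also have "\<dots> \<le> C * norm v" unfolding C_def sum_distrib_left[symmetric] by (simp add: algebra_simps)
    finally show ?thesis .
  qed
  have "dist (N u) (N v) \<le> C * dist u v" for u v
    using seminorm_add[OF N, of "u - v" v] seminorm_add[OF N, of "v - u" u] le[of "u - v"]
      seminorm_minus[OF N, of "u - v"]
    by (simp add: dist_norm abs_le_iff)
  then show ?thesis
    using C by (intro lipschitz_on_continuous_on[of C] lipschitz_onI) simp_all
qed

text \<open>On the orthogonal complement of its kernel \<open>N\<close> is a norm, and
  \<open>k\<close> is its minimum on the compact unit sphere there (or 1 if that sphere is empty);
  \<open>z\<close> is the orthogonal projection of \<open>v\<close> to the kernel.\<close>

lemma seminorm_ge_dist_kernel: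
  fixes N :: "'a::euclidean_space \<Rightarrow> real"
  assumes N: "seminorm N"
  obtains k where "0 < k" "\<And>v. \<exists>z. N z = 0 \<and> k * norm (v - z) \<le> N v"
proof -
  define Z where "Z = {v. N v = 0}"
  define S where "S = {v. \<forall>z\<in>Z. orthogonal v z} \<inter> sphere 0 1"
  have subZ: "subspace Z" unfolding Z_def by (rule seminorm_kernel_subspace[OF N])
  have subO: "subspace {v. \<forall>z\<in>Z. orthogonal v z}"
    by (auto simp: subspace_def orthogonal_clauses)
  have "compact S" by (simp add: S_def closed_Int_compact closed_subspace subO)
  have pos: "0 < N v" if "v \<in> S" for v
  proof -
    have "v \<notin> Z" using that by (force simp: S_def orthogonal_def)
    then show ?thesis using seminorm_nonneg[OF N, of v] by (simp add: Z_def)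
  qed
  obtain k where k: "0 < k" "\<And>v. v \<in> S \<Longrightarrow> k \<le> N v"
  proof (cases "S = {}")
    case True
    then show ?thesis using that[of 1] by auto
  next
    case False
    then obtain v0 where "v0 \<in> S" "\<And>v. v \<in> S \<Longrightarrow> N v0 \<le> N v"
      using continuous_attains_inf[OF \<open>compact S\<close> False seminorm_continuous_on[OF N]] by blast
    then show ?thesis using that[of "N v0"] pos by blast
  qed
  have "\<exists>z. N z = 0 \<and> k * norm (v - z) \<le> N v" for v
  proof -
    obtain z w where zw: "z \<in> span Z" "\<And>x. x \<in> span Z \<Longrightarrow> orthogonal w x" "v = z + w"
      using orthogonal_subspace_decomp_exists[of Z v] by metis
    have z: "N z = 0" using zw(1) subZ by (simp add: span_eq_iff[THEN iffD2] Z_def)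
    have "k * norm w \<le> N w"
    proof (cases "w = 0")
      case True
      then show ?thesis by (simp add: seminorm_0[OF N])
    next
      case False
      then have "(1 / norm w) *\<^sub>R w \<in> S"
        using zw(2) by (auto simp: S_def span_base orthogonal_clauses)
      then show ?thesis using k(2) False by (force simp: seminorm_scaleR[OF N] field_simps)
    qed
    moreover have "N w = N v" "v - z = w"
      using seminorm_diff_kernel[OF N z, of v] zw(3) by auto
    ultimately show ?thesis using z by auto
  qed
  with k(1) show ?thesis using that by blast
qed

text \<open>Since \<open>W\<close> is closed and contains the kernel,
  \<open>seminorm_ge_dist_kernel\<close> bounds the \<open>N\<close>-distance of \<open>u\<close>
  from \<open>W\<close> below by a multiple of the Euclidean one. The factor 2 replaces the
  existence of a nearest point.\<close>

lemma seminorm_inf_dist_positive: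
  fixes N :: "'a::euclidean_space \<Rightarrow> real"
  assumes N: "seminorm N" and W: "subspace W" "{v. N v = 0} \<subseteq> W" and u: "u \<notin> W"
  obtains d where "0 < d" "\<And>w. w \<in> W \<Longrightarrow> d \<le> N (u - w)" "\<exists>w\<in>W. N (u - w) \<le> 2 * d"
proof -
  obtain k where k: "0 < k" "\<And>v. \<exists>z. N z = 0 \<and> k * norm (v - z) \<le> N v"
    using seminorm_ge_dist_kernel[OF N] by metis
  have pos: "0 < infdist u W"
    using W(1) u closed_subspace[OF W(1)] subspace_0[OF W(1)]
    by (metis empty_iff in_closed_iff_infdist_zero infdist_nonneg less_eq_real_def)
  have le: "k * infdist u W \<le> N (u - w)" if w: "w \<in> W" for w
  proof -
    obtain z where z: "N z = 0" "k * norm (u - w - z) \<le> N (u - w)" using k(2) by blast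
    have "w + z \<in> W" using W z(1) w by (auto intro: subspace_add)
    then have "infdist u W \<le> norm (u - w - z)"
      using infdist_le[of "w + z" W u] by (simp add: dist_norm algebra_simps)
    then show ?thesis using z(2) k(1) mult_left_mono[of "infdist u W" "norm (u - w - z)" k] by linarith
  qed
  define d where "d = (INF w\<in>W. N (u - w))"
  have ne: "W \<noteq> {}" using subspace_0[OF W(1)] by auto
  have bd: "bdd_below ((\<lambda>w. N (u - w)) ` W)"
    by (intro bdd_belowI2[where m = 0] seminorm_nonneg[OF N])
  have "k * infdist u W \<le> d" unfolding d_def by (rule cINF_greatest[OF ne le])
  then have d: "0 < d" using k(1) pos by (meson less_le_trans mult_pos_pos)
  moreover have "d \<le> N (u - w)" if "w \<in> W" for w
    unfolding d_def by (rule cINF_lower[OF bd that])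
  moreover have "\<exists>w\<in>W. N (u - w) < 2 * d"
    using cINF_less_iff[OF ne bd, of "2 * d"] d by (simp add: d_def)
  ultimately show ?thesis using that by (meson less_imp_le)
qed

text \<open>A weak form of Auerbach's lemma.\<close>

lemma seminorm_conditioned_basis:
  fixes N :: "'a::euclidean_space \<Rightarrow> real"
  assumes N: "seminorm N"
  obtains E where "finite E" "card E \<le> DIM('a)"
    "\<And>v. \<exists>c. v = (\<Sum>e\<in>E. c e *\<^sub>R e) \<and> (\<Sum>e\<in>E. \<bar>c e\<bar> * N e) \<le> 3 ^ DIM('a) * N v"
proof -
  define Z where "Z = {v. N v = 0}"
  \<comment> \<open>The bound \<open>3 ^ card E - 1\<close> is made for adding one vector:
    \<open>2 + 3 * (3 ^ k - 1) = 3 ^ (k + 1) - 1\<close>. The condition on \<open>Z\<close> is met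
    at the start by a basis of the kernel, on which every cost is 0.\<close>
  define good where "good E \<longleftrightarrow> independent E \<and> Z \<subseteq> span E \<and>
      (\<forall>v\<in>span E. \<exists>c. v = (\<Sum>e\<in>E. c e *\<^sub>R e) \<and> (\<Sum>e\<in>E. \<bar>c e\<bar> * N e) \<le> (3 ^ card E - 1) * N v)" for E
  obtain B where B: "B \<subseteq> Z" "independent B" "Z \<subseteq> span B"
    using basis_exists[of Z] by metis
  have gB: "good B"
    unfolding good_def
  proof (intro conjI ballI B)
    fix v assume v: "v \<in> span B"
    obtain c where c: "v = (\<Sum>e\<in>B. c e *\<^sub>R e)"
      using v span_finite[OF independent_imp_finite[OF B(2)]] by auto
    have "(\<Sum>e\<in>B. \<bar>c e\<bar> * N e) = 0"
      using B(1) by (intro sum.neutral) (auto simp: Z_def)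
    moreover have "0 \<le> (3 ^ card B - 1) * N v" by (simp add: seminorm_nonneg[OF N])
    ultimately show "\<exists>c. v = (\<Sum>e\<in>B. c e *\<^sub>R e) \<and> (\<Sum>e\<in>B. \<bar>c e\<bar> * N e) \<le> (3 ^ card B - 1) * N v"
      using c by auto
  qed
  have ext: "\<exists>E'. good E' \<and> card E < card E'" if g: "good E" and u: "u \<notin> span E" for E u
  proof -
    have ind: "independent E" and ZE: "Z \<subseteq> span E"
      and rep: "\<And>v. v \<in> span E \<Longrightarrow> \<exists>c. v = (\<Sum>e\<in>E. c e *\<^sub>R e) \<and> (\<Sum>e\<in>E. \<bar>c e\<bar> * N e) \<le> (3 ^ card E - 1) * N v"
      using g by (auto simp: good_def)
    have fE: "finite E" by (rule independent_imp_finite[OF ind])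
    obtain d where d: "0 < d" "\<And>w. w \<in> span E \<Longrightarrow> d \<le> N (u - w)" "\<exists>w\<in>span E. N (u - w) \<le> 2 * d"
      using seminorm_inf_dist_positive[OF N subspace_span ZE[unfolded Z_def] u] by metis
    obtain w where w: "w \<in> span E" "N (u - w) \<le> 2 * d" using d(3) by blast
    \<comment> \<open>The vector \<open>u\<close> is reduced modulo the span to a seminorm within a
      factor 2 of the distance. Its coefficient in any \<open>v\<close> therefore costs at most
      \<open>2 * N v\<close>, and the rest of \<open>v\<close> has seminorm at most
      \<open>3 * N v\<close>.\<close>
    define e where "e = u - w"
    have e: "e \<notin> span E" using u w(1) by (metis diff_add_cancel e_def span_add)
    then have eE: "e \<notin> E" using span_base by blast
    have lower: "\<bar>t\<bar> * d \<le> N (x + t *\<^sub>R e)" if x: "x \<in> span E" for x t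
    proof (cases "t = 0")
      case True
      then show ?thesis by (simp add: seminorm_nonneg[OF N])
    next
      case False
      have "w - (1 / t) *\<^sub>R x \<in> span E" using w(1) x by (intro span_diff span_scale)
      then have "d \<le> N (u - (w - (1 / t) *\<^sub>R x))" by (rule d(2))
      also have "u - (w - (1 / t) *\<^sub>R x) = (1 / t) *\<^sub>R (x + t *\<^sub>R e)"
        using False by (simp add: e_def algebra_simps)
      also have "N \<dots> = N (x + t *\<^sub>R e) / \<bar>t\<bar>" by (simp only: seminorm_scaleR[OF N]) simp
      finally show ?thesis using False by (simp add: pos_le_divide_eq mult.commute)
    qed
    have "good (insert e E)"
      unfolding good_def
    proof (intro conjI ballI)
      show "independent (insert e E)" using ind e by (rule independent_insertI[rotated])
      show "Z \<subseteq> span (insert e E)" using ZE span_mono[of E "insert e E"] by blast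
      fix v assume "v \<in> span (insert e E)"
      then obtain t where t: "v - t *\<^sub>R e \<in> span E" using span_breakdown_eq by metis
      define x where "x = v - t *\<^sub>R e"
      have v: "v = x + t *\<^sub>R e" and x: "x \<in> span E" using t by (auto simp: x_def)
      obtain c where c: "x = (\<Sum>e\<in>E. c e *\<^sub>R e)" "(\<Sum>e\<in>E. \<bar>c e\<bar> * N e) \<le> (3 ^ card E - 1) * N x"
        using rep[OF x] by blast
      have te: "\<bar>t\<bar> * N e \<le> 2 * N v"
      proof -
        have "\<bar>t\<bar> * N e \<le> \<bar>t\<bar> * (2 * d)" using w(2) by (intro mult_left_mono) (auto simp: e_def)
        then show ?thesis using lower[OF x, of t] by (simp add: v)
      qed
      have "N x \<le> N v + \<bar>t\<bar> * N e"
        using seminorm_add[OF N, of v "- (t *\<^sub>R e)"]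
        by (simp add: x_def seminorm_minus[OF N] seminorm_scaleR[OF N])
      then have "N x \<le> 3 * N v" using te by linarith
      then have "(3 ^ card E - 1) * N x \<le> (3 ^ card E - 1) * (3 * N v)"
        by (intro mult_left_mono) auto
      define c' where "c' = c(e := t)"
      have s1: "(\<Sum>a\<in>insert e E. c' a *\<^sub>R a) = t *\<^sub>R e + x"
        using eE fE by (simp add: c'_def c(1) cong: sum.cong) (intro sum.cong, auto)
      have "(\<Sum>a\<in>insert e E. \<bar>c' a\<bar> * N a) = \<bar>t\<bar> * N e + (\<Sum>a\<in>E. \<bar>c a\<bar> * N a)"
        using eE fE by (simp add: c'_def) (intro sum.cong, auto)
      also have "\<dots> \<le> 2 * N v + (3 ^ card E - 1) * (3 * N v)"
        using te c(2) \<open>(3 ^ card E - 1) * N x \<le> _\<close> by linarith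
      also have "\<dots> = (3 ^ card (insert e E) - 1) * N v"
        using eE fE by (simp add: algebra_simps)
      finally show "\<exists>c. v = (\<Sum>a\<in>insert e E. c a *\<^sub>R a) \<and>
          (\<Sum>a\<in>insert e E. \<bar>c a\<bar> * N a) \<le> (3 ^ card (insert e E) - 1) * N v"
        using s1 v by (intro exI[of _ c']) (simp add: add.commute)
    qed
    then show ?thesis using eE fE by (intro exI[of _ "insert e E"]) simp
  qed
  have bd: "card E \<le> DIM('a)" if "good E" for E
    using that independent_bound[of E] by (simp add: good_def)
  obtain E where E: "good E" "\<And>E'. good E' \<Longrightarrow> card E' \<le> card E"
    using ex_has_greatest_nat[of good B card "Suc DIM('a)"] gB bd by (auto simp: less_Suc_eq_le)
  have sp: "span E = UNIV"
  proof -
    have "u \<in> span E" for u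
    proof (rule ccontr)
      assume "u \<notin> span E"
      then obtain E' where "good E'" "card E < card E'" using ext[OF E(1)] by blast
      then show False using E(2)[of E'] by simp
    qed
    then show ?thesis by blast
  qed
  have c: "(3 ^ card E - 1) * N v \<le> 3 ^ DIM('a) * N v" for v
  proof -
    have "(3::real) ^ card E \<le> 3 ^ DIM('a)" by (intro power_increasing bd E) auto
    then show ?thesis by (intro mult_right_mono seminorm_nonneg[OF N]) linarith
  qed
  show ?thesis
  proof (rule that[OF _ bd[OF E(1)]])
    show "finite E" using E(1) by (auto simp: good_def independent_imp_finite)
    fix v
    show "\<exists>c. v = (\<Sum>e\<in>E. c e *\<^sub>R e) \<and> (\<Sum>e\<in>E. \<bar>c e\<bar> * N e) \<le> 3 ^ DIM('a) * N v"
    proof -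
      have "v \<in> span E" using sp by simp
      then obtain a where "v = (\<Sum>e\<in>E. a e *\<^sub>R e)" "(\<Sum>e\<in>E. \<bar>a e\<bar> * N e) \<le> (3 ^ card E - 1) * N v"
        using E(1) unfolding good_def by blast
      then show ?thesis using c[of v] by (intro exI[of _ a] conjI) (assumption, linarith)
    qed
  qed
qed


text \<open>A forest of cells: \<open>nu j m\<close> is the unnormalized seminorm of the cell \<open>m\<close> of level \<open>j\<close>.\<close>

locale stopping_forest =
  fixes par :: "'m \<Rightarrow> 'm" and vol :: "nat \<Rightarrow> real" and nu :: "nat \<Rightarrow> 'm \<Rightarrow> 'v::euclidean_space \<Rightarrow> real"
  assumes vol_pos: "\<And>j. 0 < vol j"
    and finite_children: "\<And>m. finite {c. par c = m}"
    and vol_children: "\<And>j m. vol j = (\<Sum>c\<in>{c. par c = m}. vol (Suc j))"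
    and seminorm_nu: "\<And>j m. seminorm (nu j m)"
    and nu_children: "\<And>j m v. nu j m v = (\<Sum>c\<in>{c. par c = m}. nu (Suc j) c v)"
begin

definition cond_basis :: "nat \<Rightarrow> 'm \<Rightarrow> 'v set" where
  "cond_basis j m = (SOME E. finite E \<and> card E \<le> DIM('v) \<and>
     (\<forall>v. \<exists>c. v = (\<Sum>e\<in>E. c e *\<^sub>R e) \<and> (\<Sum>e\<in>E. \<bar>c e\<bar> * nu j m e) \<le> 3 ^ DIM('v) * nu j m v))"

lemma cond_basis:
  shows "finite (cond_basis j m)" "card (cond_basis j m) \<le> DIM('v)"
    "\<exists>c. v = (\<Sum>e\<in>cond_basis j m. c e *\<^sub>R e) \<and>
       (\<Sum>e\<in>cond_basis j m. \<bar>c e\<bar> * nu j m e) \<le> 3 ^ DIM('v) * nu j m v"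
proof -
  obtain E where E: "finite E" "card E \<le> DIM('v)"
    "\<And>v. \<exists>c. v = (\<Sum>e\<in>E. c e *\<^sub>R e) \<and> (\<Sum>e\<in>E. \<bar>c e\<bar> * nu j m e) \<le> 3 ^ DIM('v) * nu j m v"
    by (rule seminorm_conditioned_basis[OF seminorm_nu[of j m]]) (rule that)
  have ex: "finite E \<and> card E \<le> DIM('v) \<and>
     (\<forall>v. \<exists>c. v = (\<Sum>e\<in>E. c e *\<^sub>R e) \<and> (\<Sum>e\<in>E. \<bar>c e\<bar> * nu j m e) \<le> 3 ^ DIM('v) * nu j m v)"
    by (intro conjI allI E)
  from someI[of "\<lambda>E. finite E \<and> card E \<le> DIM('v) \<and>
     (\<forall>v. \<exists>c. v = (\<Sum>e\<in>E. c e *\<^sub>R e) \<and> (\<Sum>e\<in>E. \<bar>c e\<bar> * nu j m e) \<le> 3 ^ DIM('v) * nu j m v)", OF ex]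
  show "finite (cond_basis j m)" "card (cond_basis j m) \<le> DIM('v)"
    "\<exists>c. v = (\<Sum>e\<in>cond_basis j m. c e *\<^sub>R e) \<and>
       (\<Sum>e\<in>cond_basis j m. \<bar>c e\<bar> * nu j m e) \<le> 3 ^ DIM('v) * nu j m v"
    unfolding cond_basis_def by blast+
qed

text \<open>Twice the largest number of test directions, so that by \<open>excess_self\<close> the
  stopping cells first met below a stopping cell fill at most half of it.\<close>

definition ratio :: real where "ratio = 2 * DIM('v)"

lemma ratio_ge_2: "2 \<le> ratio"
proof -
  have "1 \<le> DIM('v)" using DIM_positive[where 'a = 'v] by linarith
  then show ?thesis by (simp add: ratio_def)
qed

text \<open>Averages over the two cells are compared only along the basis attached to the upper one.
  Strictness matters: for nested cells it excludes directions on which the upper seminorm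
  vanishes.\<close>

fun stops :: "nat \<times> 'm \<Rightarrow> nat \<Rightarrow> 'm \<Rightarrow> bool" where
  "stops (i, p) j m \<longleftrightarrow> (\<exists>e\<in>cond_basis i p. ratio * nu i p e / vol i < nu j m e / vol j)"

text \<open>The nearest stopping cell at or above a cell, found by descending from level 0, where
  every cell counts as stopping. Thus \<open>principal j m = (j, m)\<close> characterizes the
  stopping cells.\<close>

primrec principal :: "nat \<Rightarrow> 'm \<Rightarrow> nat \<times> 'm" where
  "principal 0 m = (0, m)"
| "principal (Suc j) m =
     (if stops (principal j (par m)) (Suc j) m then (Suc j, m) else principal j (par m))"

text \<open>The last conjunct guarantees that every value of \<open>principal\<close> is a stopping
  cell, as the packing estimate presupposes.\<close>

lemma principal_ancestor:
  "fst (principal j m) \<le> j \<and> (par ^^ (j - fst (principal j m))) m = snd (principal j m) \<and>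
     principal (fst (principal j m)) (snd (principal j m)) = principal j m"
proof (induction j arbitrary: m)
  case (Suc j)
  show ?case
  proof (cases "stops (principal j (par m)) (Suc j) m")
    case False
    then have "principal (Suc j) m = principal j (par m)" by simp
    moreover have "(par ^^ (Suc j - fst (principal j (par m)))) m = (par ^^ (j - fst (principal j (par m)))) (par m)"
      using Suc.IH[of "par m"] by (simp add: Suc_diff_le funpow_Suc_right del: funpow.simps)
    ultimately show ?thesis using Suc.IH[of "par m"] by simp
  qed simp
qed simp

lemma seminorm_nonneg_nu: "0 \<le> nu j m v"
  by (rule seminorm_nonneg[OF seminorm_nu])

lemma nu_par_mono: "nu (Suc j) m v \<le> nu j (par m) v"
  unfolding nu_children[of j "par m"]
  by (rule member_le_sum[where f = "\<lambda>c. nu (Suc j) c v"])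
    (auto simp: finite_children seminorm_nonneg_nu)

lemma nu_ancestor_mono: "nu (i + k) m v \<le> nu i ((par ^^ k) m) v"
proof (induction k arbitrary: m)
  case (Suc k)
  have "nu (i + Suc k) m v \<le> nu (i + k) (par m) v" using nu_par_mono[of "i + k" m v] by simp
  also have "\<dots> \<le> nu i ((par ^^ k) (par m)) v" by (rule Suc.IH)
  finally show ?case by (simp add: funpow_Suc_right del: funpow.simps)
qed simp

lemma nu_principal_mono: "principal j m = (i, p) \<Longrightarrow> nu j m v \<le> nu i p v"
  using principal_ancestor[of j m] nu_ancestor_mono[of i "j - i" m v] by simp

text \<open>If the cell did not stop, its averages are controlled along the basis of the principal
  cell; the conditioning of that basis extends the control to an arbitrary \<open>v\<close> at the
  price of \<open>3 ^ DIM('v)\<close>, however degenerate \<open>nu i p\<close> is.\<close>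

lemma average_le_principal:
  assumes P: "principal j m = (i, p)"
  shows "nu j m v / vol j \<le> ratio * 3 ^ DIM('v) * (nu i p v / vol i)"
proof (cases "principal j m = (j, m)")
  case True
  have "1 * 1 \<le> ratio * 3 ^ DIM('v)" using ratio_ge_2 by (intro mult_mono) auto
  then have "1 * (nu j m v / vol j) \<le> ratio * 3 ^ DIM('v) * (nu j m v / vol j)"
    by (intro mult_right_mono) (auto simp: seminorm_nonneg_nu vol_pos less_imp_le)
  then show ?thesis using P True by simp
next
  case False
  then obtain j' where j: "j = Suc j'" by (cases j) auto
  have ns: "\<not> stops (i, p) j m"
    using P False by (auto simp: j split: if_splits)
  obtain c where c: "v = (\<Sum>e\<in>cond_basis i p. c e *\<^sub>R e)"
    "(\<Sum>e\<in>cond_basis i p. \<bar>c e\<bar> * nu i p e) \<le> 3 ^ DIM('v) * nu i p v"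
    using cond_basis(3) by blast
  have "nu j m v \<le> (\<Sum>e\<in>cond_basis i p. \<bar>c e\<bar> * nu j m e)"
    unfolding c(1) by (rule seminorm_sum_le[OF seminorm_nu cond_basis(1)])
  then have "nu j m v / vol j \<le> (\<Sum>e\<in>cond_basis i p. \<bar>c e\<bar> * nu j m e) / vol j"
    by (intro divide_right_mono) (simp_all add: vol_pos less_imp_le)
  also have "\<dots> = (\<Sum>e\<in>cond_basis i p. \<bar>c e\<bar> * (nu j m e / vol j))"
    by (simp add: sum_divide_distrib)
  also have "\<dots> \<le> (\<Sum>e\<in>cond_basis i p. \<bar>c e\<bar> * (ratio * nu i p e / vol i))"
    using ns by (intro sum_mono mult_left_mono) (auto simp: not_less)
  also have "\<dots> = ratio / vol i * (\<Sum>e\<in>cond_basis i p. \<bar>c e\<bar> * nu i p e)"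
    by (simp add: sum_distrib_left mult_ac)
  also have "\<dots> \<le> ratio / vol i * (3 ^ DIM('v) * nu i p v)"
    using ratio_ge_2 vol_pos[of i] by (intro mult_left_mono c(2)) auto
  finally show ?thesis by (simp add: mult_ac)
qed

text \<open>A measure-like majorant for the volume of stopping cells: additive over children, at
  least the volume of any cell below \<open>P\<close> that stops relative to \<open>P\<close>, and
  at most half the volume on \<open>P\<close> itself. Directions on which the seminorm of
  \<open>P\<close> vanishes contribute 0 through division by zero.\<close>

definition excess :: "nat \<times> 'm \<Rightarrow> nat \<Rightarrow> 'm \<Rightarrow> real" where
  "excess P j m = (\<Sum>e\<in>cond_basis (fst P) (snd P).
     nu j m e * (vol (fst P) / (ratio * nu (fst P) (snd P) e)))"

lemma excess_nonneg: "0 \<le> excess P j m"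
  unfolding excess_def using ratio_ge_2
  by (intro sum_nonneg mult_nonneg_nonneg divide_nonneg_nonneg seminorm_nonneg_nu)
    (auto simp: vol_pos less_imp_le)

lemma excess_children: "excess P j m = (\<Sum>c\<in>{c. par c = m}. excess P (Suc j) c)"
  unfolding excess_def nu_children[of j m] sum_distrib_right by (rule sum.swap)

lemma excess_self: "2 * excess (j, m) j m \<le> vol j"
proof -
  have "excess (j, m) j m \<le> (\<Sum>e\<in>cond_basis j m. vol j / ratio)"
    unfolding excess_def fst_conv snd_conv
    using vol_pos[of j] ratio_ge_2 by (intro sum_mono) auto
  also have "\<dots> = card (cond_basis j m) * (vol j / ratio)" by simp
  also have "\<dots> \<le> real DIM('v) * (vol j / ratio)"
    using cond_basis(2)[of j m] vol_pos[of j] ratio_ge_2 by (intro mult_right_mono) auto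
  finally show ?thesis by (simp add: ratio_def)
qed

text \<open>One direction that triggers the test already contributes the whole volume; the remaining
  summands are nonnegative.\<close>

lemma vol_le_excess:
  assumes st: "stops (i, p) j m" and le: "\<And>v. nu j m v \<le> nu i p v"
  shows "vol j \<le> excess (i, p) j m"
proof -
  obtain e where e: "e \<in> cond_basis i p" "ratio * nu i p e / vol i < nu j m e / vol j"
    using st by auto
  \<comment> \<open>If the upper seminorm vanished at \<open>e\<close>, so would the lower one, and
    the strict inequality in \<open>stops\<close> would read 0 < 0.\<close>
  have pos: "0 < nu i p e"
  proof (rule ccontr)
    assume "\<not> 0 < nu i p e"
    then have "nu i p e = 0" "nu j m e = 0"
      using seminorm_nonneg_nu[of i p e] seminorm_nonneg_nu[of j m e] le[of e] by auto
    then show False using e(2) by simp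
  qed
  have "vol j \<le> nu j m e * (vol i / (ratio * nu i p e))"
    using e(2) pos vol_pos[of i] vol_pos[of j] ratio_ge_2 by (simp add: field_simps)
  also have "\<dots> \<le> excess (i, p) j m"
    unfolding excess_def fst_conv snd_conv using ratio_ge_2
    by (intro member_le_sum[OF e(1)] cond_basis(1) mult_nonneg_nonneg divide_nonneg_nonneg seminorm_nonneg_nu)
      (auto simp: vol_pos less_imp_le)
  finally show ?thesis .
qed

definition stop_vol :: "nat \<Rightarrow> 'm \<Rightarrow> real" where
  "stop_vol j m = (if principal j m = (j, m) then vol j else 0)"

text \<open>Volume of the stopping cells in the \<open>k + 1\<close> levels from \<open>m\<close>
  downwards. Finite depth permits an induction on \<open>k\<close>, with bounds that are free of
  \<open>k\<close>.\<close>

definition descendant_stops :: "nat \<Rightarrow> nat \<Rightarrow> 'm \<Rightarrow> real" where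
  "descendant_stops k j m = (\<Sum>i\<le>k. \<Sum>c\<in>{c. (par ^^ i) c = m}. stop_vol (j + i) c)"

lemma finite_descendants: "finite {c. (par ^^ i) c = m}"
proof (induction i arbitrary: m)
  case (Suc i)
  have "{c. (par ^^ Suc i) c = m} = (\<Union>d\<in>{d. par d = m}. {c. (par ^^ i) c = d})" by auto
  then show ?case using finite_children Suc.IH by simp
qed simp

lemma descendant_stops_0: "descendant_stops 0 j m = stop_vol j m"
  by (simp add: descendant_stops_def)

lemma descendant_stops_Suc:
  "descendant_stops (Suc k) j m = stop_vol j m + (\<Sum>d\<in>{d. par d = m}. descendant_stops k (Suc j) d)"
proof -
  have "(\<Sum>c\<in>{c. (par ^^ Suc i) c = m}. stop_vol (j + Suc i) c) =
      (\<Sum>d\<in>{d. par d = m}. \<Sum>c\<in>{c. (par ^^ i) c = d}. stop_vol (Suc j + i) c)" for i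
  proof -
    have "{c. (par ^^ Suc i) c = m} = (\<Union>d\<in>{d. par d = m}. {c. (par ^^ i) c = d})" by auto
    then show ?thesis
      by (simp only: add_Suc_right add_Suc)
        (intro sum.UNION_disjoint finite_children ballI finite_descendants, auto)
  qed
  then have "(\<Sum>i\<le>k. \<Sum>c\<in>{c. (par ^^ Suc i) c = m}. stop_vol (j + Suc i) c) =
      (\<Sum>d\<in>{d. par d = m}. descendant_stops k (Suc j) d)"
    unfolding descendant_stops_def by (simp only:) (rule sum.swap)
  then show ?thesis
    unfolding descendant_stops_def[of "Suc k"] sum.atMost_Suc_shift by simp
qed

text \<open>Both bounds have to be carried along the induction: the second one controls all stopping
  cells strictly below \<open>m\<close> by the excess relative to the principal cell of \<open>m\<close>.\<close>

lemma carleson_aux: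
  "descendant_stops k j m \<le> 2 * vol j \<and>
   descendant_stops k j m - stop_vol j m \<le> 2 * excess (principal j m) j m"
proof (induction k arbitrary: j m)
  case 0
  then show ?case
    using excess_nonneg[of "principal j m" j m] vol_pos[of j]
    by (simp add: descendant_stops_0 stop_vol_def)
next
  case (Suc k)
  obtain i p where P: "principal j m = (i, p)" by fastforce
  have ij: "i \<le> j" using principal_ancestor[of j m] P by simp
  let ?Y = "\<Sum>d\<in>{d. par d = m}. descendant_stops k (Suc j) d"
  \<comment> \<open>A stopping child is paid for by the first bound and
    \<open>vol_le_excess\<close>. Any other child inherits the principal cell of \<open>m\<close>,
    adds no volume of its own because \<open>i \<le> j\<close>, and is covered by the second
    bound.\<close>
  have "descendant_stops k (Suc j) d \<le> 2 * excess (i, p) (Suc j) d" if d: "par d = m" for d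
  proof (cases "stops (i, p) (Suc j) d")
    case True
    have "nu (Suc j) d v \<le> nu i p v" for v
      using nu_par_mono[of j d v] nu_principal_mono[OF P, of v] d by simp
    from vol_le_excess[OF True this] show ?thesis
      using Suc.IH[of "Suc j" d] by linarith
  next
    case False
    then have "principal (Suc j) d = (i, p)" using d P by simp
    then show ?thesis
      using Suc.IH[of "Suc j" d] ij by (simp add: stop_vol_def)
  qed
  then have Y: "?Y \<le> 2 * excess (i, p) j m"
    unfolding excess_children[of "(i, p)" j m] sum_distrib_left by (intro sum_mono) auto
  \<comment> \<open>At a stopping cell twice the excess is at most the volume, which together with
    the cell's own volume gives \<open>2 * vol j\<close>. At any other cell the first bounds of the
    children add up.\<close>
  have "stop_vol j m + ?Y \<le> 2 * vol j"
  proof (cases "principal j m = (j, m)")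
    case True
    then show ?thesis using Y P excess_self[of j m] by (simp add: stop_vol_def)
  next
    case False
    have "?Y \<le> (\<Sum>d\<in>{d. par d = m}. 2 * vol (Suc j))"
      using Suc.IH by (intro sum_mono) auto
    also have "\<dots> = 2 * vol j" by (simp add: vol_children[of j m])
    finally show ?thesis using False by (simp add: stop_vol_def)
  qed
  then show ?case using Y P by (simp add: descendant_stops_Suc)
qed

text \<open>A finite family has bounded depth below \<open>(i, p)\<close>, so counting levels from
  \<open>i\<close> embeds it into \<open>descendant_stops\<close>. The cell \<open>(i, p)\<close> is
  arbitrary and need not be a stopping cell; translated families require this.\<close>

lemma carleson_packing:
  assumes S: "finite S" and st: "\<And>j m. (j, m) \<in> S \<Longrightarrow> principal j m = (j, m)"
  shows "(\<Sum>(j, m)\<in>{(j, m)\<in>S. i \<le> j \<and> (par ^^ (j - i)) m = p}. vol j) \<le> 2 * vol i"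
proof -
  define S' where "S' = {(j, m)\<in>S. i \<le> j \<and> (par ^^ (j - i)) m = p}"
  have fS': "finite S'" using S by (auto simp: S'_def intro: finite_subset[OF _ S])
  obtain k where k: "\<And>j m. (j, m) \<in> S' \<Longrightarrow> j \<le> i + k"
  proof -
    define M where "M = Max (insert 0 (fst ` S'))"
    have "j \<le> M" if "(j, m) \<in> S'" for j m
      unfolding M_def using fS' that by (intro Max_ge) force+
    then show ?thesis using that[of M] by (meson le_add2 order_trans)
  qed
  define T where "T = (SIGMA l:{..k}. {c. (par ^^ l) c = p})"
  have fT: "finite T" unfolding T_def by (intro finite_SigmaI finite_descendants) simp
  have "(\<Sum>(j, m)\<in>S'. vol j) = (\<Sum>(j, m)\<in>S'. stop_vol j m)"
    using st by (intro sum.cong) (auto simp: S'_def stop_vol_def)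
  also have "\<dots> = (\<Sum>x\<in>S'. (\<lambda>(l, m). stop_vol (i + l) m) (fst x - i, snd x))"
    by (intro sum.cong) (auto simp: S'_def)
  also have "\<dots> = (\<Sum>(l, m)\<in>(\<lambda>x. (fst x - i, snd x)) ` S'. stop_vol (i + l) m)"
  proof (rule sum.reindex[unfolded comp_def, symmetric])
    show "inj_on (\<lambda>x. (fst x - i, snd x)) S'"
    proof (rule inj_onI)
      fix x y assume "x \<in> S'" "y \<in> S'" "(fst x - i, snd x) = (fst y - i, snd y)"
      then show "x = y" by (cases x, cases y) (auto simp: S'_def)
    qed
  qed
  also have "\<dots> \<le> (\<Sum>(l, m)\<in>T. stop_vol (i + l) m)"
  proof (rule sum_mono2[OF fT])
    show "(\<lambda>x. (fst x - i, snd x)) ` S' \<subseteq> T"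
    proof
      fix y assume "y \<in> (\<lambda>x. (fst x - i, snd x)) ` S'"
      then obtain j m where "(j, m) \<in> S'" "y = (j - i, m)" by auto
      then show "y \<in> T" using k[of j m] by (simp add: T_def S'_def)
    qed
    show "0 \<le> (case y of (l, m) \<Rightarrow> stop_vol (i + l) m)" for y
      using vol_pos[of "i + fst y"] by (cases y) (simp add: stop_vol_def)
  qed
  also have "\<dots> = descendant_stops k i p"
    unfolding T_def descendant_stops_def by (subst sum.Sigma) (auto simp: finite_descendants)
  also have "\<dots> \<le> 2 * vol i" using carleson_aux by blast
  finally show ?thesis by (simp add: S'_def)
qed

end

section \<open>Dyadic cells and the Carleson embedding\<close>

text \<open>Index of the parent cell; \<open>div\<close> rounds down, so the grid is consistent
  across negative coordinates.\<close>

definition halve :: "int^'d \<Rightarrow> int^'d" where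
  "halve m = (\<chi> i. m $ i div 2)"

lemma halve_funpow: "(halve ^^ k) m = (\<chi> i. m $ i div 2 ^ k)"
proof (induction k)
  case (Suc k)
  then show ?case
    by (simp add: halve_def vec_eq_iff) (metis mult.commute zdiv_zmult2_eq zero_le_numeral zero_le_power)
qed (simp add: vec_eq_iff)

lemma finite_vec_set:
  assumes "\<And>i. finite (S i)"
  shows "finite {m :: 'a^'d. \<forall>i. m $ i \<in> S i}"
proof -
  have "m \<in> vec_lambda ` (PiE UNIV S)" if "\<forall>i. m $ i \<in> S i" for m :: "'a^'d"
    using that by (intro image_eqI[of _ _ "\<lambda>i. m $ i"]) (auto simp: vec_eq_iff)
  then have "{m :: 'a^'d. \<forall>i. m $ i \<in> S i} \<subseteq> vec_lambda ` (PiE UNIV S)" by blast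
  then show ?thesis by (rule finite_subset) (intro finite_imageI finite_PiE assms, simp)
qed

lemma finite_halve_fiber: "finite {c. halve c = (m :: int^'d)}"
proof (rule finite_subset)
  have "2 * m $ i \<le> c $ i \<and> c $ i \<le> 2 * m $ i + 1" if "halve c = m" for c i
  proof -
    have "m $ i = c $ i div 2" using that by (auto simp: halve_def)
    then show ?thesis by presburger
  qed
  then show "{c. halve c = m} \<subseteq> {c. \<forall>i. c $ i \<in> {2 * m $ i .. 2 * m $ i + 1}}"
    by auto
  show "finite {c :: int^'d. \<forall>i. c $ i \<in> {2 * m $ i .. 2 * m $ i + 1}}"
    by (rule finite_vec_set) simp
qed

text \<open>Levels only refine, starting from side \<open>L\<close>. As \<open>L\<close> will be the
  outer truncation radius of the kernel, no coarser cell is called for.\<close>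

locale dyadic_grid =
  fixes L :: real
  assumes L_pos: "0 < L"
begin

definition side :: "nat \<Rightarrow> real" where "side j = L / 2 ^ j"

definition cidx :: "nat \<Rightarrow> real^'d \<Rightarrow> int^'d" where
  "cidx j x = (\<chi> i. \<lfloor>x $ i / side j\<rfloor>)"

definition cell :: "nat \<Rightarrow> int^'d \<Rightarrow> (real^'d) set" where
  "cell j m = {x. cidx j x = m}"

lemma side_pos: "0 < side j"
  using L_pos by (simp add: side_def)

lemma side_add: "side (j + k) = side j / 2 ^ k"
  by (simp add: side_def power_add)

lemma cidx_ancestor: "(halve ^^ k) (cidx (j + k) x) = cidx j x"
proof -
  have "\<lfloor>x $ i / side (j + k)\<rfloor> div 2 ^ k = \<lfloor>x $ i / side j\<rfloor>" for i
    using floor_divide_real_eq_div[of "2 ^ k" "x $ i / side (j + k)"] by (simp add: side_add)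
  then show ?thesis by (simp add: halve_funpow cidx_def)
qed

lemma cidx_Suc: "halve (cidx (Suc j) x) = cidx j x"
  using cidx_ancestor[of 1 j x] by simp

lemma mem_cell_iff:
  "x \<in> cell j m \<longleftrightarrow> (\<forall>i. of_int (m $ i) * side j \<le> x $ i \<and> x $ i < (of_int (m $ i) + 1) * side j)"
proof -
  have "\<lfloor>x $ i / side j\<rfloor> = m $ i \<longleftrightarrow>
      of_int (m $ i) * side j \<le> x $ i \<and> x $ i < (of_int (m $ i) + 1) * side j" for i
    using side_pos[of j] by (simp add: floor_eq_iff pos_le_divide_eq pos_divide_less_eq)
  then show ?thesis by (simp add: cell_def cidx_def vec_eq_iff)
qed

lemma cell_between:
  fixes m :: "int^'d" and j
  defines "a \<equiv> (\<chi> i. of_int (m $ i) * side j)" and "b \<equiv> (\<chi> i. (of_int (m $ i) + 1) * side j)"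
  shows "box a b \<subseteq> cell j m" "cell j m \<subseteq> cbox a b"
  by (auto simp: mem_cell_iff mem_box_cart a_def b_def less_imp_le)

lemma borel_measurable_cidx: "(\<lambda>x :: real^'d. cidx j x $ i) \<in> measurable borel (count_space UNIV)"
proof -
  have "(\<lambda>x :: real^'d. \<lfloor>x $ i / side j\<rfloor>) \<in> measurable borel (count_space UNIV)"
    by measurable
  then show ?thesis by (simp add: cidx_def)
qed

lemma cell_borel [measurable]: "cell j m \<in> sets borel"
proof -
  have "cell j m = (\<Inter>i\<in>UNIV. (\<lambda>x. cidx j x $ i) -` {m $ i} \<inter> space borel)"
    by (auto simp: cell_def vec_eq_iff)
  then show ?thesis
    using measurable_sets[OF borel_measurable_cidx, of "{m $ _}" j]
    by (simp only:) (rule sets.finite_INT, auto)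
qed

text \<open>The \<open>itself\<close> argument carries the dimension, which the level alone does not
  determine.\<close>

definition vol :: "'d itself \<Rightarrow> nat \<Rightarrow> real" where "vol _ j = side j ^ CARD('d)"

lemma vol_pos: "0 < vol TYPE('d) j"
  by (simp add: vol_def side_pos)

lemma emeasure_cell: "emeasure lborel (cell j (m :: int^'d)) = ennreal (vol TYPE('d) j)"
proof -
  define a where "a = (\<chi> i. of_int (m $ i) * side j)"
  define b where "b = (\<chi> i. (of_int (m $ i) + 1) * side j)"
  have le: "\<forall>i\<in>Basis. a \<bullet> i \<le> b \<bullet> i"
    using side_pos[of j] by (auto simp: a_def b_def Basis_vec_def inner_axis)
  have p: "(\<Prod>i\<in>Basis. (b - a) \<bullet> i) = vol TYPE('d) j"
  proof -
    have "(b - a) \<bullet> i = side j" if "i \<in> Basis" for i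
      using that by (auto simp: a_def b_def Basis_vec_def inner_axis algebra_simps)
    then show ?thesis by (simp add: vol_def)
  qed
  have "emeasure lborel (box a b) \<le> emeasure lborel (cell j m)"
    "emeasure lborel (cell j m) \<le> emeasure lborel (cbox a b)"
    using cell_between[where m = m and j = j] by (intro emeasure_mono; simp add: a_def b_def)+
  then show ?thesis
    using le p by (simp add: emeasure_lborel_box_eq emeasure_lborel_cbox_eq)
qed

lemma vol_mono: "i \<le> j \<Longrightarrow> vol TYPE('d) j \<le> vol TYPE('d) i"
  unfolding vol_def using L_pos
  by (intro power_mono) (auto simp: side_def intro!: divide_left_mono power_increasing)

lemma disjoint_cells: "m \<noteq> m' \<Longrightarrow> cell j m \<inter> cell j m' = {}"
  by (auto simp: cell_def)

lemma cell_children: "cell j m = (\<Union>c\<in>{c. halve c = m}. cell (Suc j) c)"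
  by (auto simp: cell_def cidx_Suc)

lemma nn_integral_cell_children:
  assumes "f \<in> borel_measurable borel"
  shows "(\<integral>\<^sup>+ x\<in>cell j m. f x \<partial>lborel) = (\<Sum>c\<in>{c. halve c = m}. \<integral>\<^sup>+ x\<in>cell (Suc j) c. f x \<partial>lborel)"
proof -
  note [measurable] = assms
  have "indicator (cell j m) x = (\<Sum>c\<in>{c. halve c = m}. indicator (cell (Suc j) c) x :: ennreal)" for x
    unfolding cell_children[of j m]
    by (rule indicator_UN_disjoint) (auto simp: finite_halve_fiber disjoint_family_on_def disjoint_cells)
  then have "(\<integral>\<^sup>+ x\<in>cell j m. f x \<partial>lborel) =
      (\<integral>\<^sup>+ x. (\<Sum>c\<in>{c. halve c = m}. f x * indicator (cell (Suc j) c) x) \<partial>lborel)"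
    by (simp add: sum_distrib_left)
  also have "\<dots> = (\<Sum>c\<in>{c. halve c = m}. \<integral>\<^sup>+ x\<in>cell (Suc j) c. f x \<partial>lborel)"
    by (rule nn_integral_sum) measurable
  finally show ?thesis .
qed

lemma vol_children:
  fixes m :: "int^'d"
  shows "vol TYPE('d) j = (\<Sum>c\<in>{c. halve c = m}. vol TYPE('d) (Suc j))"
proof -
  have "ennreal (vol TYPE('d) j) = (\<Sum>c\<in>{c. halve c = m}. ennreal (vol TYPE('d) (Suc j)))"
    using nn_integral_cell_children[of "\<lambda>x. 1" j m] by (simp add: emeasure_cell)
  also have "\<dots> = ennreal (\<Sum>c\<in>{c. halve c = m}. vol TYPE('d) (Suc j))"
    by (rule sum_ennreal) (simp add: vol_pos less_imp_le)
  finally show ?thesis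
    by (simp add: vol_pos less_imp_le sum_nonneg)
qed

end

text \<open>The tangent line inequality for \<open>x powr r\<close> at \<open>y\<close>, rearranged.
  It linearizes the power, so that Jensen's inequality can be obtained by integrating a pointwise
  bound.\<close>

lemma young_power_inequality:
  fixes x y r :: real
  assumes "1 \<le> r" "0 \<le> x" "0 < y"
  shows "x * y powr (r - 1) \<le> x powr r / r + (1 - 1 / r) * y powr r"
proof (cases "r = 1")
  case True
  then show ?thesis using assms by simp
next
  case False
  then have r: "1 < r" using assms by simp
  have "x * y powr (r - 1) \<le> x powr r / r + (y powr (r - 1)) powr (r / (r - 1)) / (r / (r - 1))"
    using r assms by (intro Youngs_inequality) (auto simp: field_simps)
  also have "(y powr (r - 1)) powr (r / (r - 1)) = y powr r"
    using r by (simp add: powr_powr)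
  also have "y powr r / (r / (r - 1)) = (1 - 1 / r) * y powr r"
    using r by (simp add: field_simps)
  finally show ?thesis .
qed

text \<open>Layer cake formula in the reciprocal level \<open>t\<close>; in this form the condition
  that a Luxemburg norm exceeds \<open>1 / t\<close> becomes one on the modular of
  \<open>g x * t\<close>.\<close>

lemma powr_layer_cake:
  fixes l q :: real
  assumes q: "0 < q" and l: "0 \<le> l"
  shows "ennreal (l powr q) \<le> ennreal q * (\<integral>\<^sup>+ t\<in>{t. 0 < t \<and> 1 < t * l}. ennreal (t powr (- q - 1)) \<partial>lborel)"
proof (cases "l = 0")
  case False
  define a where "a = 1 / l"
  have a: "0 < a" using l False by (simp add: a_def)
  have "(\<integral>\<^sup>+ t. ennreal (t powr (- q - 1)) * indicator {a..} t \<partial>lborel) = ennreal (0 - (- (a powr (- q)) / q))"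
  proof (rule nn_integral_FTC_atLeast)
    show "((\<lambda>t. - (t powr (- q)) / q) \<longlongrightarrow> 0) at_top"
      using tendsto_neg_powr[of "- q" "\<lambda>t. t" at_top] q
      by (intro tendsto_divide_zero tendsto_minus_cancel_left[THEN iffD1]) (simp_all add: filterlim_ident)
    show "DERIV (\<lambda>t. - (t powr (- q)) / q) x :> x powr (- q - 1)" if "a \<le> x" for x
      using that a q by (auto intro!: derivative_eq_intros simp: field_simps)
  qed auto
  also have "0 - (- (a powr (- q)) / q) = l powr q / q"
    using False l by (simp add: a_def powr_minus powr_divide divide_simps)
  finally have e1: "ennreal q * (\<integral>\<^sup>+ t. ennreal (t powr (- q - 1)) * indicator {a..} t \<partial>lborel) = ennreal (l powr q)"
    using q by (simp add: ennreal_mult[symmetric])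
  have e2: "(\<integral>\<^sup>+ t. ennreal (t powr (- q - 1)) * indicator {a..} t \<partial>lborel) =
      (\<integral>\<^sup>+ t. ennreal (t powr (- q - 1)) * indicator {a<..} t \<partial>lborel)"
    using AE_lborel_singleton[of a]
    by (intro nn_integral_cong_AE) (auto simp: indicator_def elim!: eventually_mono)
  have e3: "{t. 0 < t \<and> 1 < t * l} = {a<..}"
  proof -
    have "1 < t * l \<longleftrightarrow> a < t" for t
      using l False by (simp add: a_def pos_divide_less_eq)
    then show ?thesis using a by (intro set_eqI) (simp, linarith)
  qed
  show ?thesis unfolding e3 e2[symmetric] e1 by (rule order_refl)
qed simp


text \<open>Scaling \<open>t\<close> by \<open>u\<close> turns the integral into
  \<open>u powr q\<close> times a constant. The constant is finite by the class condition on
  \<open>{1..}\<close> and because the integrand is bounded between \<open>c\<close> and 1. The cut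
  at \<open>c\<close> is affordable since arguments up to \<open>c\<close> account for at most half
  of a modular.\<close>

lemma young_associate_tail:
  assumes Y: "young_function \<Phi>" and pq: "0 < p" "p \<le> q"
    and B: "B_class2 p q (young_associate \<Phi>)"
  defines "A \<equiv> young_associate \<Phi>"
  obtains c K where "0 < c" "A c \<le> 1 / 2" "0 \<le> K"
    "\<And>u. 0 < u \<Longrightarrow> (\<integral>\<^sup>+ t\<in>{t. 0 < t \<and> c < u * t}. ennreal (A (u * t) powr (q / p) * t powr (- q - 1)) \<partial>lborel)
       \<le> ennreal (K * u powr q)"
proof -
  \<comment> \<open>By \<open>young_associate_scale\<close> the value at \<open>c\<close> is at most
    \<open>c * A 1\<close>, hence at most 1/2; the 2 added in the denominator keeps it positive and
    gives \<open>c \<le> 1\<close>.\<close>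
  define c where "c = 1 / (2 * A 1 + 2)"
  define r where "r = q / p"
  have A1: "0 \<le> A t" for t by (simp add: A_def young_associate_nonneg[OF Y])
  have [measurable]: "A \<in> borel_measurable borel"
    unfolding A_def by (rule borel_measurable_young_associate[OF Y])
  have c: "0 < c" "c \<le> 1" using A1[of 1] by (simp_all add: c_def)
  have "A (c * 1) \<le> c * A 1"
    unfolding A_def using c by (intro young_associate_scale[OF Y]) auto
  also have "\<dots> \<le> 1 / 2" using A1[of 1] by (simp add: c_def field_simps)
  finally have Ac: "A c \<le> 1 / 2" by simp
  define f where "f u = ennreal (A u powr r * u powr (- q - 1)) * indicator {c<..} u" for u
  have [measurable]: "f \<in> borel_measurable borel" unfolding f_def[abs_def] by measurable
  define D where "D = A 1 powr r * c powr (- q - 1)"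
  have "f u \<le> ennreal D * indicator {c..1} u + ennreal (A u powr r / u powr q * (1 / u)) * indicator {1..} u" for u
  proof (cases "c < u")
    case True
    show ?thesis
    proof (cases "u < 1")
      case u: True
      have "A u powr r \<le> A 1 powr r"
        using u A1 pq by (intro powr_mono2) (auto simp: r_def A_def young_associate_mono[OF Y])
      moreover have "u powr (- q - 1) \<le> c powr (- q - 1)"
        using True c pq by (intro powr_mono2') auto
      ultimately have "A u powr r * u powr (- q - 1) \<le> D"
        unfolding D_def by (intro mult_mono) auto
      then show ?thesis using True u by (simp add: f_def ennreal_leI)
    next
      case u: False
      have "u powr (- q - 1) = 1 / u powr q * (1 / u)"
        using True c by (simp add: powr_diff powr_minus divide_simps)
      then show ?thesis using u True by (simp add: f_def)
    qed
  qed (simp add: f_def)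
  then have "(\<integral>\<^sup>+ u. f u \<partial>lborel) \<le> (\<integral>\<^sup>+ u. ennreal D * indicator {c..1} u
      + ennreal (A u powr r / u powr q * (1 / u)) * indicator {1..} u \<partial>lborel)"
    by (intro nn_integral_mono)
  also have "\<dots> = ennreal D * emeasure lborel {c..1}
      + (\<integral>\<^sup>+ u\<in>{1..}. ennreal (A u powr r / u powr q * (1 / u)) \<partial>lborel)"
    by (subst nn_integral_add) (simp_all add: nn_integral_cmult_indicator)
  also have "\<dots> < \<infinity>"
    using B c by (simp add: B_class2_def A_def r_def ennreal_mult_less_top)
  finally have fin: "(\<integral>\<^sup>+ u. f u \<partial>lborel) < \<infinity>" .
  define K where "K = enn2real (\<integral>\<^sup>+ u. f u \<partial>lborel)"
  have K: "(\<integral>\<^sup>+ u. f u \<partial>lborel) = ennreal K" using fin by (simp add: K_def)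
  have "(\<integral>\<^sup>+ t\<in>{t. 0 < t \<and> c < u * t}. ennreal (A (u * t) powr r * t powr (- q - 1)) \<partial>lborel)
      \<le> ennreal (K * u powr q)" if u: "0 < u" for u
  proof -
    have "(\<integral>\<^sup>+ t\<in>{t. 0 < t \<and> c < u * t}. ennreal (A (u * t) powr r * t powr (- q - 1)) \<partial>lborel)
        = (\<integral>\<^sup>+ t. ennreal (u powr (q + 1)) * f (0 + u * t) \<partial>lborel)"
    proof (rule nn_integral_cong)
      fix t
      show "ennreal (A (u * t) powr r * t powr (- q - 1)) * indicator {t. 0 < t \<and> c < u * t} t
          = ennreal (u powr (q + 1)) * f (0 + u * t)"
      proof (cases "c < u * t")
        case True
        then have t: "0 < t" using c u by (metis less_trans zero_less_mult_pos)
        have "u powr (q + 1) * (u * t) powr (- q - 1) = t powr (- q - 1)"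
          using u t by (simp add: powr_mult powr_add powr_diff powr_minus divide_simps)
        then have "A (u * t) powr r * t powr (- q - 1) = u powr (q + 1) * (A (u * t) powr r * (u * t) powr (- q - 1))"
          by (metis mult.left_commute)
        then show ?thesis using True t
          by (simp only: f_def add_0 ennreal_mult powr_ge_zero mult_nonneg_nonneg) simp
      qed (simp add: f_def)
    qed
    also have "\<dots> = ennreal (u powr (q + 1)) * (\<integral>\<^sup>+ t. f (0 + u * t) \<partial>lborel)"
      by (rule nn_integral_cmult) measurable
    also have "u powr (q + 1) = u powr q * \<bar>u\<bar>" using u by (simp add: powr_add)
    also have "ennreal (u powr q * \<bar>u\<bar>) * (\<integral>\<^sup>+ t. f (0 + u * t) \<partial>lborel) =
        ennreal (u powr q) * (ennreal \<bar>u\<bar> * (\<integral>\<^sup>+ t. f (0 + u * t) \<partial>lborel))"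
      by (simp add: ennreal_mult mult.assoc)
    also have "ennreal \<bar>u\<bar> * (\<integral>\<^sup>+ t. f (0 + u * t) \<partial>lborel) = ennreal K"
      using nn_integral_real_affine[of f u 0] u K by simp
    also have "ennreal (u powr q) * ennreal K = ennreal (K * u powr q)"
      by (simp add: ennreal_mult[symmetric] K_def mult.commute)
    finally show ?thesis by simp
  qed
  then show ?thesis using that[of c K] c Ac by (simp add: K_def r_def)
qed

section \<open>Carleson embedding for Luxemburg norms\<close>

lemma sum_UN_le:
  fixes f :: "'a \<Rightarrow> real"
  assumes "finite M" "\<And>R. finite (D R)" "\<And>T. 0 \<le> f T"
  shows "sum f (\<Union>R\<in>M. D R) \<le> (\<Sum>R\<in>M. sum f (D R))"
  using assms(1)
proof induction
  case (insert R M)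
  have "sum f (D R \<union> (\<Union>R\<in>M. D R)) \<le> sum f (D R) + sum f (\<Union>R\<in>M. D R)"
    using sum.union_inter[of "D R" "\<Union>R\<in>M. D R" f] sum_nonneg[of "D R \<inter> (\<Union>R\<in>M. D R)" f] assms insert.hyps(1)
    by simp
  then show ?case using insert by simp
qed simp

lemma sum_nn_integral_disjoint_le:
  assumes S: "finite S" and C: "\<And>T. T \<in> S \<Longrightarrow> C T \<in> sets M"
    and disj: "\<And>T T' x. T \<in> S \<Longrightarrow> T' \<in> S \<Longrightarrow> x \<in> C T \<Longrightarrow> x \<in> C T' \<Longrightarrow> T = T'"
    and f: "f \<in> borel_measurable M"
  shows "(\<Sum>T\<in>S. \<integral>\<^sup>+ x\<in>C T. f x \<partial>M) \<le> (\<integral>\<^sup>+ x. f x \<partial>M)"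
proof -
  have "(\<Sum>T\<in>S. \<integral>\<^sup>+ x\<in>C T. f x \<partial>M) = (\<integral>\<^sup>+ x. (\<Sum>T\<in>S. f x * indicator (C T) x) \<partial>M)"
    using C f by (intro nn_integral_sum[symmetric]) (auto intro!: borel_measurable_times_ennreal)
  also have "\<dots> \<le> (\<integral>\<^sup>+ x. f x \<partial>M)"
  proof (rule nn_integral_mono)
    fix x
    show "(\<Sum>T\<in>S. f x * indicator (C T) x) \<le> f x"
    proof (cases "\<exists>T\<in>S. x \<in> C T")
      case True
      then obtain T where T: "T \<in> S" "x \<in> C T" by blast
      have "(\<Sum>T'\<in>S. f x * indicator (C T') x) = (\<Sum>T'\<in>S. if T' = T then f x else 0)"
        using disj[OF T(1)] T(2) by (intro sum.cong) (auto simp: indicator_def)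
      then show ?thesis using S T(1) by simp
    qed simp
  qed
  finally show ?thesis .
qed

text \<open>Jensen's inequality for the measure \<open>g powr p\<close>, in the form of Young's inequality with
  \<open>y = v / (2 * G)\<close>.\<close>

lemma cell_jensen:
  fixes g :: "'a::euclidean_space \<Rightarrow> real"
  assumes A [measurable]: "A \<in> borel_measurable borel" and A0: "\<And>t. 0 \<le> A t"
    and g [measurable]: "g \<in> borel_measurable borel" and g0: "\<And>x. 0 \<le> g x"
    and C [measurable]: "C \<in> sets borel"
    and pq: "0 < p" "p \<le> q" and c: "0 < c" and t: "0 < t" and G: "0 < G"
    and gG: "(\<integral>\<^sup>+ x. ennreal (g x powr p) \<partial>lborel) \<le> ennreal G" and v: "0 < v"
    and vle: "ennreal (v / 2) \<le> (\<integral>\<^sup>+ x\<in>C. ennreal (A (g x * t)) * indicator {x. c < g x * t} x \<partial>lborel)"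
  shows "ennreal ((v / 2) powr (q / p)) \<le> ennreal (G powr (q / p - 1)) *
    (\<integral>\<^sup>+ x\<in>C. ennreal (A (g x * t) powr (q / p) * g x powr (p - q)) * indicator {x. c < g x * t} x \<partial>lborel)"
    (is "_ \<le> _ * ?Z")
proof -
  define r where "r = q / p"
  have r: "1 \<le> r" and pr: "p * r = q" using pq by (simp_all add: r_def)
  define y where "y = v / (2 * G)"
  have y: "0 < y" using v G by (simp add: y_def)
  have I: "{x. c < g x * t} \<in> sets borel" by measurable
  have pw: "ennreal (y powr (r - 1)) * (ennreal (A (g x * t)) * indicator {x. c < g x * t} x * indicator C x) \<le>
      ennreal (1 / r) * (ennreal (A (g x * t) powr r * g x powr (p - q)) * indicator {x. c < g x * t} x * indicator C x)
      + ennreal ((1 - 1 / r) * y powr r) * ennreal (g x powr p)" for x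
  proof (cases "x \<in> C \<and> c < g x * t")
    case True
    have gp: "0 < g x" using True c t g0[of x] by (metis less_trans zero_less_mult_pos2)
    define a where "a = A (g x * t)"
    have a0: "0 \<le> a" by (simp add: a_def A0)
    \<comment> \<open>Here \<open>p * r = q\<close> enters; it is the origin of the weight
      \<open>g x powr (p - q)\<close>.\<close>
    have e: "(a / g x powr p) powr r * g x powr p = a powr r * g x powr (p - q)"
      using gp a0 pr by (simp add: powr_divide powr_powr powr_diff)
    have "a * y powr (r - 1) = (a / g x powr p) * y powr (r - 1) * g x powr p" using gp by simp
    also have "\<dots> \<le> ((a / g x powr p) powr r / r + (1 - 1 / r) * y powr r) * g x powr p"
      using a0 gp y r by (intro mult_right_mono young_power_inequality) auto
    also have "\<dots> = 1 / r * (a powr r * g x powr (p - q)) + (1 - 1 / r) * y powr r * g x powr p"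
      unfolding e[symmetric] by (simp add: algebra_simps)
    finally have "ennreal (y powr (r - 1) * a) \<le> ennreal (1 / r * (a powr r * g x powr (p - q)) + (1 - 1 / r) * y powr r * g x powr p)"
      by (simp add: mult.commute ennreal_leI)
    then show ?thesis using True r a0
      by (simp add: a_def[symmetric] ennreal_mult[symmetric] ennreal_plus[symmetric] del: ennreal_plus)
  qed auto
  have "ennreal (y powr (r - 1)) * ennreal (v / 2) \<le>
      ennreal (y powr (r - 1)) * (\<integral>\<^sup>+ x\<in>C. ennreal (A (g x * t)) * indicator {x. c < g x * t} x \<partial>lborel)"
    by (intro mult_left_mono vle) simp
  also have "\<dots> = (\<integral>\<^sup>+ x. ennreal (y powr (r - 1)) * (ennreal (A (g x * t)) * indicator {x. c < g x * t} x * indicator C x) \<partial>lborel)"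
    by (rule nn_integral_cmult[symmetric]) measurable
  also have "\<dots> \<le> (\<integral>\<^sup>+ x. ennreal (1 / r) * (ennreal (A (g x * t) powr r * g x powr (p - q)) * indicator {x. c < g x * t} x * indicator C x)
      + ennreal ((1 - 1 / r) * y powr r) * ennreal (g x powr p) \<partial>lborel)"
    by (intro nn_integral_mono pw)
  also have "\<dots> = ennreal (1 / r) * ?Z + ennreal ((1 - 1 / r) * y powr r) * (\<integral>\<^sup>+ x. ennreal (g x powr p) \<partial>lborel)"
    unfolding r_def[symmetric]
    by (subst nn_integral_add, measurable, subst nn_integral_cmult, measurable, subst nn_integral_cmult, measurable)
  also have "\<dots> \<le> ennreal (1 / r) * ?Z + ennreal ((1 - 1 / r) * y powr r) * ennreal G"
    by (intro add_mono mult_left_mono gG) auto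
  finally have main: "ennreal (y powr (r - 1)) * ennreal (v / 2) \<le>
      ennreal (1 / r) * ?Z + ennreal ((1 - 1 / r) * y powr r) * ennreal G" .
  show ?thesis
  proof (cases "?Z = \<infinity>")
    case True
    then show ?thesis using G by (simp add: ennreal_mult_top)
  next
    case False
    define z where "z = enn2real ?Z"
    have z: "?Z = ennreal z" "0 \<le> z" using False by (simp_all add: z_def less_top)
    \<comment> \<open>As \<open>v / 2 = y * G\<close>, both sides of \<open>main\<close> contain
      \<open>y powr r * G\<close>; cancelling leaves \<open>y powr r * G \<le> z\<close>, which is
      the claim up to a power of \<open>G\<close>.\<close>
    have vy: "v / 2 = y * G" using G by (simp add: y_def)
    have "ennreal (y powr (r - 1) * (v / 2)) \<le> ennreal (1 / r * z + (1 - 1 / r) * y powr r * G)"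
      using main r G v z by (simp add: ennreal_mult[symmetric] ennreal_plus[symmetric] del: ennreal_plus)
    moreover have "0 \<le> 1 / r * z + (1 - 1 / r) * y powr r * G"
      using r z G by (intro add_nonneg_nonneg mult_nonneg_nonneg) auto
    ultimately have "y powr (r - 1) * (v / 2) \<le> 1 / r * z + (1 - 1 / r) * y powr r * G"
      by (simp add: ennreal_le_iff)
    moreover have "y powr (r - 1) * (v / 2) = y powr r * G"
      using y by (simp add: vy powr_diff)
    ultimately have "1 / r * (y powr r * G) \<le> 1 / r * z" by (simp add: algebra_simps)
    then have yz: "y powr r * G \<le> z" using r by (simp add: divide_le_cancel split: if_splits)
    have "(v / 2) powr r = G powr (r - 1) * (y powr r * G)"
      using y G by (simp add: vy powr_mult powr_diff)
    also have "\<dots> \<le> G powr (r - 1) * z" by (intro mult_left_mono yz) simp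
    finally show ?thesis using z by (simp add: r_def[symmetric] ennreal_mult[symmetric] ennreal_leI)
  qed
qed

context dyadic_grid
begin

lemma cells_nested:
  assumes "x \<in> cell i p" "x \<in> cell j m" "i \<le> j"
  shows "(halve ^^ (j - i)) m = p"
  using assms cidx_ancestor[of "j - i" i x] by (auto simp: cell_def)

text \<open>For each reciprocal level \<open>t\<close>, packing reduces the cells of norm above
  \<open>1 / t\<close> to the maximal ones, which are disjoint, and \<open>cell_jensen\<close>
  bounds their volumes by an integral of \<open>g\<close>. Integrating in \<open>t\<close> and
  applying the tail estimate recovers the integral of \<open>g powr p\<close>. The tail is a
  hypothesis, so that \<open>c\<close> and \<open>K\<close> are fixed before \<open>S\<close> and
  \<open>g\<close>.\<close>

lemma carleson_embedding:
  fixes S :: "(nat \<times> (int^'d)) set" and g :: "real^'d \<Rightarrow> real"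
  assumes Y: "young_function \<Phi>" and pq: "0 < p" "p \<le> q"
    and c: "0 < c" "young_associate \<Phi> c \<le> 1 / 2" and K: "0 \<le> K"
    and tail: "\<And>u. 0 < u \<Longrightarrow> (\<integral>\<^sup>+ t\<in>{t. 0 < t \<and> c < u * t}.
        ennreal (young_associate \<Phi> (u * t) powr (q / p) * t powr (- q - 1)) \<partial>lborel) \<le> ennreal (K * u powr q)"
    and S: "finite S" and La: "0 \<le> \<Lambda>"
    and packing: "\<And>i k. (\<Sum>(j, m)\<in>{(j, m)\<in>S. i \<le> j \<and> (halve ^^ (j - i)) m = k}. vol TYPE('d) j) \<le> \<Lambda> * vol TYPE('d) i"
    and g [measurable]: "g \<in> borel_measurable borel" and g0: "\<And>x. 0 \<le> g x"
    and G: "0 < G" and gG: "(\<integral>\<^sup>+ x. ennreal (g x powr p) \<partial>lborel) \<le> ennreal G"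
    and lux: "\<And>T. T \<in> S \<Longrightarrow> 0 \<le> luxemburg (young_associate \<Phi>) (cell (fst T) (snd T)) g"
  shows "(\<Sum>T\<in>S. vol TYPE('d) (fst T) powr (q / p) * luxemburg (young_associate \<Phi>) (cell (fst T) (snd T)) g powr q)
    \<le> q * \<Lambda> * 2 powr (q / p) * K * G powr (q / p)"
proof -
  define A where "A = young_associate \<Phi>"
  define r where "r = q / p"
  have r: "1 \<le> r" using pq by (simp add: r_def)
  have A0: "0 \<le> A t" for t by (simp add: A_def young_associate_nonneg[OF Y])
  have [measurable]: "A \<in> borel_measurable borel"
    unfolding A_def by (rule borel_measurable_young_associate[OF Y])
  define lam where "lam T = luxemburg A (cell (fst T) (snd T)) g" for T :: "nat \<times> (int^'d)"
  define v where "v T = vol TYPE('d) (fst T)" for T :: "nat \<times> (int^'d)"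
  define Cl where "Cl T = cell (fst T) (snd T)" for T :: "nat \<times> (int^'d)"
  have vpos: "0 < v T" for T by (simp add: v_def vol_pos)
  have ClM [measurable]: "Cl T \<in> sets borel" for T by (simp add: Cl_def cell_borel)
  define h where "h t x = ennreal (A (g x * t) powr r * g x powr (p - q)) * indicator {x. c < g x * t} x" for t x
  have hM [measurable]: "h t \<in> borel_measurable borel" for t unfolding h_def[abs_def] by measurable
  define cG where "cG = \<Lambda> * 2 powr r * G powr (r - 1)"
  have cG: "0 \<le> cG" using La by (simp add: cG_def)

  \<comment> \<open>When the norm exceeds \<open>1 / t\<close>, the modular at \<open>1 / t\<close>
    exceeds the volume; points with \<open>g x * t \<le> c\<close> supply at most half of the
    volume, so the others supply the rest.\<close>
  have cell_bound: "ennreal ((v T / 2) powr r) \<le> ennreal (G powr (r - 1)) * (\<integral>\<^sup>+ x\<in>Cl T. h t x \<partial>lborel)"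
    if t: "0 < t" "1 < t * lam T" for t T
  proof -
    have s: "0 < 1 / t" "1 / t < lam T" using t by (simp_all add: field_simps)
    define hh where "hh = ennreal (1 / 2)"
    have hv: "hh * ennreal (v T) = ennreal (v T / 2)"
      unfolding hh_def by (subst ennreal_mult[symmetric]) (simp_all add: vpos less_imp_le)
    have "ennreal (v T) = emeasure lborel (Cl T)"
      by (simp add: v_def Cl_def emeasure_cell)
    also have "\<dots> \<le> (\<integral>\<^sup>+ x\<in>Cl T. ennreal (A (g x / (1 / t))) \<partial>lborel)"
      unfolding Cl_def using less_luxemburg_imp[of "1 / t" A "cell (fst T) (snd T)" g] s
      by (simp add: lam_def less_imp_le)
    also have "\<dots> \<le> (\<integral>\<^sup>+ x. ennreal (A (g x * t)) * indicator {x. c < g x * t} x * indicator (Cl T) x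
        + hh * indicator (Cl T) x \<partial>lborel)"
    proof (rule nn_integral_mono)
      fix x
      have "ennreal (A (g x * t)) \<le> hh" if "\<not> c < g x * t"
      proof -
        have "A (g x * t) \<le> A c" unfolding A_def using that by (intro young_associate_mono[OF Y]) simp
        then show ?thesis unfolding hh_def using c(2) by (intro ennreal_leI) (simp add: A_def)
      qed
      then show "ennreal (A (g x / (1 / t))) * indicator (Cl T) x \<le>
          ennreal (A (g x * t)) * indicator {x. c < g x * t} x * indicator (Cl T) x + hh * indicator (Cl T) x"
        by (cases "x \<in> Cl T"; cases "c < g x * t") simp_all
    qed
    also have "\<dots> = (\<integral>\<^sup>+ x\<in>Cl T. ennreal (A (g x * t)) * indicator {x. c < g x * t} x \<partial>lborel) + hh * ennreal (v T)"
    proof -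
      have "emeasure lborel (Cl T) = ennreal (v T)" by (simp add: v_def Cl_def emeasure_cell)
      then show ?thesis
        by (subst nn_integral_add) (auto simp: nn_integral_cmult_indicator)
    qed
    finally have le: "ennreal (v T) \<le> (\<integral>\<^sup>+ x\<in>Cl T. ennreal (A (g x * t)) * indicator {x. c < g x * t} x \<partial>lborel)
        + ennreal (v T / 2)" (is "_ \<le> ?Y + _")
      unfolding hv .
    have "ennreal (v T / 2) \<le> ?Y"
    proof (cases ?Y)
      case (real y)
      then show ?thesis using le vpos[of T]
        by (simp add: ennreal_plus[symmetric] ennreal_le_iff del: ennreal_plus)
    qed simp
    from cell_jensen[OF _ A0 g g0 ClM pq c(1) t(1) G gG vpos this]
    show ?thesis unfolding h_def r_def by measurable
  qed

  have level_bound: "(\<Sum>T\<in>{T\<in>S. 1 < t * lam T}. ennreal (v T powr r)) \<le> ennreal cG * (\<integral>\<^sup>+ x. h t x \<partial>lborel)"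
    if t: "0 < t" for t
  proof -
    define S' where "S' = {T\<in>S. 1 < t * lam T}"
    have fS': "finite S'" using S by (simp add: S'_def)
    define anc where "anc i T = (i, (halve ^^ (fst T - i)) (snd T))" for i and T :: "nat \<times> (int^'d)"
    \<comment> \<open>The maximal cells of the level set; by nestedness they are pairwise
      disjoint.\<close>
    define M where "M = {T\<in>S'. \<forall>i<fst T. anc i T \<notin> S'}"
    have fM: "finite M" using fS' by (simp add: M_def)
    define D where "D R = {T\<in>S. fst R \<le> fst T \<and> anc (fst R) T = R}" for R
    have fD: "finite (D R)" for R using S by (simp add: D_def)
    have cover: "S' \<subseteq> (\<Union>R\<in>M. D R)"
    proof
      fix T assume T: "T \<in> S'"
      \<comment> \<open>Level of the topmost ancestor of \<open>T\<close> in \<open>S'\<close>; the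
        search succeeds because \<open>T\<close> is its own ancestor.\<close>
      define i where "i = (LEAST i. i \<le> fst T \<and> anc i T \<in> S')"
      have ex: "fst T \<le> fst T \<and> anc (fst T) T \<in> S'" using T by (simp add: anc_def)
      have i: "i \<le> fst T" "anc i T \<in> S'"
        using LeastI[of "\<lambda>i. i \<le> fst T \<and> anc i T \<in> S'", OF ex] by (simp_all add: i_def)
      have "anc l (anc i T) \<notin> S'" if "l < i" for l
      proof -
        have "(halve ^^ (i - l)) ((halve ^^ (fst T - i)) (snd T)) = (halve ^^ (fst T - l)) (snd T)"
          using that i(1) by (simp add: funpow_add[symmetric, unfolded comp_def, THEN fun_cong])
        then have "anc l (anc i T) = anc l T" by (simp add: anc_def)
        moreover have "anc l T \<notin> S'"
          using not_less_Least[of l "\<lambda>i. i \<le> fst T \<and> anc i T \<in> S'"] that i(1) by (auto simp: i_def[symmetric])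
        ultimately show ?thesis by simp
      qed
      then have "anc i T \<in> M" using i(2) by (simp add: M_def anc_def)
      moreover have "T \<in> D (anc i T)" using T i(1) by (simp add: D_def S'_def anc_def)
      ultimately show "T \<in> (\<Union>R\<in>M. D R)" by blast
    qed
    have disj: "R = R'" if "R \<in> M" "R' \<in> M" "x \<in> Cl R" "x \<in> Cl R'" for R R' x
    proof -
      have *: "R = R'" if R: "R \<in> M" "R' \<in> M" "x \<in> Cl R" "x \<in> Cl R'" "fst R \<le> fst R'" for R R'
      proof -
        have "anc (fst R) R' = R"
          using cells_nested[of x "fst R" "snd R" "fst R'" "snd R'"] R by (simp add: anc_def Cl_def)
        moreover have "R \<in> S'" using R(1) by (simp add: M_def)
        ultimately have "\<not> fst R < fst R'" using R(2) by (auto simp: M_def)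
        then have "fst R = fst R'" using R(5) by simp
        with \<open>anc (fst R) R' = R\<close> show ?thesis by (simp add: anc_def prod_eq_iff)
      qed
      show ?thesis using *[of R R'] *[of R' R] that by (metis linear)
    qed
    \<comment> \<open>Cells below \<open>R\<close> are no larger than \<open>R\<close>, and
      \<open>r - 1 \<ge> 0\<close>: the power \<open>r - 1\<close> is bounded by that of
      \<open>R\<close>, and packing applies to the remaining first power.\<close>
    have block: "(\<Sum>T\<in>D R. v T powr r) \<le> \<Lambda> * v R powr r" for R
    proof -
      have "(\<Sum>T\<in>D R. v T powr r) \<le> (\<Sum>T\<in>D R. v T * v R powr (r - 1))"
      proof (rule sum_mono)
        fix T assume "T \<in> D R"
        then have "v T \<le> v R" by (simp add: D_def v_def vol_mono)
        then have "v T powr (r - 1) \<le> v R powr (r - 1)" using vpos[of T] r by (intro powr_mono2) auto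
        then have "v T * v T powr (r - 1) \<le> v T * v R powr (r - 1)"
          using vpos[of T] by (intro mult_left_mono) auto
        moreover have "v T * v T powr (r - 1) = v T powr r" using vpos[of T] by (simp add: powr_diff)
        ultimately show "v T powr r \<le> v T * v R powr (r - 1)" by simp
      qed
      also have "\<dots> = (\<Sum>T\<in>D R. v T) * v R powr (r - 1)" by (simp add: sum_distrib_right)
      also have "(\<Sum>T\<in>D R. v T) \<le> \<Lambda> * v R"
      proof -
        have "D R = {(j, m)\<in>S. fst R \<le> j \<and> (halve ^^ (j - fst R)) m = snd R}"
          by (auto simp: D_def anc_def prod_eq_iff)
        then show ?thesis using packing[of "fst R" "snd R"] by (simp add: v_def case_prod_unfold)
      qed
      also have "\<Lambda> * v R * v R powr (r - 1) = \<Lambda> * v R powr r"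
        using vpos[of R] by (simp add: powr_diff)
      finally show ?thesis by (simp add: mult_right_mono)
    qed
    have "(\<Sum>T\<in>S'. v T powr r) \<le> (\<Sum>T\<in>(\<Union>R\<in>M. D R). v T powr r)"
      using fM fD cover by (intro sum_mono2) auto
    also have "\<dots> \<le> (\<Sum>R\<in>M. \<Sum>T\<in>D R. v T powr r)"
      using fM fD by (intro sum_UN_le) auto
    also have "\<dots> \<le> (\<Sum>R\<in>M. \<Lambda> * v R powr r)" by (intro sum_mono block)
    also have "\<dots> = (\<Sum>R\<in>M. \<Lambda> * 2 powr r * (v R / 2) powr r)"
      using vpos by (intro sum.cong) (auto simp: powr_divide less_imp_le)
    also have "\<dots> = \<Lambda> * 2 powr r * (\<Sum>R\<in>M. (v R / 2) powr r)" by (simp add: sum_distrib_left)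
    finally have "ennreal (\<Sum>T\<in>S'. v T powr r) \<le> ennreal (\<Lambda> * 2 powr r) * ennreal (\<Sum>R\<in>M. (v R / 2) powr r)"
      using La by (subst ennreal_mult[symmetric]) (auto intro: ennreal_leI sum_nonneg)
    also have "ennreal (\<Sum>R\<in>M. (v R / 2) powr r) = (\<Sum>R\<in>M. ennreal ((v R / 2) powr r))"
      by simp
    also have "\<dots> \<le> (\<Sum>R\<in>M. ennreal (G powr (r - 1)) * (\<integral>\<^sup>+ x\<in>Cl R. h t x \<partial>lborel))"
      using t by (intro sum_mono cell_bound) (auto simp: M_def S'_def)
    also have "\<dots> = ennreal (G powr (r - 1)) * (\<Sum>R\<in>M. \<integral>\<^sup>+ x\<in>Cl R. h t x \<partial>lborel)"
      by (simp add: sum_distrib_left)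
    also have "\<dots> \<le> ennreal (G powr (r - 1)) * (\<integral>\<^sup>+ x. h t x \<partial>lborel)"
      using fM disj by (intro mult_left_mono sum_nn_integral_disjoint_le) auto
    finally have "ennreal (\<Sum>T\<in>S'. v T powr r) \<le>
        ennreal (\<Lambda> * 2 powr r) * (ennreal (G powr (r - 1)) * (\<integral>\<^sup>+ x. h t x \<partial>lborel))"
      by (simp add: mult_left_mono)
    also have "\<dots> = ennreal cG * (\<integral>\<^sup>+ x. h t x \<partial>lborel)"
      using La by (simp add: cG_def ennreal_mult mult.assoc)
    finally show ?thesis by (simp add: S'_def)
  qed

  define w where "w t = ennreal (t powr (- q - 1)) * indicator {0<..} t" for t :: real
  have [measurable]: "w \<in> borel_measurable borel" unfolding w_def[abs_def] by measurable
  have "ennreal (\<Sum>T\<in>S. v T powr r * lam T powr q) = (\<Sum>T\<in>S. ennreal (v T powr r) * ennreal (lam T powr q))"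
    by (simp add: ennreal_mult[symmetric])
  also have "\<dots> \<le> (\<Sum>T\<in>S. ennreal (v T powr r) * (ennreal q * (\<integral>\<^sup>+ t. w t * indicator {t. 1 < t * lam T} t \<partial>lborel)))"
  proof (intro sum_mono mult_left_mono)
    fix T assume "T \<in> S"
    then have "0 \<le> lam T" using lux by (simp add: lam_def A_def)
    moreover have "indicator {t. 0 < t \<and> 1 < t * lam T} t = (indicator {0<..} t * indicator {t. 1 < t * lam T} t :: ennreal)" for t
      by (simp add: indicator_def)
    ultimately show "ennreal (lam T powr q) \<le> ennreal q * (\<integral>\<^sup>+ t. w t * indicator {t. 1 < t * lam T} t \<partial>lborel)"
      using powr_layer_cake[of q "lam T"] pq by (simp add: w_def mult.assoc)
  qed simp
  also have "\<dots> = ennreal q * (\<integral>\<^sup>+ t. (\<Sum>T\<in>S. ennreal (v T powr r) * (w t * indicator {t. 1 < t * lam T} t)) \<partial>lborel)"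
  proof -
    have "(\<integral>\<^sup>+ t. (\<Sum>T\<in>S. ennreal (v T powr r) * (w t * indicator {t. 1 < t * lam T} t)) \<partial>lborel)
        = (\<Sum>T\<in>S. \<integral>\<^sup>+ t. ennreal (v T powr r) * (w t * indicator {t. 1 < t * lam T} t) \<partial>lborel)"
      by (rule nn_integral_sum) measurable
    also have "\<dots> = (\<Sum>T\<in>S. ennreal (v T powr r) * (\<integral>\<^sup>+ t. w t * indicator {t. 1 < t * lam T} t \<partial>lborel))"
      by (intro sum.cong refl nn_integral_cmult) measurable
    finally show ?thesis by (simp only: sum_distrib_left mult.left_commute)
  qed
  also have "\<dots> \<le> ennreal q * (\<integral>\<^sup>+ t. ennreal cG * (\<integral>\<^sup>+ x. w t * h t x \<partial>lborel) \<partial>lborel)"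
  proof (intro mult_left_mono nn_integral_mono)
    fix t
    show "(\<Sum>T\<in>S. ennreal (v T powr r) * (w t * indicator {t. 1 < t * lam T} t)) \<le> ennreal cG * (\<integral>\<^sup>+ x. w t * h t x \<partial>lborel)"
    proof (cases "0 < t")
      case True
      have "(\<Sum>T\<in>S. ennreal (v T powr r) * (w t * indicator {t. 1 < t * lam T} t))
          = w t * (\<Sum>T\<in>S. ennreal (v T powr r) * indicator {t. 1 < t * lam T} t)"
        by (simp add: sum_distrib_left mult_ac)
      also have "(\<Sum>T\<in>S. ennreal (v T powr r) * indicator {t. 1 < t * lam T} t) = (\<Sum>T\<in>{T\<in>S. 1 < t * lam T}. ennreal (v T powr r))"
        using S by (intro sum.mono_neutral_cong_right) (auto simp: indicator_def)
      also have "w t * \<dots> \<le> w t * (ennreal cG * (\<integral>\<^sup>+ x. h t x \<partial>lborel))"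
        by (intro mult_left_mono level_bound[OF True]) simp
      also have "\<dots> = ennreal cG * (\<integral>\<^sup>+ x. w t * h t x \<partial>lborel)"
        by (simp add: nn_integral_cmult mult.left_commute)
      finally show ?thesis .
    qed (simp add: w_def)
  qed simp
  also have "(\<integral>\<^sup>+ t. ennreal cG * (\<integral>\<^sup>+ x. w t * h t x \<partial>lborel) \<partial>lborel) =
      ennreal cG * (\<integral>\<^sup>+ t. (\<integral>\<^sup>+ x. w t * h t x \<partial>lborel) \<partial>lborel)"
    unfolding h_def by (rule nn_integral_cmult) measurable
  \<comment> \<open>After the interchange the inner integral is, for fixed \<open>x\<close>, the
    tail integral at \<open>u = g x\<close> times \<open>g x powr (p - q)\<close>, hence at most
    \<open>K * g x powr p\<close>.\<close>
  also have "(\<integral>\<^sup>+ t. (\<integral>\<^sup>+ x. w t * h t x \<partial>lborel) \<partial>lborel) = (\<integral>\<^sup>+ x. (\<integral>\<^sup>+ t. w t * h t x \<partial>lborel) \<partial>lborel)"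
    unfolding h_def by (rule lborel_pair.Fubini') measurable
  also have "\<dots> \<le> (\<integral>\<^sup>+ x. ennreal K * ennreal (g x powr p) \<partial>lborel)"
  proof (rule nn_integral_mono)
    fix x
    show "(\<integral>\<^sup>+ t. w t * h t x \<partial>lborel) \<le> ennreal K * ennreal (g x powr p)"
    proof (cases "0 < g x")
      case True
      have "(\<integral>\<^sup>+ t. w t * h t x \<partial>lborel) = (\<integral>\<^sup>+ t. ennreal (g x powr (p - q)) *
          (ennreal (A (g x * t) powr r * t powr (- q - 1)) * indicator {t. 0 < t \<and> c < g x * t} t) \<partial>lborel)"
        by (intro nn_integral_cong) (auto simp: w_def h_def ennreal_mult indicator_def mult_ac)
      also have "\<dots> = ennreal (g x powr (p - q)) *
          (\<integral>\<^sup>+ t\<in>{t. 0 < t \<and> c < g x * t}. ennreal (A (g x * t) powr r * t powr (- q - 1)) \<partial>lborel)"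
        by (rule nn_integral_cmult) measurable
      also have "\<dots> \<le> ennreal (g x powr (p - q)) * ennreal (K * g x powr q)"
        using tail[OF True] by (intro mult_left_mono) (simp_all add: A_def r_def)
      also have "\<dots> = ennreal K * ennreal (g x powr p)"
        using K True by (simp add: ennreal_mult[symmetric] powr_diff)
      finally show ?thesis .
    next
      case False
      then have "h t x = 0" for t using c(1) g0[of x] by (simp add: h_def indicator_def)
      then show ?thesis by simp
    qed
  qed
  also have "(\<integral>\<^sup>+ x. ennreal K * ennreal (g x powr p) \<partial>lborel) = ennreal K * (\<integral>\<^sup>+ x. ennreal (g x powr p) \<partial>lborel)"
    by (rule nn_integral_cmult) measurable
  also have "\<dots> \<le> ennreal K * ennreal G" by (intro mult_left_mono gG) simp
  finally have "ennreal (\<Sum>T\<in>S. v T powr r * lam T powr q) \<le> ennreal q * (ennreal cG * (ennreal K * ennreal G))"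
    by (simp add: mult_left_mono)
  also have "\<dots> = ennreal (q * (cG * (K * G)))"
    using pq cG K G by (simp add: ennreal_mult)
  finally have "(\<Sum>T\<in>S. v T powr r * lam T powr q) \<le> q * (cG * (K * G))"
    using pq cG K G by (subst (asm) ennreal_le_iff) auto
  also have "\<dots> = q * \<Lambda> * 2 powr r * K * G powr r"
    using G by (simp add: cG_def powr_diff)
  finally show ?thesis by (simp add: v_def lam_def A_def r_def)
qed

end

section \<open>Hoelder's inequality for iterated Orlicz norms\<close>

lemma young_ennreal_mono:
  assumes Y: "young_function \<Phi>" and st: "s \<le> t"
  shows "young_ennreal \<Phi> s \<le> young_ennreal \<Phi> t"
proof (cases "t = \<infinity>")
  case False
  then have "s \<noteq> \<infinity>" using st by (auto simp: top_unique)
  moreover have "enn2real s \<le> enn2real t" using st False by (intro enn2real_mono) (auto simp: less_top)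
  ultimately show ?thesis using False
    by (simp add: young_ennreal_def ennreal_leI young_function_mono[OF Y])
qed (simp add: young_ennreal_def)

lemma nn_integral_lebesgue_eq: "(\<integral>\<^sup>+ x\<in>Q. f x \<partial>lebesgue) = (\<integral>\<^sup>+ x\<in>Q. f x \<partial>lborel)"
  by (rule nn_integral_completion)

lemma ennreal_average_le_1_iff:
  assumes "0 < v"
  shows "(1 / ennreal v) * I \<le> 1 \<longleftrightarrow> I \<le> ennreal v"
proof (cases I)
  case (real i)
  have "1 / ennreal v = ennreal (1 / v)"
    using divide_ennreal[of 1 v] assms by simp
  then have "(1 / ennreal v) * I = ennreal (1 / v * i)" using real assms by (subst ennreal_mult) auto
  also have "\<dots> \<le> ennreal 1 \<longleftrightarrow> 1 / v * i \<le> 1" by (rule ennreal_le_iff) simp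
  also have "\<dots> \<longleftrightarrow> i \<le> v" using assms by (simp add: field_simps)
  finally show ?thesis using real assms by (simp add: ennreal_le_iff)
next
  case top
  have "1 / ennreal v = ennreal (1 / v)"
    using divide_ennreal[of 1 v] assms by simp
  then show ?thesis using top assms by (simp add: ennreal_mult_top top_unique)
qed

text \<open>Hoelder's inequality in both variables; the inner norm need not be a measurable function of
  \<open>x\<close>, since only the measurable function \<open>k0 / (2 * dg)\<close> below it is integrated.\<close>

lemma double_orlicz_holder:
  fixes K :: "real^'d \<Rightarrow> real^'d \<Rightarrow> real"
  assumes YF: "young_function \<Phi>" and YP: "young_function \<Psi>"
    and K [measurable]: "(\<lambda>(x, y). K x y) \<in> borel_measurable (borel \<Otimes>\<^sub>M borel)" and K0: "\<And>x y. 0 \<le> K x y"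
    and g [measurable]: "g \<in> borel_measurable borel" and g0: "\<And>y. 0 \<le> g y"
    and h [measurable]: "h \<in> borel_measurable borel" and h0: "\<And>x. 0 \<le> h x"
    and Q [measurable]: "Q \<in> sets borel" and v: "emeasure lborel Q = ennreal v" "0 < v"
    and c: "0 < c" and dg: "0 < dg" and dh: "0 < dh"
    and norm: "orlicz_norm \<Psi> Q (\<lambda>x. orlicz_norm \<Phi> Q (\<lambda>y. ennreal (K x y))) < ennreal c"
    and IG: "(\<integral>\<^sup>+ y\<in>Q. ennreal (young_associate \<Phi> (g y / dg)) \<partial>lborel) \<le> ennreal v"
    and IH: "(\<integral>\<^sup>+ x\<in>Q. ennreal (young_associate \<Psi> (h x / dh)) \<partial>lborel) \<le> ennreal v"
  shows "(\<integral>\<^sup>+ x\<in>Q. (\<integral>\<^sup>+ y\<in>Q. ennreal (h x * K x y * g y) \<partial>lborel) \<partial>lborel) \<le> ennreal (4 * c * dg * dh * v\<^sup>2)"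
proof -
  define k where "k x = orlicz_norm \<Phi> Q (\<lambda>y. ennreal (K x y))" for x
  define I where "I x = (\<integral>\<^sup>+ y\<in>Q. ennreal (K x y) * ennreal (g y) \<partial>lborel)" for x
  \<comment> \<open>Normalizes the inner integral: for every admissible \<open>b\<close> the inner
    Hoelder inequality reads \<open>I x \<le> b * e\<close>.\<close>
  define e where "e = 2 * dg * v"
  have e: "0 < e" using dg v by (simp add: e_def)
  have eL: "emeasure lebesgue Q = ennreal v" using v(1) Q by simp
  have [measurable]: "I \<in> borel_measurable borel"
    unfolding I_def[abs_def] by measurable
  have Ik: "I x / ennreal e \<le> k x" for x
  proof -
    have "I x / ennreal e \<le> ennreal b" if b: "0 < b"
      "(1 / emeasure lebesgue Q) * (\<integral>\<^sup>+ y\<in>Q. young_ennreal \<Phi> (ennreal (K x y) / ennreal b) \<partial>lebesgue) \<le> 1" for b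
    proof -
      have "(\<integral>\<^sup>+ y\<in>Q. young_ennreal \<Phi> (ennreal (K x y) / ennreal b) \<partial>lborel) \<le> ennreal v"
        using b(2) unfolding eL nn_integral_lebesgue_eq ennreal_average_le_1_iff[OF v(2)] .
      then have "I x \<le> ennreal (2 * b * dg) * emeasure lborel Q"
        unfolding I_def using IG g0 b(1) dg v(1) by (intro orlicz_holder[OF YF]) simp_all
      also have "\<dots> = ennreal b * ennreal e"
        using b(1) dg v by (simp add: e_def ennreal_mult[symmetric] mult_ac)
      finally have "I x / ennreal e \<le> ennreal b * ennreal e / ennreal e"
        by (rule divide_right_mono_ennreal)
      also have "\<dots> = ennreal b"
        using e b(1) by (simp add: ennreal_mult[symmetric] divide_ennreal)
      finally show ?thesis .
    qed
    then show ?thesis unfolding k_def orlicz_norm_def by (intro Inf_greatest) auto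
  qed
  \<comment> \<open>The strict norm bound yields an admissible \<open>b\<close> below
    \<open>c\<close>; monotonicity of \<open>young_ennreal\<close> carries its modular bound from
    the inner norm over to the measurable function \<open>I x / e\<close>.\<close>
  obtain b where b: "0 < b" "b < c"
    "(1 / emeasure lebesgue Q) * (\<integral>\<^sup>+ x\<in>Q. young_ennreal \<Psi> (k x / ennreal b) \<partial>lebesgue) \<le> 1"
    using norm unfolding k_def[symmetric] orlicz_norm_def[of \<Psi>] Inf_less_iff
    by (auto simp: ennreal_less_iff)
  have Ib: "(\<integral>\<^sup>+ x\<in>Q. young_ennreal \<Psi> ((I x / ennreal e) / ennreal b) \<partial>lborel) \<le> emeasure lborel Q"
  proof -
    have "(\<integral>\<^sup>+ x\<in>Q. young_ennreal \<Psi> ((I x / ennreal e) / ennreal b) \<partial>lborel)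
        \<le> (\<integral>\<^sup>+ x\<in>Q. young_ennreal \<Psi> (k x / ennreal b) \<partial>lborel)"
      by (intro nn_integral_mono mult_right_mono young_ennreal_mono[OF YP] divide_right_mono_ennreal Ik) simp
    also have "\<dots> \<le> ennreal v"
      using b(3) unfolding eL nn_integral_lebesgue_eq ennreal_average_le_1_iff[OF v(2)] .
    finally show ?thesis using v(1) by simp
  qed
  have "(\<integral>\<^sup>+ x\<in>Q. (I x / ennreal e) * ennreal (h x) \<partial>lborel) \<le> ennreal (2 * b * dh) * emeasure lborel Q"
    by (rule orlicz_holder[OF YP _ h h0 Q b(1) dh Ib]) (use IH v(1) in simp_all)
  also have "\<dots> \<le> ennreal (2 * c * dh * v)"
    using v b c dh by (simp add: ennreal_mult[symmetric] ennreal_leI mult_right_mono)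
  finally have le: "(\<integral>\<^sup>+ x\<in>Q. (I x / ennreal e) * ennreal (h x) \<partial>lborel) \<le> ennreal (2 * c * dh * v)" .
  have "(\<integral>\<^sup>+ x\<in>Q. (\<integral>\<^sup>+ y\<in>Q. ennreal (h x * K x y * g y) \<partial>lborel) \<partial>lborel)
      = (\<integral>\<^sup>+ x. ennreal e * ((I x / ennreal e) * ennreal (h x) * indicator Q x) \<partial>lborel)"
  proof (rule nn_integral_cong)
    fix x
    have "(\<integral>\<^sup>+ y\<in>Q. ennreal (h x * K x y * g y) \<partial>lborel) =
        (\<integral>\<^sup>+ y. ennreal (h x) * (ennreal (K x y) * ennreal (g y) * indicator Q y) \<partial>lborel)"
      using K0 g0 h0 by (intro nn_integral_cong) (simp add: ennreal_mult mult.assoc)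
    also have "\<dots> = ennreal (h x) * I x"
      unfolding I_def by (rule nn_integral_cmult) measurable
    also have "I x = ennreal e * (I x / ennreal e)"
      using e by (cases "I x") (auto simp: divide_ennreal ennreal_mult[symmetric] ennreal_top_divide ennreal_mult_top)
    finally show "(\<integral>\<^sup>+ y\<in>Q. ennreal (h x * K x y * g y) \<partial>lborel) * indicator Q x =
        ennreal e * ((I x / ennreal e) * ennreal (h x) * indicator Q x)"
      by (simp add: mult_ac)
  qed
  also have "\<dots> = ennreal e * (\<integral>\<^sup>+ x\<in>Q. (I x / ennreal e) * ennreal (h x) \<partial>lborel)"
    by (rule nn_integral_cmult) measurable
  also have "\<dots> \<le> ennreal e * ennreal (2 * c * dh * v)" by (intro mult_left_mono le) simp
  also have "\<dots> = ennreal (4 * c * dg * dh * v\<^sup>2)"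
    using e c dh v by (simp add: ennreal_mult[symmetric] e_def power2_eq_square mult_ac)
  finally show ?thesis .
qed

text \<open>Lets bounds known for all \<open>s\<close> above an infimum pass to the infimum itself;
  \<open>b = 0\<close> is separate because the argument divides by \<open>b\<close>.\<close>

lemma ennreal_le_mult_limit:
  assumes "0 \<le> b" "0 \<le> a" and le: "\<And>s. a < s \<Longrightarrow> X \<le> ennreal (b * s)"
  shows "X \<le> ennreal (b * a)"
proof (cases X)
  case (real x)
  have "x \<le> b * s" if "a < s" for s
    using le[OF that] real assms that by (simp add: ennreal_le_iff)
  then have "x \<le> b * a"
  proof (cases "b = 0")
    case False
    then have b: "0 < b" using assms by simp
    show ?thesis
    proof (rule ccontr)
      assume "\<not> x \<le> b * a"
      then have "a < (a + x / b) / 2" "b * ((a + x / b) / 2) < x"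
        using b by (auto simp: field_simps)
      then show False using \<open>\<And>s. a < s \<Longrightarrow> x \<le> b * s\<close> by fastforce
    qed
  qed (use \<open>\<And>s. a < s \<Longrightarrow> x \<le> b * s\<close>[of "a + 1"] in simp)
  then show ?thesis using real by (simp add: ennreal_leI)
next
  case top
  then show ?thesis using le[of "a + 1"] by (simp add: top_unique)
qed

text \<open>Boxes of offsets between cell indices: from -1 to 1 for neighbours, from -1 to 2 for
  cells meeting a closed tripled cube, and from -2 to 2 as a symmetric box around the
  latter.\<close>

definition index_box :: "int \<Rightarrow> int \<Rightarrow> (int^'d) set" where
  "index_box a b = {e. \<forall>i. e $ i \<in> {a..b}}"

lemma finite_index_box [simp]: "finite (index_box a b)"
  unfolding index_box_def by (rule finite_vec_set) simp

lemma zero_in_index_box: "a \<le> 0 \<Longrightarrow> 0 \<le> b \<Longrightarrow> 0 \<in> index_box a b"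
  by (simp add: index_box_def)

lemma card_index_box_ge_1: "a \<le> 0 \<Longrightarrow> 0 \<le> b \<Longrightarrow> 1 \<le> card (index_box a b :: (int^'d) set)"
  using zero_in_index_box[of a b] by (metis One_nat_def Suc_leI card_gt_0_iff empty_iff finite_index_box)

text \<open>Rounding down is monotone and turns an added \<open>e * k\<close> into an added
  \<open>e\<close>, and \<open>e \<le> e * k\<close>. Hence close indices stay as close when one
  passes to ancestors.\<close>

lemma div_diff_le:
  fixes a b e k :: int
  assumes "0 \<le> e" "0 < k" "\<bar>a - b\<bar> \<le> e"
  shows "\<bar>a div k - b div k\<bar> \<le> e"
proof -
  have *: "x div k \<le> y div k + e" if "x \<le> y + e" for x y
  proof -
    have "x div k \<le> (y + e * k) div k"
      using that assms mult_left_mono[of 1 k e] by (intro zdiv_mono1) auto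
    then show ?thesis using assms by simp
  qed
  show ?thesis using *[of a b] *[of b a] assms by linarith
qed

lemma halve_funpow_diff_le:
  fixes m m' :: "int^'d"
  assumes "0 \<le> e" "\<bar>m $ i - m' $ i\<bar> \<le> e"
  shows "\<bar>(halve ^^ k) m $ i - (halve ^^ k) m' $ i\<bar> \<le> e"
  using div_diff_le[OF assms(1) _ assms(2), of "2 ^ k"] by (simp add: halve_funpow)

context dyadic_grid
begin

text \<open>The level-\<open>i\<close> ancestors of \<open>m\<close> and \<open>m + e\<close> differ
  by at most 2 in each coordinate, so the translated cells below \<open>k\<close> come from cells of
  \<open>S\<close> below one of the finitely many \<open>k + a\<close>.\<close>

lemma packing_shift:
  fixes S :: "(nat \<times> (int^'d)) set"
  assumes S: "finite S" and e: "e \<in> index_box (-2) 2"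
    and pk: "\<And>i k. (\<Sum>(j, m)\<in>{(j, m)\<in>S. i \<le> j \<and> (halve ^^ (j - i)) m = k}. vol TYPE('d) j) \<le> 2 * vol TYPE('d) i"
  shows "(\<Sum>(j, m)\<in>{(j, m)\<in>(\<lambda>T. (fst T, snd T + e)) ` S. i \<le> j \<and> (halve ^^ (j - i)) m = k}. vol TYPE('d) j)
    \<le> 2 * card (index_box (-2) 2 :: (int^'d) set) * vol TYPE('d) i"
proof -
  define D where "D k' = {T\<in>S. i \<le> fst T \<and> (halve ^^ (fst T - i)) (snd T) = k'}" for k'
  define E where "E = {T\<in>S. i \<le> fst T \<and> (halve ^^ (fst T - i)) (snd T + e) = k}"
  have fD: "finite (D k')" for k' using S by (simp add: D_def)
  have eq: "{(j, m)\<in>(\<lambda>T. (fst T, snd T + e)) ` S. i \<le> j \<and> (halve ^^ (j - i)) m = k} = (\<lambda>T. (fst T, snd T + e)) ` E"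
    by (auto simp: E_def)
  have "(\<Sum>(j, m)\<in>(\<lambda>T. (fst T, snd T + e)) ` E. vol TYPE('d) j) = (\<Sum>T\<in>E. vol TYPE('d) (fst T))"
    by (subst sum.reindex) (auto simp: inj_on_def prod_eq_iff)
  also have "\<dots> \<le> (\<Sum>T\<in>(\<Union>a\<in>index_box (-2) 2. D (k + a)). vol TYPE('d) (fst T))"
  proof (rule sum_mono2)
    show "finite (\<Union>a\<in>index_box (-2) 2. D (k + a))" using fD by simp
    show "E \<subseteq> (\<Union>a\<in>index_box (-2) 2. D (k + a))"
    proof
      fix T assume T: "T \<in> E"
      define a where "a = (halve ^^ (fst T - i)) (snd T) - k"
      have "\<bar>a $ l\<bar> \<le> 2" for l
      proof -
        have "\<bar>snd T $ l - (snd T + e) $ l\<bar> \<le> 2" using e by (simp add: index_box_def abs_le_iff minus_le_iff)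
        from halve_funpow_diff_le[OF _ this, of "fst T - i"] T
        show ?thesis by (simp add: a_def E_def)
      qed
      then have "a \<in> index_box (-2) 2" by (simp add: index_box_def abs_le_iff minus_le_iff)
      moreover have "T \<in> D (k + a)" using T by (simp add: D_def E_def a_def)
      ultimately show "T \<in> (\<Union>a\<in>index_box (-2) 2. D (k + a))" by blast
    qed
  qed (simp add: vol_pos less_imp_le)
  also have "\<dots> \<le> (\<Sum>a\<in>index_box (-2) 2. \<Sum>T\<in>D (k + a). vol TYPE('d) (fst T))"
    using fD by (intro sum_UN_le) (simp_all add: vol_pos less_imp_le)
  also have "\<dots> \<le> (\<Sum>a\<in>(index_box (-2) 2 :: (int^'d) set). 2 * vol TYPE('d) i)"
  proof (rule sum_mono)
    fix a
    have "D (k + a) = {(j, m)\<in>S. i \<le> j \<and> (halve ^^ (j - i)) m = k + a}" by (auto simp: D_def)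
    then show "(\<Sum>T\<in>D (k + a). vol TYPE('d) (fst T)) \<le> 2 * vol TYPE('d) i"
      using pk[of i "k + a"] by (simp add: case_prod_unfold)
  qed
  finally show ?thesis unfolding eq by (simp add: mult_ac)
qed

definition nbhd :: "nat \<Rightarrow> int^'d \<Rightarrow> (real^'d) set" where
  "nbhd j m = {y. cidx j y - m \<in> index_box (-1) 1}"

text \<open>A closed cube, as membership in \<open>cubes\<close> demands, whereas
  \<open>nbhd\<close> is the half-open version made of cells. Its upper faces touch one further
  layer of cells, whence the offset 2 in \<open>dilate_subset_cells\<close>.\<close>

definition dilate :: "nat \<Rightarrow> int^'d \<Rightarrow> (real^'d) set" where
  "dilate j m = cbox (\<chi> i. (of_int (m $ i) - 1) * side j) ((\<chi> i. (of_int (m $ i) - 1) * side j) + (\<chi> i. 3 * side j))"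

lemma dilate_in_cubes: "dilate j m \<in> cubes"
  unfolding cubes_def dilate_def using side_pos[of j]
  by (intro CollectI exI[of _ "\<chi> i. (of_int (m $ i) - 1) * side j"] exI[of _ "3 * side j"]) simp

lemma dilate_borel [measurable]: "dilate j m \<in> sets borel"
  by (simp add: dilate_def)

lemma emeasure_dilate: "emeasure lborel (dilate j (m :: int^'d)) = ennreal (3 ^ CARD('d) * vol TYPE('d) j)"
proof -
  define a :: "real^'d" where "a = (\<chi> i. (of_int (m $ i) - 1) * side j)"
  define w :: "real^'d" where "w = (\<chi> i. 3 * side j)"
  have w: "w \<bullet> i = 3 * side j" if "i \<in> Basis" for i
    using that by (auto simp: w_def Basis_vec_def inner_axis)
  have "emeasure lborel (cbox a (a + w)) = ennreal (\<Prod>i\<in>Basis. (a + w - a) \<bullet> i)"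
    using w side_pos[of j] by (subst emeasure_lborel_cbox_eq) (auto simp: inner_add_left)
  also have "(\<Prod>i\<in>Basis. (a + w - a) \<bullet> i) = 3 ^ CARD('d) * vol TYPE('d) j"
    using w by (simp add: vol_def power_mult_distrib)
  finally show ?thesis by (simp add: dilate_def a_def w_def)
qed

lemma cell_subset_nbhd: "cell j m \<subseteq> nbhd j m"
  by (auto simp: cell_def nbhd_def index_box_def)

lemma nbhd_subset_dilate: "nbhd j m \<subseteq> dilate j m"
proof
  fix y assume y: "y \<in> nbhd j m"
  have "(of_int (m $ i) - 1) * side j \<le> y $ i \<and> y $ i \<le> (of_int (m $ i) - 1) * side j + 3 * side j" for i
  proof -
    have "- 1 \<le> cidx j y $ i - m $ i" "cidx j y $ i - m $ i \<le> 1"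
      using y by (auto simp: nbhd_def index_box_def)
    then have 1: "of_int (m $ i) - 1 \<le> (of_int (cidx j y $ i) :: real)" "of_int (cidx j y $ i) \<le> (of_int (m $ i) + 1 :: real)"
      by linarith+
    have "y \<in> cell j (cidx j y)" by (simp add: cell_def)
    then have 2: "of_int (cidx j y $ i) * side j \<le> y $ i" "y $ i < (of_int (cidx j y $ i) + 1) * side j"
      by (auto simp: mem_cell_iff)
    have 3: "(of_int (m $ i) - 1) * side j \<le> of_int (cidx j y $ i) * side j"
      "(of_int (cidx j y $ i) + 1) * side j \<le> (of_int (m $ i) + 2) * side j"
      using 1 side_pos[of j] by (intro mult_right_mono; simp)+
    show ?thesis using 2 3 by (simp add: algebra_simps)
  qed
  then show "y \<in> dilate j m" by (simp add: dilate_def mem_box_cart)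
qed

lemma dilate_subset_cells: "dilate j m \<subseteq> (\<Union>e\<in>index_box (-1) 2. cell j (m + e))"
proof
  fix y assume y: "y \<in> dilate j m"
  have "-1 \<le> (cidx j y - m) $ i \<and> (cidx j y - m) $ i \<le> 2" for i
  proof -
    have "(of_int (m $ i) - 1) * side j \<le> y $ i" "y $ i \<le> (of_int (m $ i) - 1) * side j + 3 * side j"
      using y by (auto simp: dilate_def mem_box_cart)
    then have "of_int (m $ i - 1) * side j \<le> y $ i" "y $ i \<le> of_int (m $ i + 2) * side j"
      by (simp_all add: algebra_simps)
    then have "of_int (m $ i - 1) \<le> y $ i / side j" "y $ i / side j \<le> of_int (m $ i + 2)"
      by (simp_all only: pos_le_divide_eq[OF side_pos] pos_divide_le_eq[OF side_pos])
    then have "m $ i - 1 \<le> \<lfloor>y $ i / side j\<rfloor>" "\<lfloor>y $ i / side j\<rfloor> \<le> m $ i + 2"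
      by (simp_all add: le_floor_iff floor_le_iff)
    then show ?thesis by (simp add: cidx_def)
  qed
  then have "cidx j y - m \<in> index_box (-1) 2" by (simp add: index_box_def)
  moreover have "y \<in> cell j (m + (cidx j y - m))" by (simp add: cell_def)
  ultimately show "y \<in> (\<Union>e\<in>index_box (-1) 2. cell j (m + e))" by blast
qed

lemma nbhd_borel [measurable]: "nbhd j m \<in> sets borel"
proof -
  have "nbhd j m = (\<Union>e\<in>index_box (-1) 1. cell j (m + e))"
    by (auto simp: nbhd_def cell_def)
  then show ?thesis by (simp only:) (intro sets.finite_UN finite_index_box cell_borel)
qed

text \<open>The tripled cube is covered by the cells of offsets -1 to 2. Dividing the argument by
  their number reduces the associate at least by that factor, which compensates for adding up the
  modulars, each at most the volume of a cell.\<close>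

lemma dilate_associate_bound:
  fixes g :: "real^'d \<Rightarrow> real"
  assumes Y: "young_function \<Phi>" and g [measurable]: "g \<in> borel_measurable borel" and g0: "\<And>x. 0 \<le> g x"
    and gR: "\<And>x. g x \<le> R" and s: "0 \<le> l"
    "\<And>e. e \<in> index_box (-1) 2 \<Longrightarrow> luxemburg (young_associate \<Phi>) (cell j (m + e)) g \<le> l" "l < s"
  shows "(\<integral>\<^sup>+ y\<in>dilate j m. ennreal (young_associate \<Phi> (g y / (real (card (index_box (-1) 2 :: (int^'d) set)) * s))) \<partial>lborel)
    \<le> ennreal (3 ^ CARD('d) * vol TYPE('d) j)"
proof -
  define A where "A = young_associate \<Phi>"
  define N where "N = real (card (index_box (-1) 2 :: (int^'d) set))"
  have N: "1 \<le> N" using card_index_box_ge_1[of "-1" 2] by (simp add: N_def)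
  have A0: "0 \<le> A t" for t by (simp add: A_def young_associate_nonneg[OF Y])
  have [measurable]: "A \<in> borel_measurable borel"
    unfolding A_def by (rule borel_measurable_young_associate[OF Y])
  have cell_le: "(\<integral>\<^sup>+ y\<in>cell j (m + e). ennreal (A (g y / s)) \<partial>lborel) \<le> ennreal (vol TYPE('d) j)"
    if "e \<in> index_box (-1) 2" for e
    using luxemburg_less_imp[of A g "cell j (m + e)" s] s(2)[OF that] s(3) g0
      luxemburg_exists[OF Y g0 gR cell_borel[of j "m + e"]] young_associate_mono[OF Y]
    by (simp add: A_def emeasure_cell)
  have "(\<integral>\<^sup>+ y\<in>dilate j m. ennreal (A (g y / (N * s))) \<partial>lborel)
      \<le> (\<integral>\<^sup>+ y. (\<Sum>e\<in>index_box (-1) 2. ennreal (1 / N) * (ennreal (A (g y / s)) * indicator (cell j (m + e)) y)) \<partial>lborel)"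
  proof (rule nn_integral_mono)
    fix y
    show "ennreal (A (g y / (N * s))) * indicator (dilate j m) y \<le>
        (\<Sum>e\<in>index_box (-1) 2. ennreal (1 / N) * (ennreal (A (g y / s)) * indicator (cell j (m + e)) y))"
    proof (cases "y \<in> dilate j m")
      case True
      then obtain e where e: "e \<in> index_box (-1) 2" "y \<in> cell j (m + e)"
        using dilate_subset_cells by blast
      have "A ((1 / N) * (g y / s)) \<le> (1 / N) * A (g y / s)"
        unfolding A_def using N by (intro young_associate_scale[OF Y]) auto
      then have "ennreal (A (g y / (N * s))) \<le> ennreal ((1 / N) * A (g y / s))" by (simp add: ennreal_leI)
      also have "\<dots> = ennreal (1 / N) * (ennreal (A (g y / s)) * indicator (cell j (m + e)) y)"
        using N A0 e(2) by (simp add: ennreal_mult[symmetric])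
      also have "\<dots> \<le> (\<Sum>e\<in>index_box (-1) 2. ennreal (1 / N) * (ennreal (A (g y / s)) * indicator (cell j (m + e)) y))"
        using e(1) by (intro member_le_sum) auto
      finally show ?thesis using True by simp
    qed simp
  qed
  also have "\<dots> = (\<Sum>e\<in>index_box (-1) 2. ennreal (1 / N) * (\<integral>\<^sup>+ y\<in>cell j (m + e). ennreal (A (g y / s)) \<partial>lborel))"
  proof -
    have "(\<integral>\<^sup>+ y. (\<Sum>e\<in>index_box (-1) 2. ennreal (1 / N) * (ennreal (A (g y / s)) * indicator (cell j (m + e)) y)) \<partial>lborel)
        = (\<Sum>e\<in>index_box (-1) 2. \<integral>\<^sup>+ y. ennreal (1 / N) * (ennreal (A (g y / s)) * indicator (cell j (m + e)) y) \<partial>lborel)"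
      by (rule nn_integral_sum) measurable
    also have "\<dots> = (\<Sum>e\<in>index_box (-1) 2. ennreal (1 / N) * (\<integral>\<^sup>+ y\<in>cell j (m + e). ennreal (A (g y / s)) \<partial>lborel))"
      by (intro sum.cong refl nn_integral_cmult) measurable
    finally show ?thesis .
  qed
  also have "\<dots> \<le> (\<Sum>e\<in>(index_box (-1) 2 :: (int^'d) set). ennreal (1 / N) * ennreal (vol TYPE('d) j))"
    by (intro sum_mono mult_left_mono cell_le) auto
  also have "\<dots> = ennreal (N * (1 / N * vol TYPE('d) j))"
    using N vol_pos[where 'd='d, of j]
    by (simp add: N_def ennreal_mult[symmetric] ennreal_of_nat_eq_real_of_nat)
  also have "\<dots> \<le> ennreal (3 ^ CARD('d) * vol TYPE('d) j)"
  proof -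
    have "1 * vol TYPE('d) j \<le> 3 ^ CARD('d) * vol TYPE('d) j"
      using vol_pos[where 'd='d, of j] by (intro mult_right_mono) auto
    then show ?thesis using N by (intro ennreal_leI) simp
  qed
  finally show ?thesis by (simp add: A_def N_def)
qed

end

section \<open>The discretized bilinear form\<close>

text \<open>The first group of factors is lost in passing to stopping cells, the second is the
  Hoelder constant on tripled cubes, the third comes from the two Carleson embeddings. Neither the
  grid nor \<open>R\<close> nor the functions occur, which makes the estimate stable under
  limits.\<close>

definition bilinear_const ::
  "'d::finite itself \<Rightarrow> 'v::euclidean_space itself \<Rightarrow> real \<Rightarrow> real \<Rightarrow> real \<Rightarrow> real \<Rightarrow> real \<Rightarrow> real \<Rightarrow> real" where
  "bilinear_const _ _ \<alpha> p q M K1 K2 =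
     2 * real DIM('v) * 3 ^ DIM('v) * real (card (index_box (-1) 1 :: (int^'d) set)) * (1 / (1 - 2 powr (- \<alpha>))) *
     (4 * M * (real (card (index_box (-1) 2 :: (int^'d) set)))\<^sup>2 *
        (3 ^ CARD('d)) powr (2 - (\<alpha> / CARD('d) + 1 / q - 1 / p))) *
     (real (card (index_box (-1) 2 :: (int^'d) set)) * (2 * real (card (index_box (-2) 2 :: (int^'d) set))) *
        (2 powr (q / p) * K1 + 2 * K2))"

text \<open>In the application \<open>N x v\<close> is \<open>h x * norm (A x *v v)\<close> and
  \<open>K x y\<close> is the operator norm of \<open>A x ** B y\<close>. The exponent 1 in
  \<open>tail2\<close> is written as a quotient so that the same embedding applies with both
  exponents equal to \<open>conj_exponent q\<close>.\<close>

locale bilinear_setting = dyadic_grid L for L :: real +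
  fixes \<alpha> p q M c1 K1 c2 K2 R :: real and \<Phi> \<Psi> :: "real \<Rightarrow> real"
    and K :: "real^'d \<Rightarrow> real^'d \<Rightarrow> real" and N :: "real^'d \<Rightarrow> 'v::euclidean_space \<Rightarrow> real"
    and f :: "real^'d \<Rightarrow> 'v" and g h :: "real^'d \<Rightarrow> real"
  assumes alpha: "0 < \<alpha>" and pq: "1 < p" "p \<le> q"
    and YF: "young_function \<Phi>" and YP: "young_function \<Psi>"
    and c1: "0 < c1" "young_associate \<Phi> c1 \<le> 1 / 2" and K1: "0 \<le> K1"
    and tail1: "\<And>u. 0 < u \<Longrightarrow> (\<integral>\<^sup>+ t\<in>{t. 0 < t \<and> c1 < u * t}.
        ennreal (young_associate \<Phi> (u * t) powr (q / p) * t powr (- q - 1)) \<partial>lborel) \<le> ennreal (K1 * u powr q)"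
    and c2: "0 < c2" "young_associate \<Psi> c2 \<le> 1 / 2" and K2: "0 \<le> K2"
    and tail2: "\<And>u. 0 < u \<Longrightarrow> (\<integral>\<^sup>+ t\<in>{t. 0 < t \<and> c2 < u * t}.
        ennreal (young_associate \<Psi> (u * t) powr (conj_exponent q / conj_exponent q) * t powr (- conj_exponent q - 1)) \<partial>lborel)
        \<le> ennreal (K2 * u powr conj_exponent q)"
    and K_meas [measurable]: "(\<lambda>(x, y). K x y) \<in> borel_measurable (borel \<Otimes>\<^sub>M borel)"
    and K_nonneg: "\<And>x y. 0 \<le> K x y"
    and M: "0 < M"
    and bump: "\<And>Q. Q \<in> cubes \<Longrightarrow> ennreal (measure lebesgue Q powr (\<alpha> / CARD('d) + 1 / q - 1 / p)) *
        orlicz_norm \<Psi> Q (\<lambda>x. orlicz_norm \<Phi> Q (\<lambda>y. ennreal (K x y))) < ennreal M"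
    and N_seminorm: "\<And>x. seminorm (N x)"
    and N_meas [measurable]: "\<And>v. (\<lambda>x. N x v) \<in> borel_measurable borel"
    and Nf_meas [measurable]: "(\<lambda>(x, y). N x (f y)) \<in> borel_measurable (borel \<Otimes>\<^sub>M borel)"
    and N_bound: "\<And>x v. N x v \<le> R * norm v" and N_support: "\<And>x v. R < norm x \<Longrightarrow> N x v = 0"
    and N_le: "\<And>x y. N x (f y) \<le> h x * K x y * g y"
    and f_meas [measurable]: "f \<in> borel_measurable borel"
    and g_meas [measurable]: "g \<in> borel_measurable borel" and g: "\<And>x. 0 \<le> g x" "\<And>x. g x \<le> R"
    and h_meas [measurable]: "h \<in> borel_measurable borel" and h: "\<And>x. 0 \<le> h x" "\<And>x. h x \<le> R"
    and g_norm: "(\<integral>\<^sup>+ x. ennreal (g x powr p) \<partial>lborel) \<le> 1"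
    and h_norm: "(\<integral>\<^sup>+ x. ennreal (h x powr conj_exponent q) \<partial>lborel) \<le> 1"
begin

definition nu :: "nat \<Rightarrow> int^'d \<Rightarrow> 'v \<Rightarrow> real" where
  "nu j m v = enn2real (\<integral>\<^sup>+ x\<in>cell j m. ennreal (N x v) \<partial>lborel)"

lemma N_nonneg: "0 \<le> N x v"
  by (rule seminorm_nonneg[OF N_seminorm])

text \<open>\<open>N_bound\<close> on a cell of finite volume makes the integral finite, so
  \<open>enn2real\<close> loses nothing in \<open>nu\<close>.\<close>

lemma ennreal_nu: "ennreal (nu j m v) = (\<integral>\<^sup>+ x\<in>cell j m. ennreal (N x v) \<partial>lborel)"
proof -
  have "(\<integral>\<^sup>+ x\<in>cell j m. ennreal (N x v) \<partial>lborel) \<le> (\<integral>\<^sup>+ x. ennreal (R * norm v) * indicator (cell j m) x \<partial>lborel)"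
    by (intro nn_integral_mono mult_right_mono ennreal_leI N_bound) simp
  also have "\<dots> = ennreal (R * norm v) * ennreal (vol TYPE('d) j)"
    by (simp add: nn_integral_cmult_indicator emeasure_cell)
  also have "\<dots> < \<infinity>" by (simp add: ennreal_mult_less_top)
  finally show ?thesis by (simp add: nu_def)
qed

lemma nu_nonneg: "0 \<le> nu j m v"
  by (simp add: nu_def)

lemma seminorm_nu': "seminorm (nu j m)"
  unfolding seminorm_def
proof (intro conjI allI)
  fix u v and c :: real
  have "ennreal (nu j m (u + v)) \<le> (\<integral>\<^sup>+ x. ennreal (N x u) * indicator (cell j m) x + ennreal (N x v) * indicator (cell j m) x \<partial>lborel)"
    unfolding ennreal_nu
  proof (rule nn_integral_mono)
    fix x
    have "ennreal (N x (u + v)) \<le> ennreal (N x u) + ennreal (N x v)"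
      using seminorm_add[OF N_seminorm, of x u v] N_nonneg
      by (simp add: ennreal_plus[symmetric] ennreal_leI del: ennreal_plus)
    then show "ennreal (N x (u + v)) * indicator (cell j m) x \<le>
        ennreal (N x u) * indicator (cell j m) x + ennreal (N x v) * indicator (cell j m) x"
      by (cases "x \<in> cell j m") simp_all
  qed
  also have "\<dots> = ennreal (nu j m u) + ennreal (nu j m v)"
    unfolding ennreal_nu by (rule nn_integral_add) measurable
  also have "\<dots> = ennreal (nu j m u + nu j m v)" by (simp add: nu_nonneg)
  finally show "nu j m (u + v) \<le> nu j m u + nu j m v" by (subst (asm) ennreal_le_iff) (simp_all add: nu_nonneg)
  have "ennreal (nu j m (c *\<^sub>R v)) = (\<integral>\<^sup>+ x. ennreal \<bar>c\<bar> * (ennreal (N x v) * indicator (cell j m) x) \<partial>lborel)"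
    unfolding ennreal_nu
    by (intro nn_integral_cong) (simp add: seminorm_scaleR[OF N_seminorm] ennreal_mult N_nonneg mult.assoc)
  also have "\<dots> = ennreal \<bar>c\<bar> * ennreal (nu j m v)"
    unfolding ennreal_nu by (rule nn_integral_cmult) measurable
  also have "\<dots> = ennreal (\<bar>c\<bar> * nu j m v)" by (simp add: ennreal_mult nu_nonneg)
  finally show "nu j m (c *\<^sub>R v) = \<bar>c\<bar> * nu j m v" by (simp add: nu_nonneg)
qed

lemma nu_children': "nu j m v = (\<Sum>c\<in>{c. halve c = m}. nu (Suc j) c v)"
proof -
  have "ennreal (nu j m v) = (\<Sum>c\<in>{c. halve c = m}. ennreal (nu (Suc j) c v))"
    unfolding ennreal_nu by (rule nn_integral_cell_children) measurable
  also have "\<dots> = ennreal (\<Sum>c\<in>{c. halve c = m}. nu (Suc j) c v)" by (simp add: nu_nonneg)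
  finally show ?thesis by (simp add: nu_nonneg sum_nonneg)
qed

sublocale stopping_forest halve "vol TYPE('d)" nu
  by (rule stopping_forest.intro)
    (rule vol_pos finite_halve_fiber vol_children seminorm_nu' nu_children')+

text \<open>Contains the index of every cell of level \<open>j\<close> that meets the ball of radius
  \<open>R\<close>, outside of which \<open>N\<close> vanishes; this keeps all sums over cells
  finite.\<close>

definition top_box :: "nat \<Rightarrow> (int^'d) set" where
  "top_box j = index_box \<lfloor>- R / side j\<rfloor> \<lfloor>R / side j\<rfloor>"

lemma cidx_in_top_box:
  assumes "norm x \<le> R"
  shows "cidx j x \<in> top_box j"
proof -
  have "- R \<le> x $ i \<and> x $ i \<le> R" for i
    using component_le_norm_cart[of x i] assms by linarith
  then have "- R / side j \<le> x $ i / side j \<and> x $ i / side j \<le> R / side j" for i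
    using divide_right_mono[of "- R" "x $ i" "side j"] divide_right_mono[of "x $ i" R "side j"] side_pos[of j]
    by (simp del: divide_minus_left)
  then show ?thesis by (auto simp: top_box_def index_box_def cidx_def intro!: floor_mono)
qed

section \<open>From the discretized kernel to stopping cells\<close>

lemma nu_f_meas [measurable]: "(\<lambda>y. ennreal (nu j m (f y))) \<in> borel_measurable borel"
  unfolding ennreal_nu by measurable

lemma nu_nbhd_eq:
  "(\<integral>\<^sup>+ y\<in>nbhd j m. ennreal (nu j m (f y)) \<partial>lborel) =
   (\<integral>\<^sup>+ x. (\<integral>\<^sup>+ y. ennreal (N x (f y)) * indicator (cell j m) x * indicator (nbhd j m) y \<partial>lborel) \<partial>lborel)"
proof -
  have "(\<integral>\<^sup>+ y\<in>nbhd j m. ennreal (nu j m (f y)) \<partial>lborel) =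
      (\<integral>\<^sup>+ y. (\<integral>\<^sup>+ x. ennreal (N x (f y)) * indicator (cell j m) x * indicator (nbhd j m) y \<partial>lborel) \<partial>lborel)"
    unfolding ennreal_nu by (intro nn_integral_cong nn_integral_multc[symmetric]) measurable
  also have "\<dots> = (\<integral>\<^sup>+ x. (\<integral>\<^sup>+ y. ennreal (N x (f y)) * indicator (cell j m) x * indicator (nbhd j m) y \<partial>lborel) \<partial>lborel)"
    by (rule lborel_pair.Fubini') measurable
  finally show ?thesis .
qed

text \<open>For given \<open>x\<close> only its own cell of level \<open>j\<close> matters, and
  unless \<open>N x\<close> vanishes that cell belongs to \<open>top_box j\<close>. Fubini then
  integrates over \<open>x\<close> first and produces \<open>nu\<close> at
  \<open>f y\<close>.\<close>

lemma discretized_le_cells: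
  "(\<integral>\<^sup>+ x. (\<integral>\<^sup>+ y. ennreal (N x (f y)) * (\<Sum>j\<le>J. ennreal (side j powr (\<alpha> - CARD('d))) * indicator (nbhd j (cidx j x)) y) \<partial>lborel) \<partial>lborel)
   \<le> (\<Sum>T\<in>(SIGMA j:{..J}. top_box j). ennreal (side (fst T) powr (\<alpha> - CARD('d))) *
        (\<integral>\<^sup>+ y\<in>nbhd (fst T) (snd T). ennreal (nu (fst T) (snd T) (f y)) \<partial>lborel))"
proof -
  define s where "s T = ennreal (side (fst T) powr (\<alpha> - CARD('d)))" for T :: "nat \<times> (int^'d)"
  define F where "F T x y = ennreal (N x (f y)) * indicator (cell (fst T) (snd T)) x * indicator (nbhd (fst T) (snd T)) y"
    for T x y
  define TT where "TT = (SIGMA j:{..J}. top_box j)"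
  have fTT: "finite TT" unfolding TT_def by (intro finite_SigmaI) (auto simp: top_box_def)
  have Fm [measurable]: "(\<lambda>(x, y). F T x y) \<in> borel_measurable (borel \<Otimes>\<^sub>M borel)" for T
    unfolding F_def by measurable
  have Fm2 [measurable]: "F T x \<in> borel_measurable borel" for T x
    using measurable_compose[OF measurable_Pair1' Fm[of T], of x] by simp
  have "(\<integral>\<^sup>+ x. (\<integral>\<^sup>+ y. ennreal (N x (f y)) * (\<Sum>j\<le>J. ennreal (side j powr (\<alpha> - CARD('d))) * indicator (nbhd j (cidx j x)) y) \<partial>lborel) \<partial>lborel)
      \<le> (\<integral>\<^sup>+ x. (\<integral>\<^sup>+ y. (\<Sum>T\<in>TT. s T * F T x y) \<partial>lborel) \<partial>lborel)"
  proof (intro nn_integral_mono)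
    fix x y
    show "ennreal (N x (f y)) * (\<Sum>j\<le>J. ennreal (side j powr (\<alpha> - CARD('d))) * indicator (nbhd j (cidx j x)) y)
        \<le> (\<Sum>T\<in>TT. s T * F T x y)"
    proof (cases "norm x \<le> R")
      case True
      have "ennreal (N x (f y)) * (\<Sum>j\<le>J. ennreal (side j powr (\<alpha> - CARD('d))) * indicator (nbhd j (cidx j x)) y)
          = (\<Sum>j\<le>J. s (j, cidx j x) * F (j, cidx j x) x y)"
        unfolding sum_distrib_left by (intro sum.cong refl) (simp add: s_def F_def cell_def mult_ac)
      also have "\<dots> = (\<Sum>T\<in>(\<lambda>j. (j, cidx j x)) ` {..J}. s T * F T x y)"
        by (subst sum.reindex) (auto simp: inj_on_def)
      also have "\<dots> \<le> (\<Sum>T\<in>TT. s T * F T x y)"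
        using fTT cidx_in_top_box[OF True] by (intro sum_mono2) (auto simp: TT_def)
      finally show ?thesis .
    qed (simp add: N_support)
  qed
  also have "\<dots> = (\<integral>\<^sup>+ x. (\<Sum>T\<in>TT. s T * (\<integral>\<^sup>+ y. F T x y \<partial>lborel)) \<partial>lborel)"
    by (subst nn_integral_sum, measurable, subst nn_integral_cmult, measurable)
  also have "\<dots> = (\<Sum>T\<in>TT. s T * (\<integral>\<^sup>+ x. (\<integral>\<^sup>+ y. F T x y \<partial>lborel) \<partial>lborel))"
    by (subst nn_integral_sum, measurable, subst nn_integral_cmult, measurable)
  also have "\<dots> = (\<Sum>T\<in>TT. s T * (\<integral>\<^sup>+ y\<in>nbhd (fst T) (snd T). ennreal (nu (fst T) (snd T) (f y)) \<partial>lborel))"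
    by (simp only: nu_nbhd_eq F_def)
  finally show ?thesis by (simp only: s_def TT_def)
qed

lemma geometric_side_sum:
  "(\<Sum>j\<in>{i..J}. side j powr \<alpha>) \<le> 1 / (1 - 2 powr (- \<alpha>)) * side i powr \<alpha>"
proof -
  define r :: real where "r = 2 powr (- \<alpha>)"
  have r: "0 < r" "r < 1" using alpha by (auto simp: r_def powr_less_one)
  have e: "side (i + k) powr \<alpha> = side i powr \<alpha> * r ^ k" for k
    using side_pos[of i]
    by (simp add: side_add powr_divide r_def powr_powr powr_realpow[symmetric] powr_minus divide_simps mult.commute)
  have "{i..J} \<subseteq> (\<lambda>k. i + k) ` {..J}"
  proof
    fix j assume "j \<in> {i..J}"
    then have "j = i + (j - i)" "j - i \<in> {..J}" by auto
    then show "j \<in> (\<lambda>k. i + k) ` {..J}" by (rule image_eqI)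
  qed
  then have "(\<Sum>j\<in>{i..J}. side j powr \<alpha>) \<le> (\<Sum>j\<in>(\<lambda>k. i + k) ` {..J}. side j powr \<alpha>)"
    by (intro sum_mono2) auto
  also have "\<dots> = (\<Sum>k\<le>J. side i powr \<alpha> * r ^ k)"
    by (subst sum.reindex) (auto simp: e)
  also have "\<dots> = side i powr \<alpha> * (\<Sum>k\<le>J. r ^ k)" by (simp add: sum_distrib_left)
  also have "\<dots> \<le> side i powr \<alpha> * (1 / (1 - r))"
    using r sum_le_suminf[of "\<lambda>k. r ^ k" "{..J}"]
    by (intro mult_left_mono) (simp_all add: suminf_geometric summable_geometric)
  finally show ?thesis by (simp add: r_def mult.commute)
qed

text \<open>Neighbourhoods are nested along ancestors, so only points \<open>y\<close> of
  \<open>nbhd i k\<close> count. Such a point lies in a bounded number of neighbourhoods per level,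
  and the weights \<open>side j powr \<alpha>\<close> form a geometric series from level
  \<open>i\<close> on.\<close>

lemma principal_overlap:
  assumes S: "S \<subseteq> {(j, m). j \<le> J \<and> principal j m = (i, k)}" "finite S"
  shows "(\<Sum>T\<in>S. ennreal (side (fst T) powr \<alpha>) * indicator (nbhd (fst T) (snd T)) y)
    \<le> ennreal (card (index_box (-1) 1 :: (int^'d) set) * (1 / (1 - 2 powr (- \<alpha>))) * side i powr \<alpha>) * indicator (nbhd i k) y"
proof (cases "y \<in> nbhd i k")
  case False
  have "y \<notin> nbhd (fst T) (snd T)" if T: "T \<in> S" for T
  proof
    assume y: "y \<in> nbhd (fst T) (snd T)"
    obtain j m where jm: "T = (j, m)" "principal j m = (i, k)" using T S(1) by auto
    have a: "i \<le> j" "(halve ^^ (j - i)) m = k"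
      using principal_ancestor[of j m] jm(2) by auto
    have "\<bar>(halve ^^ (j - i)) (cidx j y) $ l - (halve ^^ (j - i)) m $ l\<bar> \<le> 1" for l
    proof -
      have "-1 \<le> cidx j y $ l - m $ l" "cidx j y $ l - m $ l \<le> 1"
        using y jm(1) by (simp_all add: nbhd_def index_box_def)
      then show ?thesis by (intro halve_funpow_diff_le) linarith+
    qed
    moreover have "(halve ^^ (j - i)) (cidx j y) = cidx i y" using cidx_ancestor[of "j - i" i y] a(1) by simp
    ultimately have "\<bar>cidx i y $ l - k $ l\<bar> \<le> 1" for l using a(2) by metis
    then have "y \<in> nbhd i k"
      by (simp add: nbhd_def index_box_def abs_le_iff) (smt (verit, best))
    with False show False by simp
  qed
  then show ?thesis by simp
next
  case True
  define c where "c = real (card (index_box (-1) 1 :: (int^'d) set))"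
  define B where "B j = {m :: int^'d. cidx j y - m \<in> index_box (-1) 1}" for j
  have B: "finite (B j)" "card (B j) = card (index_box (-1) 1 :: (int^'d) set)" for j
  proof -
    have "B j = (\<lambda>e. cidx j y - e) ` index_box (-1) 1"
      by (auto simp: B_def image_iff) (metis diff_diff_eq2 add_diff_cancel_left')
    then show "finite (B j)" "card (B j) = card (index_box (-1) 1 :: (int^'d) set)"
      by (simp_all add: card_image inj_on_def)
  qed
  have "(\<Sum>T\<in>S. side (fst T) powr \<alpha> * indicator (nbhd (fst T) (snd T)) y)
      = (\<Sum>T\<in>{T\<in>S. y \<in> nbhd (fst T) (snd T)}. side (fst T) powr \<alpha>)"
    using S(2) by (intro sum.mono_neutral_cong_right) auto
  also have "\<dots> \<le> (\<Sum>T\<in>(SIGMA j:{i..J}. B j). side (fst T) powr \<alpha>)"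
  proof (rule sum_mono2)
    show "finite (SIGMA j:{i..J}. B j)" using B(1) by (intro finite_SigmaI) auto
    show "{T \<in> S. y \<in> nbhd (fst T) (snd T)} \<subseteq> (SIGMA j:{i..J}. B j)"
    proof
      fix T assume T: "T \<in> {T \<in> S. y \<in> nbhd (fst T) (snd T)}"
      then obtain j m where jm: "T = (j, m)" "principal j m = (i, k)" "j \<le> J" using S(1) by auto
      have "i \<le> j" using principal_ancestor[of j m] jm(2) by auto
      then show "T \<in> (SIGMA j:{i..J}. B j)" using T jm by (auto simp: B_def nbhd_def)
    qed
  qed auto
  also have "\<dots> = (\<Sum>j\<in>{i..J}. c * side j powr \<alpha>)"
    using B by (subst sum.Sigma[symmetric, where B = B, unfolded split_def]) (auto simp: c_def)
  also have "\<dots> = c * (\<Sum>j\<in>{i..J}. side j powr \<alpha>)" by (simp add: sum_distrib_left)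
  also have "\<dots> \<le> c * (1 / (1 - 2 powr (- \<alpha>)) * side i powr \<alpha>)"
    by (intro mult_left_mono geometric_side_sum) (simp add: c_def)
  finally have "ennreal (\<Sum>T\<in>S. side (fst T) powr \<alpha> * indicator (nbhd (fst T) (snd T)) y)
      \<le> ennreal (c * (1 / (1 - 2 powr (- \<alpha>))) * side i powr \<alpha>)"
    by (intro ennreal_leI) (simp add: mult.assoc)
  also have "ennreal (\<Sum>T\<in>S. side (fst T) powr \<alpha> * indicator (nbhd (fst T) (snd T)) y) =
      (\<Sum>T\<in>S. ennreal (side (fst T) powr \<alpha>) * indicator (nbhd (fst T) (snd T)) y)"
    by (subst sum_ennreal[symmetric]) (auto simp: ennreal_mult indicator_def intro!: sum.cong)
  finally show ?thesis using True by (simp add: c_def)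
qed

text \<open>Plays the part of the Luxemburg norm over the tripled cube, but is built from dyadic
  cells, to which the Carleson embedding applies.\<close>

definition lux_max :: "(real \<Rightarrow> real) \<Rightarrow> (real^'d \<Rightarrow> real) \<Rightarrow> nat \<times> (int^'d) \<Rightarrow> real" where
  "lux_max A u P = Max ((\<lambda>e. luxemburg A (cell (fst P) (snd P + e)) u) ` index_box (-1) 2)"

lemma lux_max_ge:
  "e \<in> index_box (-1) 2 \<Longrightarrow> luxemburg A (cell (fst P) (snd P + e)) u \<le> lux_max A u P"
  unfolding lux_max_def by (intro Max_ge) auto

lemma lux_cell_nonneg:
  assumes "young_function X" "\<And>x. 0 \<le> u x" "\<And>x. u x \<le> R"
  shows "0 \<le> luxemburg (young_associate X) (cell j (m :: int^'d)) u"
  by (intro luxemburg_nonneg luxemburg_exists[OF assms cell_borel])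

lemma lux_max_nonneg:
  assumes "young_function X" "\<And>x. 0 \<le> u x" "\<And>x. u x \<le> R"
  shows "0 \<le> lux_max (young_associate X) u P"
  using order_trans[OF lux_cell_nonneg[OF assms] lux_max_ge[OF zero_in_index_box]] by simp

lemma lux_max_powr_le:
  assumes X: "young_function X" "\<And>x. 0 \<le> u x" "\<And>x. u x \<le> R"
  shows "lux_max (young_associate X) u P powr s \<le>
    (\<Sum>e\<in>index_box (-1) 2. luxemburg (young_associate X) (cell (fst P) (snd P + e)) u powr s)"
proof -
  have "lux_max (young_associate X) u P \<in> (\<lambda>e. luxemburg (young_associate X) (cell (fst P) (snd P + e)) u) ` index_box (-1) 2"
  proof -
    have "(0 :: int^'d) \<in> index_box (-1) 2" by (simp add: zero_in_index_box)
    then show ?thesis unfolding lux_max_def by (intro Max_in) auto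
  qed
  then obtain e where "e \<in> index_box (-1) 2"
    "lux_max (young_associate X) u P = luxemburg (young_associate X) (cell (fst P) (snd P + e)) u" by blast
  then show ?thesis
    using member_le_sum[of e "index_box (-1) 2" "\<lambda>e. luxemburg (young_associate X) (cell (fst P) (snd P + e)) u powr s"]
    by simp
qed

text \<open>Dominating \<open>N x (f y)\<close> by \<open>h x * K x y * g y\<close> leads to
  \<open>double_orlicz_holder\<close> on the tripled cube of volume \<open>v\<close>. There the bump
  condition bounds the kernel norm by \<open>M / v powr \<theta>\<close>, which with the factor
  \<open>v\<^sup>2\<close> of that inequality gives the exponent
  \<open>2 - \<theta>\<close>.\<close>

lemma principal_cell_bound:
  defines "n \<equiv> real (card (index_box (-1) 2 :: (int^'d) set))" and "\<theta> \<equiv> \<alpha> / CARD('d) + 1 / q - 1 / p"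
  shows "(\<integral>\<^sup>+ y\<in>nbhd i k. ennreal (nu i k (f y)) \<partial>lborel) \<le>
    ennreal (4 * M * n\<^sup>2 * (3 ^ CARD('d) * vol TYPE('d) i) powr (2 - \<theta>) *
      lux_max (young_associate \<Phi>) g (i, k) * lux_max (young_associate \<Psi>) h (i, k))"
proof -
  define v where "v = 3 ^ CARD('d) * vol TYPE('d) i"
  have v: "0 < v" by (simp add: v_def vol_pos)
  have n: "1 \<le> n" using card_index_box_ge_1[of "-1" 2] by (simp add: n_def)
  define Q where "Q = dilate i k"
  have Q [measurable]: "Q \<in> sets borel" by (simp add: Q_def dilate_borel)
  have eQ: "emeasure lborel Q = ennreal v" by (simp add: Q_def v_def emeasure_dilate)
  then have mQ: "measure lebesgue Q = v" using v by (simp add: measure_def)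
  define gm where "gm = lux_max (young_associate \<Phi>) g (i, k)"
  define hm where "hm = lux_max (young_associate \<Psi>) h (i, k)"
  have gm0: "0 \<le> gm" and hm0: "0 \<le> hm"
    using lux_max_nonneg[OF YF g] lux_max_nonneg[OF YP h] by (simp_all add: gm_def hm_def)
  have norm: "orlicz_norm \<Psi> Q (\<lambda>x. orlicz_norm \<Phi> Q (\<lambda>y. ennreal (K x y))) < ennreal (M / v powr \<theta>)" (is "?o < _")
  proof (rule ccontr)
    assume "\<not> ?thesis"
    then have "ennreal (v powr \<theta>) * ennreal (M / v powr \<theta>) \<le> ennreal (v powr \<theta>) * ?o"
      by (intro mult_left_mono) auto
    moreover have "ennreal (v powr \<theta>) * ennreal (M / v powr \<theta>) = ennreal M"
      using v M by (simp add: ennreal_mult[symmetric])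
    ultimately show False
      using bump[OF dilate_in_cubes, of i k] by (simp add: Q_def[symmetric] mQ \<theta>_def)
  qed
  define X where "X = (\<integral>\<^sup>+ y\<in>nbhd i k. ennreal (nu i k (f y)) \<partial>lborel)"
  have "X \<le> (\<integral>\<^sup>+ x\<in>Q. (\<integral>\<^sup>+ y\<in>Q. ennreal (h x * K x y * g y) \<partial>lborel) \<partial>lborel)"
    unfolding X_def nu_nbhd_eq
  proof (rule nn_integral_mono)
    fix x
    show "(\<integral>\<^sup>+ y. ennreal (N x (f y)) * indicator (cell i k) x * indicator (nbhd i k) y \<partial>lborel) \<le>
        (\<integral>\<^sup>+ y\<in>Q. ennreal (h x * K x y * g y) \<partial>lborel) * indicator Q x"
    proof (cases "x \<in> cell i k")
      case True
      then have "x \<in> Q"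
        using subsetD[OF nbhd_subset_dilate subsetD[OF cell_subset_nbhd True]] by (simp add: Q_def)
      moreover have "(\<integral>\<^sup>+ y. ennreal (N x (f y)) * indicator (nbhd i k) y \<partial>lborel) \<le> (\<integral>\<^sup>+ y\<in>Q. ennreal (h x * K x y * g y) \<partial>lborel)"
      proof (intro nn_integral_mono mult_mono ennreal_leI N_le)
        show "indicator (nbhd i k) y \<le> (indicator Q y :: ennreal)" for y
          using nbhd_subset_dilate[of i k] by (auto simp: Q_def indicator_def)
      qed simp_all
      ultimately show ?thesis using True by simp
    qed simp
  qed
  also have bound: "\<dots> \<le> ennreal (4 * (M / v powr \<theta>) * (n * s) * (n * s') * v\<^sup>2)" if s: "gm < s" "hm < s'" for s s'
  proof (rule double_orlicz_holder[OF YF YP K_meas K_nonneg g_meas g(1) h_meas h(1) Q eQ v _ _ _ norm])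
    show "0 < M / v powr \<theta>" using M v by simp
    show "0 < n * s" "0 < n * s'" using n s gm0 hm0 by auto
    show "(\<integral>\<^sup>+ y\<in>Q. ennreal (young_associate \<Phi> (g y / (n * s))) \<partial>lborel) \<le> ennreal v"
      unfolding Q_def n_def v_def
      by (rule dilate_associate_bound[OF YF g_meas g gm0 _ s(1)]) (use lux_max_ge[of _ "young_associate \<Phi>" "(i, k)" g] in \<open>simp add: gm_def\<close>)
    show "(\<integral>\<^sup>+ x\<in>Q. ennreal (young_associate \<Psi> (h x / (n * s'))) \<partial>lborel) \<le> ennreal v"
      unfolding Q_def n_def v_def
      by (rule dilate_associate_bound[OF YP h_meas h hm0 _ s(2)]) (use lux_max_ge[of _ "young_associate \<Psi>" "(i, k)" h] in \<open>simp add: hm_def\<close>)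
  qed
  finally have XX: "X \<le> ennreal (4 * (M / v powr \<theta>) * (n * s) * (n * s') * v\<^sup>2)" if "gm < s" "hm < s'" for s s'
    using that by blast
  define b where "b = 4 * (M / v powr \<theta>) * n\<^sup>2 * v\<^sup>2"
  have b: "0 \<le> b" using M v by (simp add: b_def)
  \<comment> \<open>The bound \<open>XX\<close> holds for all \<open>s > gm\<close> and
    \<open>s' > hm\<close>; the two limits are taken one after the other.\<close>
  have Xs: "X \<le> ennreal (b * s * hm)" if s: "gm < s" for s
  proof (rule ennreal_le_mult_limit)
    show "X \<le> ennreal (b * s * s')" if "hm < s'" for s'
      using XX[OF s that] by (simp add: b_def power2_eq_square mult_ac)
  qed (use b s gm0 hm0 in auto)
  have "X \<le> ennreal (b * hm * s)" if "gm < s" for s using Xs[OF that] by (simp add: mult_ac)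
  then have "X \<le> ennreal (b * hm * gm)"
    by (rule ennreal_le_mult_limit[rotated 2]) (use b hm0 gm0 in auto)
  also have "b * hm * gm = 4 * M * n\<^sup>2 * v powr (2 - \<theta>) * gm * hm"
    using v by (simp add: b_def powr_diff power2_eq_square mult_ac powr_realpow[of v 2, simplified])
  finally show ?thesis by (simp add: X_def v_def gm_def hm_def)
qed

text \<open>Since \<open>side j powr CARD('d)\<close> is the volume, each term is
  \<open>side j powr \<alpha>\<close> times an average, and \<open>average_le_principal\<close>
  replaces that average by the one of the principal cell. Grouping by principal cells leaves the
  sums bounded in \<open>principal_overlap\<close>.\<close>

lemma cells_le_principal:
  fixes J :: nat
  defines "TT \<equiv> (SIGMA j:{..J}. top_box j)"
    and "C \<equiv> 2 * real DIM('v) * 3 ^ DIM('v) * real (card (index_box (-1) 1 :: (int^'d) set)) * (1 / (1 - 2 powr (- \<alpha>)))"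
  shows "(\<Sum>T\<in>TT. ennreal (side (fst T) powr (\<alpha> - CARD('d))) *
        (\<integral>\<^sup>+ y\<in>nbhd (fst T) (snd T). ennreal (nu (fst T) (snd T) (f y)) \<partial>lborel))
    \<le> (\<Sum>P\<in>(\<lambda>T. principal (fst T) (snd T)) ` TT. ennreal (C * side (fst P) powr \<alpha> / vol TYPE('d) (fst P)) *
        (\<integral>\<^sup>+ y\<in>nbhd (fst P) (snd P). ennreal (nu (fst P) (snd P) (f y)) \<partial>lborel))"
    (is "_ \<le> (\<Sum>P\<in>?S. ?G P)")
proof -
  define D where "D = 2 * real DIM('v) * 3 ^ DIM('v)"
  define E where "E = real (card (index_box (-1) 1 :: (int^'d) set)) * (1 / (1 - 2 powr (- \<alpha>)))"
  have C: "C = D * E" by (simp add: C_def D_def E_def)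
  have D0: "0 \<le> D" by (simp add: D_def)
  have "2 powr (- \<alpha>) < 1" using alpha by (auto simp: powr_less_one)
  then have E0: "0 \<le> E" by (simp add: E_def)
  have fTT: "finite TT" unfolding TT_def by (intro finite_SigmaI) (auto simp: top_box_def)
  define pr where "pr T = principal (fst T) (snd T)" for T :: "nat \<times> (int^'d)"
  define H where "H P y = ennreal (D / vol TYPE('d) (fst P) * nu (fst P) (snd P) (f y))" for P y
  have Hn: "H P y = ennreal (D / vol TYPE('d) (fst P)) * ennreal (nu (fst P) (snd P) (f y))" for P y
    unfolding H_def using D0 vol_pos[of "fst P"] by (intro ennreal_mult) (auto simp: nu_nonneg)
  have Hm [measurable]: "H P \<in> borel_measurable borel" for P
    unfolding Hn[abs_def] by measurable
  have one: "ennreal (side (fst T) powr (\<alpha> - CARD('d))) * (\<integral>\<^sup>+ y\<in>nbhd (fst T) (snd T). ennreal (nu (fst T) (snd T) (f y)) \<partial>lborel)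
      \<le> (\<integral>\<^sup>+ y. H (pr T) y * (ennreal (side (fst T) powr \<alpha>) * indicator (nbhd (fst T) (snd T)) y) \<partial>lborel)" for T
  proof -
    obtain j m where T: "T = (j, m)" by fastforce
    obtain i k where P: "principal j m = (i, k)" by fastforce
    have le: "side j powr (\<alpha> - CARD('d)) * nu j m w \<le> D / vol TYPE('d) i * nu i k w * side j powr \<alpha>" for w
    proof -
      have "side j powr (\<alpha> - CARD('d)) * nu j m w = side j powr \<alpha> * (nu j m w / vol TYPE('d) j)"
        using side_pos[of j] by (simp add: powr_diff powr_realpow vol_def)
      also have "\<dots> \<le> side j powr \<alpha> * (D * (nu i k w / vol TYPE('d) i))"
        using average_le_principal[OF P, of w] by (intro mult_left_mono) (simp_all add: D_def ratio_def)
      finally show ?thesis by (simp add: mult_ac)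
    qed
    have "ennreal (side j powr (\<alpha> - CARD('d))) * (\<integral>\<^sup>+ y\<in>nbhd j m. ennreal (nu j m (f y)) \<partial>lborel)
        = (\<integral>\<^sup>+ y. ennreal (side j powr (\<alpha> - CARD('d))) * (ennreal (nu j m (f y)) * indicator (nbhd j m) y) \<partial>lborel)"
      by (rule nn_integral_cmult[symmetric]) measurable
    also have "\<dots> \<le> (\<integral>\<^sup>+ y. H (i, k) y * (ennreal (side j powr \<alpha>) * indicator (nbhd j m) y) \<partial>lborel)"
    proof (rule nn_integral_mono)
      fix y
      have "ennreal (side j powr (\<alpha> - CARD('d))) * ennreal (nu j m (f y)) = ennreal (side j powr (\<alpha> - CARD('d)) * nu j m (f y))"
        by (rule ennreal_mult[symmetric]) (simp_all add: nu_nonneg)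
      also have "\<dots> \<le> ennreal (D / vol TYPE('d) i * nu i k (f y) * side j powr \<alpha>)"
        by (rule ennreal_leI[OF le])
      also have "\<dots> = H (i, k) y * ennreal (side j powr \<alpha>)"
        unfolding H_def fst_conv snd_conv using D0 vol_pos[of i]
        by (intro ennreal_mult) (auto simp: nu_nonneg)
      finally show "ennreal (side j powr (\<alpha> - CARD('d))) * (ennreal (nu j m (f y)) * indicator (nbhd j m) y)
          \<le> H (i, k) y * (ennreal (side j powr \<alpha>) * indicator (nbhd j m) y)"
        by (cases "y \<in> nbhd j m") simp_all
    qed
    finally show ?thesis by (simp add: T P pr_def)
  qed
  have block: "(\<Sum>T\<in>{T\<in>TT. pr T = P}. \<integral>\<^sup>+ y. H P y * (ennreal (side (fst T) powr \<alpha>) * indicator (nbhd (fst T) (snd T)) y) \<partial>lborel)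
      \<le> ?G P" for P
  proof -
    obtain i k where P: "P = (i, k)" by fastforce
    define TP where "TP = {T\<in>TT. pr T = P}"
    have TP: "TP \<subseteq> {(j, m). j \<le> J \<and> principal j m = (i, k)}" "finite TP"
      using fTT by (auto simp: TP_def TT_def pr_def P)
    have "(\<Sum>T\<in>TP. \<integral>\<^sup>+ y. H P y * (ennreal (side (fst T) powr \<alpha>) * indicator (nbhd (fst T) (snd T)) y) \<partial>lborel)
        = (\<integral>\<^sup>+ y. (\<Sum>T\<in>TP. H P y * (ennreal (side (fst T) powr \<alpha>) * indicator (nbhd (fst T) (snd T)) y)) \<partial>lborel)"
      by (rule nn_integral_sum[symmetric]) measurable
    also have "\<dots> \<le> (\<integral>\<^sup>+ y. H P y * (ennreal (E * side i powr \<alpha>) * indicator (nbhd i k) y) \<partial>lborel)"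
      unfolding sum_distrib_left[symmetric] E_def
      by (intro nn_integral_mono mult_left_mono principal_overlap[OF TP]) simp
    also have "\<dots> = (\<integral>\<^sup>+ y. ennreal (C * side i powr \<alpha> / vol TYPE('d) i) * (ennreal (nu i k (f y)) * indicator (nbhd i k) y) \<partial>lborel)"
    proof (rule nn_integral_cong)
      fix y
      have "H P y * (ennreal (E * side i powr \<alpha>) * indicator (nbhd i k) y) =
          (ennreal (D / vol TYPE('d) i) * ennreal (E * side i powr \<alpha>)) * (ennreal (nu i k (f y)) * indicator (nbhd i k) y)"
        by (simp only: Hn P fst_conv snd_conv mult_ac)
      also have "ennreal (D / vol TYPE('d) i) * ennreal (E * side i powr \<alpha>) = ennreal (D / vol TYPE('d) i * (E * side i powr \<alpha>))"
        using D0 E0 vol_pos[of i] by (intro ennreal_mult[symmetric]) auto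
      also have "D / vol TYPE('d) i * (E * side i powr \<alpha>) = C * side i powr \<alpha> / vol TYPE('d) i"
        by (simp add: C)
      finally show "H P y * (ennreal (E * side i powr \<alpha>) * indicator (nbhd i k) y) =
          ennreal (C * side i powr \<alpha> / vol TYPE('d) i) * (ennreal (nu i k (f y)) * indicator (nbhd i k) y)" .
    qed
    also have "\<dots> = ?G P"
      unfolding P fst_conv snd_conv by (rule nn_integral_cmult) measurable
    finally show ?thesis by (simp only: TP_def)
  qed
  have "(\<Sum>T\<in>TT. ennreal (side (fst T) powr (\<alpha> - CARD('d))) *
        (\<integral>\<^sup>+ y\<in>nbhd (fst T) (snd T). ennreal (nu (fst T) (snd T) (f y)) \<partial>lborel))
      \<le> (\<Sum>T\<in>TT. \<integral>\<^sup>+ y. H (pr T) y * (ennreal (side (fst T) powr \<alpha>) * indicator (nbhd (fst T) (snd T)) y) \<partial>lborel)"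
    by (intro sum_mono one)
  also have "\<dots> = (\<Sum>P\<in>pr ` TT. \<Sum>T\<in>{T\<in>TT. pr T = P}. \<integral>\<^sup>+ y. H (pr T) y * (ennreal (side (fst T) powr \<alpha>) * indicator (nbhd (fst T) (snd T)) y) \<partial>lborel)"
    by (rule sum.image_gen[OF fTT])
  also have "\<dots> = (\<Sum>P\<in>pr ` TT. \<Sum>T\<in>{T\<in>TT. pr T = P}. \<integral>\<^sup>+ y. H P y * (ennreal (side (fst T) powr \<alpha>) * indicator (nbhd (fst T) (snd T)) y) \<partial>lborel)"
    by (intro sum.cong refl) simp
  also have "\<dots> \<le> (\<Sum>P\<in>pr ` TT. ?G P)" by (intro sum_mono block)
  finally show ?thesis by (simp only: pr_def[abs_def])
qed

text \<open>The power of the maximum is at most the sum of the powers over the offsets, and for each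
  offset the translated stopping cells still satisfy a packing condition by
  \<open>packing_shift\<close>. The embedding is used with \<open>G = 1\<close>.\<close>

lemma principal_lux_sum:
  fixes S :: "(nat \<times> (int^'d)) set" and u :: "real^'d \<Rightarrow> real"
  assumes S: "finite S" "\<And>j m. (j, m) \<in> S \<Longrightarrow> principal j m = (j, m)"
    and X: "young_function X" and ab: "0 < a" "a \<le> b"
    and c: "0 < c" "young_associate X c \<le> 1 / 2" and K': "0 \<le> K'"
    and tail: "\<And>u. 0 < u \<Longrightarrow> (\<integral>\<^sup>+ t\<in>{t. 0 < t \<and> c < u * t}.
        ennreal (young_associate X (u * t) powr (b / a) * t powr (- b - 1)) \<partial>lborel) \<le> ennreal (K' * u powr b)"
    and um: "u \<in> borel_measurable borel" and u: "\<And>x. 0 \<le> u x" "\<And>x. u x \<le> R"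
    and norm: "(\<integral>\<^sup>+ x. ennreal (u x powr a) \<partial>lborel) \<le> 1"
  shows "(\<Sum>P\<in>S. vol TYPE('d) (fst P) powr (b / a) * lux_max (young_associate X) u P powr b) \<le>
    real (card (index_box (-1) 2 :: (int^'d) set)) *
      (b * (2 * real (card (index_box (-2) 2 :: (int^'d) set))) * 2 powr (b / a) * K')"
proof -
  define z where "z T = vol TYPE('d) (fst T) powr (b / a) * luxemburg (young_associate X) (cell (fst T) (snd T)) u powr b"
    for T :: "nat \<times> (int^'d)"
  define sh where "sh e T = (fst T, snd T + e)" for e and T :: "nat \<times> (int^'d)"
  define B where "B = b * (2 * real (card (index_box (-2) 2 :: (int^'d) set))) * 2 powr (b / a) * K'"
  have each: "(\<Sum>P\<in>S. z (sh e P)) \<le> B" if e: "e \<in> index_box (-1) 2" for e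
  proof -
    have e2: "e \<in> index_box (-2) 2"
    proof -
      have "-1 \<le> e $ i" "e $ i \<le> 2" for i using e by (simp_all add: index_box_def)
      then have "-2 \<le> e $ i" "e $ i \<le> 2" for i using order_trans[of "-2 :: int" "-1" "e $ i"] by simp_all
      then show ?thesis by (simp add: index_box_def)
    qed
    have "(\<Sum>P\<in>S. z (sh e P)) = (\<Sum>T\<in>sh e ` S. z T)"
      by (subst sum.reindex) (auto simp: inj_on_def sh_def prod_eq_iff)
    also have "\<dots> \<le> b * (2 * real (card (index_box (-2) 2 :: (int^'d) set))) * 2 powr (b / a) * K' * 1 powr (b / a)"
      unfolding z_def
    proof (rule carleson_embedding[OF X ab c K' tail])
      show "finite (sh e ` S)" using S(1) by simp
      show "(\<Sum>(j, m)\<in>{(j, m) \<in> sh e ` S. i \<le> j \<and> (halve ^^ (j - i)) m = k}. vol TYPE('d) j)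
          \<le> 2 * real (card (index_box (-2) 2 :: (int^'d) set)) * vol TYPE('d) i" for i k
        using packing_shift[OF S(1) e2 carleson_packing[OF S]] by (simp add: sh_def[abs_def])
    qed (use um u norm lux_cell_nonneg[OF X u] in auto)
    finally show ?thesis by (simp add: B_def)
  qed
  have "(\<Sum>P\<in>S. vol TYPE('d) (fst P) powr (b / a) * lux_max (young_associate X) u P powr b) \<le>
      (\<Sum>P\<in>S. \<Sum>e\<in>index_box (-1) 2. z (sh e P))"
  proof (rule sum_mono)
    fix P
    show "vol TYPE('d) (fst P) powr (b / a) * lux_max (young_associate X) u P powr b \<le> (\<Sum>e\<in>index_box (-1) 2. z (sh e P))"
      using mult_left_mono[OF lux_max_powr_le[OF X u, where P = P and s = b], of "vol TYPE('d) (fst P) powr (b / a)"]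
      by (simp add: z_def sh_def sum_distrib_left)
  qed
  also have "\<dots> = (\<Sum>e\<in>index_box (-1) 2. \<Sum>P\<in>S. z (sh e P))" by (rule sum.swap)
  also have "\<dots> \<le> (\<Sum>e\<in>(index_box (-1) 2 :: (int^'d) set). B)" by (intro sum_mono each)
  finally show ?thesis by (simp add: B_def)
qed

text \<open>Once everything is a sum over stopping cells, Young's inequality with \<open>q\<close>
  and its conjugate separates \<open>g\<close> from \<open>h\<close>, and each of the two sums is an
  instance of \<open>principal_lux_sum\<close>.\<close>

lemma discretized_bound:
  "(\<integral>\<^sup>+ x. (\<integral>\<^sup>+ y. ennreal (N x (f y)) * (\<Sum>j\<le>J. ennreal (side j powr (\<alpha> - CARD('d))) * indicator (nbhd j (cidx j x)) y) \<partial>lborel) \<partial>lborel)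
   \<le> ennreal (bilinear_const TYPE('d) TYPE('v) \<alpha> p q M K1 K2)"
proof -
  define TT where "TT = (SIGMA j:{..J}. top_box j)"
  define S where "S = (\<lambda>T. principal (fst T) (snd T)) ` TT"
  define C where "C = 2 * real DIM('v) * 3 ^ DIM('v) * real (card (index_box (-1) 1 :: (int^'d) set)) * (1 / (1 - 2 powr (- \<alpha>)))"
  define n where "n = real (card (index_box (-1) 2 :: (int^'d) set))"
  define n5 where "n5 = real (card (index_box (-2) 2 :: (int^'d) set))"
  define \<theta> where "\<theta> = \<alpha> / CARD('d) + 1 / q - 1 / p"
  define D where "D = 4 * M * n\<^sup>2 * (3 ^ CARD('d)) powr (2 - \<theta>)"
  define v where "v P = vol TYPE('d) (fst P)" for P :: "nat \<times> (int^'d)"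
  define G where "G P = lux_max (young_associate \<Phi>) g P" for P
  define H where "H P = lux_max (young_associate \<Psi>) h P" for P
  define q' where "q' = conj_exponent q"
  have fTT: "finite TT" unfolding TT_def by (intro finite_SigmaI) (auto simp: top_box_def)
  have fS: "finite S" using fTT by (simp add: S_def)
  have princ: "principal j m = (j, m)" if jm: "(j, m) \<in> S" for j m
  proof -
    obtain T where "(j, m) = principal (fst T) (snd T)" using jm unfolding S_def by blast
    then have "principal (fst T) (snd T) = (j, m)" by (rule sym)
    then show ?thesis using principal_ancestor[of "fst T" "snd T"] by simp
  qed
  have "2 powr (- \<alpha>) < 1" using alpha by (auto simp: powr_less_one)
  then have C0: "0 \<le> C" by (simp add: C_def)
  have D0: "0 \<le> D" using M by (simp add: D_def)
  have v: "0 < v P" for P by (simp add: v_def vol_pos)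
  have GH: "0 \<le> G P" "0 \<le> H P" for P
    unfolding G_def H_def by (rule lux_max_nonneg[OF YF g] lux_max_nonneg[OF YP h])+
  have q1: "1 < q" using pq by simp
  have q': "1 < q'" "1 / q + 1 / q' = 1" "(1 - 1 / q) * q' = 1"
    using q1 by (simp_all add: q'_def conj_exponent_def field_simps)
  have "(\<integral>\<^sup>+ x. (\<integral>\<^sup>+ y. ennreal (N x (f y)) * (\<Sum>j\<le>J. ennreal (side j powr (\<alpha> - CARD('d))) * indicator (nbhd j (cidx j x)) y) \<partial>lborel) \<partial>lborel)
      \<le> (\<Sum>P\<in>S. ennreal (C * side (fst P) powr \<alpha> / v P) * (\<integral>\<^sup>+ y\<in>nbhd (fst P) (snd P). ennreal (nu (fst P) (snd P) (f y)) \<partial>lborel))"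
    using order_trans[OF discretized_le_cells[of J] cells_le_principal[of J]]
    by (simp only: S_def TT_def C_def v_def)
  also have "\<dots> \<le> (\<Sum>P\<in>S. ennreal (C * D * ((v P powr (1 / p) * G P) * (v P powr (1 - 1 / q) * H P))))"
  proof (rule sum_mono)
    fix P assume "P \<in> S"
    have "ennreal (C * side (fst P) powr \<alpha> / v P) * (\<integral>\<^sup>+ y\<in>nbhd (fst P) (snd P). ennreal (nu (fst P) (snd P) (f y)) \<partial>lborel)
        \<le> ennreal (C * side (fst P) powr \<alpha> / v P) * ennreal (4 * M * n\<^sup>2 * (3 ^ CARD('d) * v P) powr (2 - \<theta>) * G P * H P)"
      using principal_cell_bound[of "fst P" "snd P"]
      by (intro mult_left_mono) (simp_all add: n_def \<theta>_def v_def G_def H_def)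
    also have "\<dots> = ennreal (C * side (fst P) powr \<alpha> / v P * (4 * M * n\<^sup>2 * (3 ^ CARD('d) * v P) powr (2 - \<theta>) * G P * H P))"
      using C0 v[of P] M GH by (intro ennreal_mult[symmetric]) auto
    also have "C * side (fst P) powr \<alpha> / v P * (4 * M * n\<^sup>2 * (3 ^ CARD('d) * v P) powr (2 - \<theta>) * G P * H P)
        = C * D * ((v P powr (1 / p) * G P) * (v P powr (1 - 1 / q) * H P))"
    proof -
      have "v P powr (\<alpha> / CARD('d)) = side (fst P) powr \<alpha>"
        using side_pos[of "fst P"] by (simp add: v_def vol_def powr_realpow[symmetric] powr_powr)
      moreover have "v P powr (\<alpha> / CARD('d)) / v P * v P powr (2 - \<theta>) = v P powr (\<alpha> / CARD('d) - 1 + (2 - \<theta>))"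
        using v[of P] by (simp add: powr_add powr_diff power2_eq_square)
      \<comment> \<open>The choice of \<theta> cancels \<alpha>; what remains is divided between
        \<open>G\<close> and \<open>H\<close>.\<close>
      moreover have "\<alpha> / CARD('d) - 1 + (2 - \<theta>) = 1 / p + (1 - 1 / q)" by (simp add: \<theta>_def)
      ultimately have e1: "side (fst P) powr \<alpha> / v P * v P powr (2 - \<theta>) = v P powr (1 / p) * v P powr (1 - 1 / q)"
        by (simp only: powr_add)
      have e2: "(3 ^ CARD('d) * v P) powr (2 - \<theta>) = (3 ^ CARD('d)) powr (2 - \<theta>) * v P powr (2 - \<theta>)"
        using v[of P] by (simp add: powr_mult)
      have "C * side (fst P) powr \<alpha> / v P * (4 * M * n\<^sup>2 * (3 ^ CARD('d) * v P) powr (2 - \<theta>) * G P * H P)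
          = C * D * (side (fst P) powr \<alpha> / v P * v P powr (2 - \<theta>)) * (G P * H P)"
        unfolding e2 by (simp add: D_def)
      then show ?thesis unfolding e1 by (simp only: mult_ac)
    qed
    finally show "ennreal (C * side (fst P) powr \<alpha> / v P) * (\<integral>\<^sup>+ y\<in>nbhd (fst P) (snd P). ennreal (nu (fst P) (snd P) (f y)) \<partial>lborel)
        \<le> ennreal (C * D * ((v P powr (1 / p) * G P) * (v P powr (1 - 1 / q) * H P)))" .
  qed
  also have "\<dots> = ennreal (\<Sum>P\<in>S. C * D * ((v P powr (1 / p) * G P) * (v P powr (1 - 1 / q) * H P)))"
    using C0 D0 GH by (intro sum_ennreal) auto
  also have "\<dots> \<le> ennreal (bilinear_const TYPE('d) TYPE('v) \<alpha> p q M K1 K2)"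
  proof (rule ennreal_leI)
    \<comment> \<open>The exponent \<open>(1 - 1 / q) * q' = 1\<close> is kept as
      \<open>q' / q'\<close> to match \<open>principal_lux_sum\<close>.\<close>
    have "(v P powr (1 / p) * G P) * (v P powr (1 - 1 / q) * H P) \<le>
        (v P powr (q / p) * G P powr q) / q + (v P powr (q' / q') * H P powr q') / q'" for P
    proof -
      have "(v P powr (1 / p) * G P) powr q = v P powr (q / p) * G P powr q"
        using v[of P] GH by (simp add: powr_mult powr_powr)
      moreover have "(v P powr (1 - 1 / q) * H P) powr q' = v P powr (q' / q') * H P powr q'"
        using v[of P] GH q' by (simp add: powr_mult powr_powr)
      ultimately show ?thesis
        using Youngs_inequality[OF q1 q'(1,2), of "v P powr (1 / p) * G P" "v P powr (1 - 1 / q) * H P"] GH[of P] by simp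
    qed
    then have "(\<Sum>P\<in>S. (v P powr (1 / p) * G P) * (v P powr (1 - 1 / q) * H P)) \<le>
        (\<Sum>P\<in>S. v P powr (q / p) * G P powr q) / q + (\<Sum>P\<in>S. v P powr (q' / q') * H P powr q') / q'"
      unfolding sum_divide_distrib sum.distrib[symmetric] by (intro sum_mono)
    also have "\<dots> \<le> n * (q * (2 * n5) * 2 powr (q / p) * K1) / q + n * (q' * (2 * n5) * 2 powr (q' / q') * K2) / q'"
    proof (intro add_mono divide_right_mono)
      show "(\<Sum>P\<in>S. v P powr (q / p) * G P powr q) \<le> n * (q * (2 * n5) * 2 powr (q / p) * K1)"
        unfolding v_def G_def n_def n5_def using pq
        by (intro principal_lux_sum[OF fS princ YF _ _ c1 K1 tail1 g_meas g g_norm]) auto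
      show "(\<Sum>P\<in>S. v P powr (q' / q') * H P powr q') \<le> n * (q' * (2 * n5) * 2 powr (q' / q') * K2)"
        unfolding v_def H_def n_def n5_def q'_def using q'(1)
        by (intro principal_lux_sum[OF fS princ YP _ _ c2 K2 tail2 h_meas h h_norm]) (auto simp: q'_def)
    qed (use q1 q' in auto)
    also have "\<dots> = n * (2 * n5) * (2 powr (q / p) * K1 + 2 * K2)"
      using q1 q' by (simp add: distrib_left)
    finally have "C * D * (\<Sum>P\<in>S. (v P powr (1 / p) * G P) * (v P powr (1 - 1 / q) * H P)) \<le>
        C * D * (n * (2 * n5) * (2 powr (q / p) * K1 + 2 * K2))"
      using C0 D0 by (intro mult_left_mono) auto
    then show "(\<Sum>P\<in>S. C * D * ((v P powr (1 / p) * G P) * (v P powr (1 - 1 / q) * H P))) \<le>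
        bilinear_const TYPE('d) TYPE('v) \<alpha> p q M K1 K2"
      by (simp only: sum_distrib_left[symmetric] bilinear_const_def C_def D_def n_def n5_def \<theta>_def)
  qed
  finally show ?thesis .
qed

end

section \<open>The bilinear estimate\<close>

lemma seminorm_op_norm: "seminorm (op_norm :: complex^'n^'n \<Rightarrow> real)"
  unfolding seminorm_def
proof (intro conjI allI)
  fix A B :: "complex^'n^'n" and c :: real
  show "op_norm (A + B) \<le> op_norm A + op_norm B"
    unfolding op_norm_def matrix_vector_mult_add_rdistrib
    by (rule onorm_triangle[OF matrix_vector_mul_bounded_linear matrix_vector_mul_bounded_linear])
  have "(\<lambda>v. (c *\<^sub>R A) *v v) = (\<lambda>v. c *\<^sub>R (A *v v))"
    by (simp add: fun_eq_iff vec_eq_iff matrix_vector_mult_def scaleR_sum_right)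
  then show "op_norm (c *\<^sub>R A) = \<bar>c\<bar> * op_norm A"
    unfolding op_norm_def by (simp add: onorm_scaleR[OF matrix_vector_mul_bounded_linear])
qed

lemma op_norm_nonneg: "0 \<le> op_norm (A :: complex^'n^'n)"
  by (rule seminorm_nonneg[OF seminorm_op_norm])

lemma continuous_on_matrix_vector_mult:
  "continuous_on UNIV (\<lambda>z. (fst z :: complex^'n^'n) *v snd z)"
  unfolding matrix_vector_mult_def by (intro continuous_intros)

lemma borel_measurable_matrix_vector_mult [measurable (raw)]:
  fixes A :: "'a \<Rightarrow> complex^'n^'n"
  assumes "A \<in> borel_measurable M" "v \<in> borel_measurable M"
  shows "(\<lambda>x. A x *v v x) \<in> borel_measurable M"
  using borel_measurable_continuous_Pair[OF assms continuous_on_matrix_vector_mult] .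

lemma borel_measurable_matrix_mult [measurable (raw)]:
  fixes A B :: "'a \<Rightarrow> complex^'n^'n"
  assumes "A \<in> borel_measurable M" "B \<in> borel_measurable M"
  shows "(\<lambda>x. A x ** B x) \<in> borel_measurable M"
  using borel_measurable_continuous_Pair[OF assms, of "\<lambda>A B. A ** B"]
  by (simp add: continuous_on_matrix_mult continuous_on_fst continuous_on_snd continuous_on_id)

lemma borel_measurable_op_norm [measurable (raw)]:
  fixes A :: "'a \<Rightarrow> complex^'n^'n"
  assumes "A \<in> borel_measurable M"
  shows "(\<lambda>x. op_norm (A x)) \<in> borel_measurable M"
  by (rule borel_measurable_continuous_on[OF seminorm_continuous_on[OF seminorm_op_norm] assms])

text \<open>At the finest level \<open>j \<le> J\<close> with
  \<open>norm (x - y) \<le> side j\<close>, the point \<open>y\<close> lies in the cell of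
  \<open>x\<close> or in an adjacent one, and the distance is at least half of
  \<open>side j\<close>; the decreasing kernel thus loses only a power of 2.\<close>

lemma (in dyadic_grid) kernel_le_dyadic:
  fixes \<alpha> :: real and x y :: "real^'d"
  assumes a: "\<alpha> < CARD('d)" and J: "side J \<le> norm (x - y)" and L: "norm (x - y) \<le> L"
  shows "norm (x - y) powr (\<alpha> - CARD('d)) \<le>
    2 powr (CARD('d) - \<alpha>) * (\<Sum>j\<le>J. side j powr (\<alpha> - CARD('d)) * indicator (nbhd j (cidx j x)) y)"
proof -
  define r where "r = norm (x - y)"
  define I where "I = {j. j \<le> J \<and> r \<le> side j}"
  have "0 \<in> I" using L by (simp add: I_def side_def r_def)
  moreover have fI: "finite I" by (simp add: I_def)
  ultimately have "Max I \<in> I" by (intro Max_in) auto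
  define j where "j = Max I"
  have j: "j \<le> J" "r \<le> side j" using \<open>Max I \<in> I\<close> by (auto simp: j_def I_def)
  have half: "side j / 2 \<le> r"
  proof (cases "j = J")
    case True
    then show ?thesis using J side_pos[of j] by (simp add: r_def)
  next
    case False
    then have "Suc j \<le> J" using j(1) by simp
    moreover have "Suc j \<notin> I" using Max_ge[OF fI, of "Suc j"] by (auto simp: j_def)
    ultimately show ?thesis by (simp add: I_def side_def)
  qed
  have "y \<in> nbhd j (cidx j x)"
  proof -
    have "-1 \<le> cidx j y $ i - cidx j x $ i \<and> cidx j y $ i - cidx j x $ i \<le> 1" for i
    proof -
      have "\<bar>x $ i - y $ i\<bar> \<le> side j" using component_le_norm_cart[of "x - y" i] j(2) by (simp add: r_def)
      then have "x $ i / side j \<le> y $ i / side j + 1" "y $ i / side j \<le> x $ i / side j + 1"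
        using side_pos[of j] by (simp_all add: field_simps abs_le_iff)
      from this[THEN floor_mono] show ?thesis by (simp add: cidx_def)
    qed
    then show ?thesis by (simp add: nbhd_def index_box_def)
  qed
  then have "side j powr (\<alpha> - CARD('d)) \<le> (\<Sum>j\<le>J. side j powr (\<alpha> - CARD('d)) * indicator (nbhd j (cidx j x)) y)"
    using member_le_sum[of j "{..J}" "\<lambda>j. side j powr (\<alpha> - CARD('d)) * indicator (nbhd j (cidx j x)) y"] j(1)
    by simp
  moreover have "r powr (\<alpha> - CARD('d)) \<le> (side j / 2) powr (\<alpha> - CARD('d))"
    using half a side_pos[of j] by (intro powr_mono2') auto
  moreover have "(side j / 2) powr (\<alpha> - CARD('d)) = 2 powr (CARD('d) - \<alpha>) * side j powr (\<alpha> - CARD('d))"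
  proof -
    have "2 powr (CARD('d) - \<alpha>) = 1 / 2 powr (\<alpha> - CARD('d))"
      using powr_minus_divide[of 2 "\<alpha> - CARD('d)"] by simp
    then show ?thesis using side_pos[of j] by (simp add: powr_divide)
  qed
  ultimately show ?thesis
    unfolding r_def[symmetric] by (smt (verit, best) mult_left_mono powr_ge_zero)
qed

lemma (in dyadic_grid) borel_measurable_nbhd_pair [measurable]:
  "(\<lambda>(x, y). indicator (nbhd j (cidx j x)) (y :: real^'d) :: ennreal) \<in> borel_measurable (borel \<Otimes>\<^sub>M borel)"
proof -
  have c: "(\<lambda>x :: real^'d. real_of_int (cidx j x $ i)) \<in> borel_measurable borel" for i
    by (rule measurable_compose[OF borel_measurable_cidx]) simp
  define P where "P i = {z :: (real^'d) \<times> (real^'d).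
      real_of_int (cidx j (snd z) $ i) - real_of_int (cidx j (fst z) $ i) \<in> {-1..1}}" for i
  have P: "P i \<in> sets (borel \<Otimes>\<^sub>M borel)" for i
  proof -
    have "(\<lambda>z. real_of_int (cidx j (snd z) $ i) - real_of_int (cidx j (fst z) $ i)) \<in>
        borel_measurable ((borel :: (real^'d) measure) \<Otimes>\<^sub>M (borel :: (real^'d) measure))"
      by (intro borel_measurable_diff measurable_compose[OF measurable_snd c] measurable_compose[OF measurable_fst c])
    from measurable_sets[OF this, of "{-1..1}"] show ?thesis
      by (simp add: P_def vimage_def space_pair_measure)
  qed
  have iff: "y \<in> nbhd j (cidx j x) \<longleftrightarrow> (x, y) \<in> (\<Inter>i\<in>UNIV. P i)" for x y
  proof -
    have "cidx j y $ i - cidx j x $ i \<in> {-1..1} \<longleftrightarrow> (x, y) \<in> P i" for i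
      unfolding P_def mem_Collect_eq fst_conv snd_conv of_int_diff[symmetric] atLeastAtMost_iff by linarith
    then show ?thesis by (simp add: nbhd_def index_box_def)
  qed
  have "(\<Inter>i\<in>UNIV. P i) \<in> sets (borel \<Otimes>\<^sub>M borel)"
    using P by (intro sets.finite_INT) auto
  then have "indicator (\<Inter>i\<in>UNIV. P i) \<in> borel_measurable (borel \<Otimes>\<^sub>M borel)"
    by (rule borel_measurable_indicator)
  moreover have "(\<lambda>(x, y). indicator (nbhd j (cidx j x)) y :: ennreal) = indicator (\<Inter>i\<in>UNIV. P i)"
    unfolding fun_eq_iff by (simp only: split_paired_All prod.case indicator_def iff) simp
  ultimately show ?thesis by simp
qed

lemma nn_integral_pair_cmult:
  fixes F :: "'a::euclidean_space \<Rightarrow> 'b::euclidean_space \<Rightarrow> ennreal"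
  assumes F [measurable]: "(\<lambda>(x, y). F x y) \<in> borel_measurable (lborel \<Otimes>\<^sub>M lborel)"
  shows "(\<integral>\<^sup>+ x. (\<integral>\<^sup>+ y. c * F x y \<partial>lborel) \<partial>lborel) = c * (\<integral>\<^sup>+ x. (\<integral>\<^sup>+ y. F x y \<partial>lborel) \<partial>lborel)"
proof -
  have "(\<integral>\<^sup>+ y. c * F x y \<partial>lborel) = c * (\<integral>\<^sup>+ y. F x y \<partial>lborel)" for x
    by (rule nn_integral_cmult) measurable
  moreover have "(\<lambda>x. \<integral>\<^sup>+ y. F x y \<partial>lborel) \<in> borel_measurable lborel"
    by measurable
  ultimately show ?thesis by (simp only: nn_integral_cmult)
qed

text \<open>The radii match a grid with \<open>L = 2 ^ n\<close> used down to level
  \<open>2 * n\<close>, where the cells have side \<open>1 / 2 ^ n\<close>.\<close>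

definition trunc_kernel :: "real \<Rightarrow> nat \<Rightarrow> real^'d \<Rightarrow> real^'d \<Rightarrow> real" where
  "trunc_kernel \<alpha> n x y = norm (x - y) powr (\<alpha> - CARD('d)) * indicator {1 / 2 ^ n..2 ^ n} (norm (x - y))"

text \<open>\<open>C\<close> is fixed before the truncation \<open>n\<close> and the bound
  \<open>R\<close>. Boundedness and bounded support of the data are qualitative and disappear in a
  limit in \<open>strong_bound\<close>.\<close>

definition bilinear_estimate ::
  "real \<Rightarrow> real \<Rightarrow> real \<Rightarrow> (real^'d \<Rightarrow> complex^'n^'n) \<Rightarrow> (real^'d \<Rightarrow> complex^'n^'n) \<Rightarrow> real \<Rightarrow> bool" where
  "bilinear_estimate \<alpha> p q A B C \<longleftrightarrow> 0 \<le> C \<and> (\<forall>n R f g h.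
      f \<in> borel_measurable borel \<longrightarrow> g \<in> borel_measurable borel \<longrightarrow> h \<in> borel_measurable borel \<longrightarrow>
      (\<forall>x. 0 \<le> g x \<and> g x \<le> R) \<longrightarrow> (\<forall>x. 0 \<le> h x \<and> h x \<le> R) \<longrightarrow>
      (\<forall>x y. norm (A x *v f y) \<le> op_norm (A x ** B y) * g y) \<longrightarrow>
      (\<forall>x v. h x * norm (A x *v v) \<le> R * norm v) \<longrightarrow> (\<forall>x. R < norm x \<longrightarrow> h x = 0) \<longrightarrow>
      (\<integral>\<^sup>+ x. ennreal (g x powr p) \<partial>lborel) \<le> 1 \<longrightarrow> (\<integral>\<^sup>+ x. ennreal (h x powr conj_exponent q) \<partial>lborel) \<le> 1 \<longrightarrow>
      (\<integral>\<^sup>+ x. (\<integral>\<^sup>+ y. ennreal (h x * norm (A x *v f y)) * ennreal (trunc_kernel \<alpha> n x y) \<partial>lborel) \<partial>lborel) \<le> ennreal C)"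

lemma bilinear_bound:
  fixes \<alpha> p q M :: real and A B :: "real^'d \<Rightarrow> complex^'n^'n"
  assumes al: "0 < \<alpha>" "\<alpha> < CARD('d)" and pq: "1 < p" "p \<le> q"
    and YF: "young_function \<Phi>" and YP: "young_function \<Psi>"
    and BF: "B_class2 p q (young_associate \<Phi>)" and BP: "B_class (conj_exponent q) (young_associate \<Psi>)"
    and A [measurable]: "A \<in> borel_measurable borel" and B [measurable]: "B \<in> borel_measurable borel"
    and M: "0 < M"
    and bump: "\<And>Q. Q \<in> cubes \<Longrightarrow> ennreal (measure lebesgue Q powr (\<alpha> / CARD('d) + 1 / q - 1 / p)) *
        orlicz_norm \<Psi> Q (\<lambda>x. orlicz_norm \<Phi> Q (\<lambda>y. ennreal (op_norm (A x ** B y)))) < ennreal M"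
  obtains C where "bilinear_estimate \<alpha> p q A B C"
proof -
  define q' where "q' = conj_exponent q"
  have q': "1 < q'" using pq by (simp add: q'_def conj_exponent_def field_simps)
  obtain c1 K1 where c1: "0 < c1" "young_associate \<Phi> c1 \<le> 1 / 2" "0 \<le> K1" and
    t1: "\<And>u. 0 < u \<Longrightarrow> (\<integral>\<^sup>+ t\<in>{t. 0 < t \<and> c1 < u * t}.
        ennreal (young_associate \<Phi> (u * t) powr (q / p) * t powr (- q - 1)) \<partial>lborel) \<le> ennreal (K1 * u powr q)"
    using young_associate_tail[OF YF _ pq(2) BF] pq(1) by auto
  have "B_class2 q' q' (young_associate \<Psi>)"
    using BP q' young_associate_nonneg[OF YP] by (simp add: B_class2_def B_class_def q'_def)
  then obtain c2 K2 where c2: "0 < c2" "young_associate \<Psi> c2 \<le> 1 / 2" "0 \<le> K2" and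
    t2: "\<And>u. 0 < u \<Longrightarrow> (\<integral>\<^sup>+ t\<in>{t. 0 < t \<and> c2 < u * t}.
        ennreal (young_associate \<Psi> (u * t) powr (q' / q') * t powr (- q' - 1)) \<partial>lborel) \<le> ennreal (K2 * u powr q')"
    using young_associate_tail[OF YP, of q' q'] q' by auto
  define C0 where "C0 = max 0 (bilinear_const TYPE('d) TYPE(complex^'n) \<alpha> p q M K1 K2)"
  define b where "b = 2 powr (CARD('d) - \<alpha>)"
  show ?thesis
  proof (rule that[of "b * C0"], unfold bilinear_estimate_def, intro conjI allI impI)
    show "0 \<le> b * C0" by (simp add: b_def C0_def)
    fix n R f g h
    assume f [measurable]: "f \<in> borel_measurable borel" and g [measurable]: "g \<in> borel_measurable borel"
      and h [measurable]: "h \<in> borel_measurable borel"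
      and gR': "\<forall>x. 0 \<le> g x \<and> g x \<le> R" and hR': "\<forall>x. 0 \<le> h x \<and> h x \<le> R"
      and dom': "\<forall>x y. norm (A x *v f y) \<le> op_norm (A x ** B y) * g y"
      and bd': "\<forall>x v. h x * norm (A x *v v) \<le> R * norm v" and supp': "\<forall>x. R < norm x \<longrightarrow> h x = 0"
      and gn: "(\<integral>\<^sup>+ x. ennreal (g x powr p) \<partial>lborel) \<le> 1"
      and hn: "(\<integral>\<^sup>+ x. ennreal (h x powr conj_exponent q) \<partial>lborel) \<le> 1"
    note gR = gR'[rule_format] and hR = hR'[rule_format] and dom = dom'[rule_format]
      and bd = bd'[rule_format] and supp = supp'[rule_format]
    interpret bilinear_setting "2 ^ n" \<alpha> p q M c1 K1 c2 K2 R \<Phi> \<Psi> "\<lambda>x y. op_norm (A x ** B y)"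
      "\<lambda>x v. h x * norm (A x *v v)" f g h
    proof
      show "seminorm (\<lambda>v. h x * norm (A x *v v))" for x
        unfolding seminorm_def
      proof (intro conjI allI)
        fix u v and c :: real
        show "h x * norm (A x *v (u + v)) \<le> h x * norm (A x *v u) + h x * norm (A x *v v)"
          unfolding matrix_vector_right_distrib distrib_left[symmetric]
          using hR[of x] by (intro mult_left_mono norm_triangle_ineq) auto
        show "h x * norm (A x *v (c *\<^sub>R v)) = \<bar>c\<bar> * (h x * norm (A x *v v))"
          using linear_cmul[OF bounded_linear.linear[OF matrix_vector_mul_bounded_linear], of "A x" c v] by simp
      qed
      show "h x * norm (A x *v f y) \<le> h x * op_norm (A x ** B y) * g y" for x y
        using mult_left_mono[OF dom[of x y], of "h x"] hR[of x] by (simp add: mult.assoc)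
      show "0 \<le> op_norm (A x ** B y)" for x y by (rule op_norm_nonneg)
      show "(\<lambda>(x, y). op_norm (A x ** B y)) \<in> borel_measurable (borel \<Otimes>\<^sub>M borel)" by measurable
      show "(\<lambda>x. h x * norm (A x *v v)) \<in> borel_measurable borel" for v by measurable
      show "(\<lambda>(x, y). h x * norm (A x *v f y)) \<in> borel_measurable (borel \<Otimes>\<^sub>M borel)" by measurable
    qed (use al pq YF YP c1 c2 M bump f g h gR hR bd supp gn hn t1 t2 in \<open>auto simp: q'_def\<close>)
    have "(\<integral>\<^sup>+ x. (\<integral>\<^sup>+ y. ennreal (h x * norm (A x *v f y)) * ennreal (trunc_kernel \<alpha> n x y) \<partial>lborel) \<partial>lborel)
        \<le> (\<integral>\<^sup>+ x. (\<integral>\<^sup>+ y. ennreal b * (ennreal (h x * norm (A x *v f y)) *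
            (\<Sum>j\<le>2*n. ennreal (side j powr (\<alpha> - CARD('d))) * indicator (nbhd j (cidx j x)) y)) \<partial>lborel) \<partial>lborel)"
    proof (intro nn_integral_mono)
      fix x y :: "real^'d"
      have s: "side (2 * n) = 1 / 2 ^ n"
        by (simp add: side_def mult_2 power_add)
      have "trunc_kernel \<alpha> n x y \<le> b * (\<Sum>j\<le>2*n. side j powr (\<alpha> - CARD('d)) * indicator (nbhd j (cidx j x)) y)"
      proof (cases "norm (x - y) \<in> {1 / 2 ^ n..2 ^ n}")
        case True
        then show ?thesis
          using kernel_le_dyadic[OF al(2), of "2 * n" x y] by (simp add: trunc_kernel_def b_def s)
      next
        case False
        then have "trunc_kernel \<alpha> n x y = 0" by (simp add: trunc_kernel_def)
        moreover have "0 \<le> b * (\<Sum>j\<le>2*n. side j powr (\<alpha> - CARD('d)) * indicator (nbhd j (cidx j x)) y)"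
          by (intro mult_nonneg_nonneg sum_nonneg) (auto simp: b_def)
        ultimately show ?thesis by simp
      qed
      then have "ennreal (trunc_kernel \<alpha> n x y) \<le> ennreal (b * (\<Sum>j\<le>2*n. side j powr (\<alpha> - CARD('d)) * indicator (nbhd j (cidx j x)) y))"
        by (rule ennreal_leI)
      also have "\<dots> = ennreal b * (\<Sum>j\<le>2*n. ennreal (side j powr (\<alpha> - CARD('d)) * indicator (nbhd j (cidx j x)) y))"
        by (subst ennreal_mult) (auto simp: b_def intro!: sum_nonneg)
      also have "\<dots> = ennreal b * (\<Sum>j\<le>2*n. ennreal (side j powr (\<alpha> - CARD('d))) * indicator (nbhd j (cidx j x)) y)"
        by (intro arg_cong2[where f = "(*)"] refl sum.cong) (auto simp: ennreal_mult indicator_def)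
      finally show "ennreal (h x * norm (A x *v f y)) * ennreal (trunc_kernel \<alpha> n x y) \<le>
          ennreal b * (ennreal (h x * norm (A x *v f y)) *
            (\<Sum>j\<le>2*n. ennreal (side j powr (\<alpha> - CARD('d))) * indicator (nbhd j (cidx j x)) y))"
        unfolding mult.left_commute[of "ennreal b"] by (rule mult_left_mono) simp
    qed
    also have "\<dots> = ennreal b * (\<integral>\<^sup>+ x. (\<integral>\<^sup>+ y. ennreal (h x * norm (A x *v f y)) *
            (\<Sum>j\<le>2*n. ennreal (side j powr (\<alpha> - CARD('d))) * indicator (nbhd j (cidx j x)) y) \<partial>lborel) \<partial>lborel)"
    proof -
      have m: "(\<lambda>(x, y). ennreal (h x * norm (A x *v f y)) *
            (\<Sum>j\<le>2*n. ennreal (side j powr (\<alpha> - CARD('d))) * indicator (nbhd j (cidx j x)) y)) \<in> borel_measurable (lborel \<Otimes>\<^sub>M lborel)"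
        by measurable
      show ?thesis by (rule nn_integral_pair_cmult[OF m])
    qed
    also have "\<dots> \<le> ennreal b * ennreal (bilinear_const TYPE('d) TYPE(complex^'n) \<alpha> p q M K1 K2)"
      by (intro mult_left_mono discretized_bound) simp
    also have "\<dots> \<le> ennreal b * ennreal C0"
      by (intro mult_left_mono ennreal_leI) (auto simp: C0_def)
    also have "\<dots> = ennreal (b * C0)"
      by (simp add: ennreal_mult b_def C0_def)
    finally show "(\<integral>\<^sup>+ x. (\<integral>\<^sup>+ y. ennreal (h x * norm (A x *v f y)) * ennreal (trunc_kernel \<alpha> n x y) \<partial>lborel) \<partial>lborel) \<le> ennreal (b * C0)" .
  qed
qed

section \<open>Duality\<close>

text \<open>Majorizes \<open>norm (A x *v riesz_potential \<alpha> f x)\<close>, and for invertible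
  \<open>A x\<close> its finiteness makes the defining integral converge. With values in
  \<open>ennreal\<close> it presupposes no integrability.\<close>

definition fractional_size :: "real \<Rightarrow> (real^'d \<Rightarrow> complex^'n^'n) \<Rightarrow> (real^'d \<Rightarrow> complex^'n) \<Rightarrow> real^'d \<Rightarrow> ennreal" where
  "fractional_size \<alpha> A f x = (\<integral>\<^sup>+ y. ennreal (norm (A x *v f y)) * ennreal (norm (x - y) powr (\<alpha> - CARD('d))) \<partial>lborel)"

lemma trunc_kernel_mono: "n \<le> m \<Longrightarrow> trunc_kernel \<alpha> n x y \<le> trunc_kernel \<alpha> m x y"
proof -
  assume nm: "n \<le> m"
  have a: "(1 :: real) / 2 ^ m \<le> 1 / 2 ^ n" "(2 :: real) ^ n \<le> 2 ^ m"
    using nm by (auto intro!: divide_left_mono power_increasing)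
  have "(indicator {1 / 2 ^ n..2 ^ n} r :: real) \<le> indicator {1 / 2 ^ m..2 ^ m} r" for r :: real
    by (auto simp: indicator_def intro: order_trans[OF a(1)] order_trans[OF _ a(2)])
  then show ?thesis unfolding trunc_kernel_def by (intro mult_left_mono) auto
qed

text \<open>On the diagonal both sides are 0, since \<open>0 powr a = 0\<close>; elsewhere the radii
  eventually enclose the distance.\<close>

lemma trunc_kernel_eventually:
  fixes x y :: "real^'d"
  shows "eventually (\<lambda>n. trunc_kernel \<alpha> n x y = norm (x - y) powr (\<alpha> - CARD('d))) sequentially"
proof (cases "x = y")
  case True
  then show ?thesis by (simp add: trunc_kernel_def)
next
  case False
  define r where "r = norm (x - y)"
  have r: "0 < r" using False by (simp add: r_def)
  have "eventually (\<lambda>n. r < 2 ^ n) sequentially" "eventually (\<lambda>n. 1 / r < 2 ^ n) sequentially"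
    using filterlim_realpow_sequentially_gt1[of "2 :: real"] by (auto simp: filterlim_at_infinity_conv_norm_at_top filterlim_at_top_dense)
  then show ?thesis
  proof eventually_elim
    case (elim n)
    then show ?case using r by (simp add: trunc_kernel_def r_def[symmetric] field_simps)
  qed
qed

lemma borel_measurable_trunc_kernel [measurable]:
  "(\<lambda>(x, y). trunc_kernel \<alpha> n (x :: real^'d) y) \<in> borel_measurable (borel \<Otimes>\<^sub>M borel)"
  unfolding trunc_kernel_def by measurable

text \<open>A finite limit passes through \<open>enn2real\<close> and the power by continuity. An
  infinite one is separate because \<open>enn2real\<close> sends it to 0: there a finite
  \<open>Z\<close> would bound the whole sequence.\<close>

lemma ennreal_tendsto_top_or_real:
  fixes m :: "nat \<Rightarrow> ennreal" and t :: "nat \<Rightarrow> real" and T :: ennreal and Z :: ennreal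
  assumes m: "m \<longlonglongrightarrow> T" and t: "eventually (\<lambda>n. t n = enn2real (m n)) sequentially"
    and fin: "\<And>n. m n < \<infinity>" and Z: "\<And>n. ennreal (t n powr q) \<le> Z" and q: "0 < q"
  shows "T < \<infinity> \<Longrightarrow> ennreal (enn2real T powr q) \<le> Z" "T = \<infinity> \<Longrightarrow> Z = \<infinity>"
proof -
  assume T: "T < \<infinity>"
  have "(\<lambda>n. enn2real (m n)) \<longlonglongrightarrow> enn2real T"
    using tendsto_enn2real[of m "enn2real T" sequentially] m T by simp
  then have "t \<longlonglongrightarrow> enn2real T"
    using t by (rule Lim_transform_eventually[OF _ eventually_mono]) simp
  moreover have "eventually (\<lambda>n. 0 \<le> t n) sequentially"
    using t by (rule eventually_mono) simp
  ultimately have "(\<lambda>n. t n powr q) \<longlonglongrightarrow> enn2real T powr q"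
    using q by (intro tendsto_powr') auto
  then have "(\<lambda>n. ennreal (t n powr q)) \<longlonglongrightarrow> ennreal (enn2real T powr q)"
    by (rule tendsto_ennrealI)
  then show "ennreal (enn2real T powr q) \<le> Z"
    by (rule LIMSEQ_le_const2) (use Z in auto)
next
  assume T: "T = \<infinity>"
  show "Z = \<infinity>"
  proof (rule ccontr)
    assume "Z \<noteq> \<infinity>"
    then obtain z where z: "Z = ennreal z" "0 \<le> z" by (cases Z) auto
    have "eventually (\<lambda>n. m n \<le> ennreal (z powr (1 / q))) sequentially"
      using t
    proof eventually_elim
      case (elim n)
      have "t n powr q \<le> z" using Z[of n] z by (simp add: ennreal_le_iff)
      then have "(t n powr q) powr (1 / q) \<le> z powr (1 / q)" using q by (intro powr_mono2) auto
      then have "t n \<le> z powr (1 / q)" using q elim by (simp add: powr_powr)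
      then show ?case using elim fin[of n] by (metis ennreal_enn2real ennreal_leI infinity_ennreal_def)
    qed
    then have "T \<le> ennreal (z powr (1 / q))"
      using tendsto_upperbound[OF m] by simp
    then show False using T by (simp add: top_unique)
  qed
qed

text \<open>The duality argument: the truncation of \<open>fractional_size\<close>, raised to the power \<open>q - 1\<close>, is used
  as test function, and is then absorbed because all truncated quantities are finite.\<close>

lemma strong_bound:
  fixes \<alpha> p q C :: real and A B :: "real^'d \<Rightarrow> complex^'n^'n"
    and f :: "real^'d \<Rightarrow> complex^'n" and g :: "real^'d \<Rightarrow> real"
  assumes q: "1 < q" and est: "bilinear_estimate \<alpha> p q A B C"
    and A [measurable]: "A \<in> borel_measurable borel"
    and f [measurable]: "f \<in> borel_measurable borel"
    and g [measurable]: "g \<in> borel_measurable borel" and g0: "\<And>y. 0 \<le> g y"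
    and dom: "\<And>x y. norm (A x *v f y) \<le> op_norm (A x ** B y) * g y"
    and gn: "(\<integral>\<^sup>+ x. ennreal (g x powr p) \<partial>lborel) \<le> 1" and p: "0 < p"
  obtains Z where "Z \<in> borel_measurable borel" "(\<integral>\<^sup>+ x. Z x \<partial>lborel) \<le> ennreal (C powr q)"
    "\<And>x. fractional_size \<alpha> A f x < \<infinity> \<Longrightarrow> ennreal (enn2real (fractional_size \<alpha> A f x) powr q) \<le> Z x"
    "\<And>x. fractional_size \<alpha> A f x = \<infinity> \<Longrightarrow> Z x = \<infinity>"
proof -
  note C = est[unfolded bilinear_estimate_def, THEN conjunct1]
    and bil = est[unfolded bilinear_estimate_def, THEN conjunct2, rule_format]
  define q' where "q' = conj_exponent q"
  have q': "1 < q'" "(q - 1) * q' = q" "1 - 1 / q' = 1 / q"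
    using q by (simp_all add: q'_def conj_exponent_def field_simps)
  \<comment> \<open>Support of the test function; the bounds on \<open>x\<close> and
    \<open>A x\<close> are what the boundedness clauses of \<open>bilinear_estimate\<close> ask
    for.\<close>
  define E where "E n = {x :: real^'d. norm x \<le> real n \<and> op_norm (A x) \<le> real n}" for n
  have E [measurable]: "E n \<in> sets borel" for n unfolding E_def by measurable
  \<comment> \<open>Cutting \<open>f\<close> and \<open>g\<close> on the same set preserves the
    domination \<open>dom\<close>.\<close>
  define fn where "fn n y = (if g y \<le> real n then f y else 0)" for n :: nat and y
  define gn' where "gn' n y = (if g y \<le> real n then g y else 0)" for n :: nat and y
  have fn [measurable]: "fn n \<in> borel_measurable borel" and gn'm [measurable]: "gn' n \<in> borel_measurable borel" for n
    unfolding fn_def[abs_def] gn'_def[abs_def] by measurable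
  define Tn where "Tn n x = (\<integral>\<^sup>+ y. ennreal (norm (A x *v fn n y)) * ennreal (trunc_kernel \<alpha> n x y) \<partial>lborel)" for n x
  have integrand_m [measurable]: "(\<lambda>(x, y). ennreal (norm (A x *v fn n y)) * ennreal (trunc_kernel \<alpha> n x y)) \<in> borel_measurable (borel \<Otimes>\<^sub>M borel)" for n
    by measurable
  have Tnm [measurable]: "Tn n \<in> borel_measurable borel" for n
    unfolding Tn_def[abs_def] by measurable
  \<comment> \<open>The cap at \<open>n\<close> makes the norm that is to be absorbed finite
    beforehand.\<close>
  define mn where "mn n x = min (Tn n x) (ennreal (real n))" for n x
  have mn_fin: "mn n x < \<infinity>" for n x by (simp add: mn_def min_less_iff_disj)
  define tau where "tau n x = enn2real (mn n x) * indicator (E n) x" for n x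
  have taum [measurable]: "tau n \<in> borel_measurable borel" for n
    unfolding tau_def[abs_def] mn_def by measurable
  have tau0: "0 \<le> tau n x" for n x by (simp add: tau_def)
  have tau_le: "tau n x \<le> real n" for n x
  proof -
    have "enn2real (mn n x) \<le> enn2real (ennreal (real n))" unfolding mn_def by (intro enn2real_mono) auto
    then show ?thesis by (simp add: tau_def indicator_def)
  qed
  have tau_Tn: "ennreal (tau n x) \<le> Tn n x" for n x
    using mn_fin[of n x] by (simp add: tau_def indicator_def) (simp add: mn_def)
  have tau_out: "tau n x = 0" if "x \<notin> E n" for n x using that by (simp add: tau_def)

  have bound: "(\<integral>\<^sup>+ x. ennreal (tau n x powr q) \<partial>lborel) \<le> ennreal (C powr q)" for n
  proof -
    have "(\<integral>\<^sup>+ x. ennreal (tau n x powr q) \<partial>lborel) \<le> (\<integral>\<^sup>+ x. ennreal (real n powr q) * indicator (cball (0 :: real^'d) (real n)) x \<partial>lborel)"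
    proof (rule nn_integral_mono)
      fix x :: "real^'d"
      show "ennreal (tau n x powr q) \<le> ennreal (real n powr q) * indicator (cball (0 :: real^'d) (real n)) x"
      proof (cases "x \<in> E n")
        case True
        then show ?thesis using tau0 tau_le q by (simp add: E_def) (intro ennreal_leI powr_mono2, auto)
      qed (simp add: tau_out)
    qed
    also have "\<dots> = ennreal (real n powr q) * emeasure lborel (cball (0 :: real^'d) (real n))"
      by (rule nn_integral_cmult_indicator) simp
    also have "\<dots> < \<infinity>" using emeasure_lborel_cball_finite[of "0 :: real^'d" "real n"] by (simp add: ennreal_mult_less_top)
    finally have fin: "(\<integral>\<^sup>+ x. ennreal (tau n x powr q) \<partial>lborel) < \<infinity>" .
    define Y where "Y = enn2real (\<integral>\<^sup>+ x. ennreal (tau n x powr q) \<partial>lborel)"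
    have Y: "(\<integral>\<^sup>+ x. ennreal (tau n x powr q) \<partial>lborel) = ennreal Y" "0 \<le> Y" using fin by (simp_all add: Y_def)
    show ?thesis
    proof (cases "Y = 0")
      case False
      then have Yp: "0 < Y" using Y(2) by simp
      \<comment> \<open>Normalizes the test function: as \<open>(q - 1) * q' = q\<close>, the power
        \<open>h x powr q'\<close> is \<open>tau n x powr q\<close> divided by
        \<open>Y\<close>.\<close>
      define c where "c = 1 / Y powr (1 / q')"
      have c: "0 < c" using Yp by (simp add: c_def)
      define h where "h x = tau n x powr (q - 1) * c" for x
      define Hb where "Hb = real n powr (q - 1) * c"
      \<comment> \<open>One number above the bounds for \<open>g\<close>, for \<open>h\<close> and
        for \<open>h x * norm (A x *v v)\<close>; the part \<open>real n\<close> also covers the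
        support.\<close>
      define R where "R = real n + Hb + Hb * real n"
      have hm: "h \<in> borel_measurable borel" unfolding h_def[abs_def] by measurable
      have Hb: "0 \<le> Hb" using c by (simp add: Hb_def)
      have h: "0 \<le> h x" "h x \<le> Hb" for x
        using c tau0 tau_le q by (auto simp: h_def Hb_def intro!: mult_right_mono powr_mono2)
      have R: "real n \<le> R" "Hb \<le> R" "Hb * real n \<le> R" using Hb by (simp_all add: R_def)
      have h_out: "h x = 0" if "x \<notin> E n" for x using tau_out[OF that] q by (simp add: h_def)
      have "(\<integral>\<^sup>+ x. (\<integral>\<^sup>+ y. ennreal (h x * norm (A x *v fn n y)) * ennreal (trunc_kernel \<alpha> n x y) \<partial>lborel) \<partial>lborel) \<le> ennreal C"
      proof (rule bil[OF fn gn'm hm, where R = R])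
        show "0 \<le> gn' n x \<and> gn' n x \<le> R" for x using g0[of x] R(1) by (cases "g x \<le> real n") (auto simp: gn'_def)
        show "0 \<le> h x \<and> h x \<le> R" for x using h[of x] R by linarith
        show "norm (A x *v fn n y) \<le> op_norm (A x ** B y) * gn' n y" for x y
          using dom[of x y] by (simp add: fn_def gn'_def)
        show "h x * norm (A x *v v) \<le> R * norm v" for x v
        proof (cases "x \<in> E n")
          case True
          have "norm (A x *v v) \<le> real n * norm v"
            using op_norm_bound[of "A x" v] True mult_right_mono[of "op_norm (A x)" "real n" "norm v"] by (simp add: E_def)
          then have "h x * norm (A x *v v) \<le> Hb * (real n * norm v)"
            using h[of x] Hb by (intro mult_mono) auto
          also have "\<dots> \<le> R * norm v" using mult_right_mono[OF R(3), of "norm v"] by (simp add: mult.assoc)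
          finally show ?thesis .
        qed (use h_out R Hb in \<open>simp add: R_def\<close>)
        show "h x = 0" if "R < norm x" for x
          using that R by (intro h_out) (auto simp: E_def)
        have "(\<integral>\<^sup>+ x. ennreal (gn' n x powr p) \<partial>lborel) \<le> (\<integral>\<^sup>+ x. ennreal (g x powr p) \<partial>lborel)"
          by (intro nn_integral_mono ennreal_leI) (simp add: gn'_def)
        then show "(\<integral>\<^sup>+ x. ennreal (gn' n x powr p) \<partial>lborel) \<le> 1" using gn by (rule order_trans)
        have "ennreal (h x powr q') = ennreal (1 / Y) * ennreal (tau n x powr q)" for x
        proof -
          have "h x powr q' = (tau n x powr (q - 1)) powr q' * c powr q'"
            using c by (simp add: h_def powr_mult)
          also have "\<dots> = tau n x powr q * (1 / Y)"
            using q' Yp by (simp add: powr_powr c_def powr_divide)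
          finally show ?thesis using Yp by (simp add: ennreal_mult[symmetric] mult.commute)
        qed
        then have "(\<integral>\<^sup>+ x. ennreal (h x powr q') \<partial>lborel) = ennreal (1 / Y) * ennreal Y"
          by (simp add: nn_integral_cmult Y(1))
        also have "\<dots> = 1" using Yp by (simp add: ennreal_mult[symmetric])
        finally show "(\<integral>\<^sup>+ x. ennreal (h x powr conj_exponent q) \<partial>lborel) \<le> 1" by (simp add: q'_def)
      qed
      also have "(\<integral>\<^sup>+ x. (\<integral>\<^sup>+ y. ennreal (h x * norm (A x *v fn n y)) * ennreal (trunc_kernel \<alpha> n x y) \<partial>lborel) \<partial>lborel)
          = (\<integral>\<^sup>+ x. ennreal (h x) * Tn n x \<partial>lborel)"
      proof (rule nn_integral_cong)
        fix x
        have "(\<integral>\<^sup>+ y. ennreal (h x * norm (A x *v fn n y)) * ennreal (trunc_kernel \<alpha> n x y) \<partial>lborel)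
            = (\<integral>\<^sup>+ y. ennreal (h x) * (ennreal (norm (A x *v fn n y)) * ennreal (trunc_kernel \<alpha> n x y)) \<partial>lborel)"
          using h by (intro nn_integral_cong) (simp add: ennreal_mult mult.assoc)
        also have "\<dots> = ennreal (h x) * Tn n x"
          unfolding Tn_def by (rule nn_integral_cmult) measurable
        finally show "(\<integral>\<^sup>+ y. ennreal (h x * norm (A x *v fn n y)) * ennreal (trunc_kernel \<alpha> n x y) \<partial>lborel) = ennreal (h x) * Tn n x" .
      qed
      finally have le: "(\<integral>\<^sup>+ x. ennreal (h x) * Tn n x \<partial>lborel) \<le> ennreal C" .
      have "ennreal c * ennreal Y = (\<integral>\<^sup>+ x. ennreal c * ennreal (tau n x powr q) \<partial>lborel)"
        by (simp add: nn_integral_cmult Y(1))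
      also have "\<dots> \<le> (\<integral>\<^sup>+ x. ennreal (h x) * Tn n x \<partial>lborel)"
      proof (rule nn_integral_mono)
        fix x
        have "tau n x powr q = tau n x powr (q - 1) * tau n x"
        proof (cases "tau n x = 0")
          case False
          then have "0 < tau n x" using tau0[of n x] by simp
          then show ?thesis by (simp add: powr_diff)
        qed simp
        then have "ennreal c * ennreal (tau n x powr q) = ennreal (h x) * ennreal (tau n x)"
          using c tau0[of n x] by (simp add: h_def ennreal_mult[symmetric] mult_ac)
        also have "\<dots> \<le> ennreal (h x) * Tn n x" by (intro mult_left_mono tau_Tn) simp
        finally show "ennreal c * ennreal (tau n x powr q) \<le> ennreal (h x) * Tn n x" .
      qed
      also note le
      finally have "c * Y \<le> C" using c Yp C by (simp add: ennreal_mult[symmetric] ennreal_le_iff)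
      \<comment> \<open>Absorption: \<open>c * Y\<close> is the \<open>q\<close>-norm of
        \<open>tau n\<close>, so that norm is at most \<open>C\<close> for every
        \<open>n\<close>.\<close>
      moreover have "c * Y = Y powr (1 / q)"
        using Yp q'(3) powr_diff[of Y 1 "1 / q'"] by (simp add: c_def)
      ultimately have "(Y powr (1 / q)) powr q \<le> C powr q" using q by (intro powr_mono2) auto
      then show ?thesis using Yp q Y by (simp add: powr_powr ennreal_leI)
    qed (simp add: Y)
  qed

  have fn_mono: "norm (A x *v fn n y) \<le> norm (A x *v fn m y)" if "n \<le> m" for n m x y
    using that by (auto simp: fn_def)
  have Tn_mono: "Tn n x \<le> Tn m x" if "n \<le> m" for n m x
    unfolding Tn_def using that
    by (intro nn_integral_mono mult_mono ennreal_leI fn_mono trunc_kernel_mono) auto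
  have tau_mono: "tau n x \<le> tau m x" if "n \<le> m" for n m x
  proof (cases "x \<in> E n")
    case True
    then have "x \<in> E m" using that by (auto simp: E_def)
    moreover have "mn n x \<le> mn m x"
      unfolding mn_def using that by (intro min.mono Tn_mono ennreal_leI) auto
    then have "enn2real (mn n x) \<le> enn2real (mn m x)" using mn_fin[of m x] by (intro enn2real_mono) auto
    ultimately show ?thesis using True by (simp add: tau_def)
  qed (simp add: tau_out tau0)
  have lim: "(\<lambda>n. Tn n x) \<longlonglongrightarrow> fractional_size \<alpha> A f x" for x
    unfolding Tn_def fractional_size_def
  proof (rule nn_integral_LIMSEQ)
    show "incseq (\<lambda>n y. ennreal (norm (A x *v fn n y)) * ennreal (trunc_kernel \<alpha> n x y))"
      unfolding incseq_def le_fun_def by (intro allI impI mult_mono ennreal_leI fn_mono trunc_kernel_mono) auto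
    show "(\<lambda>y. ennreal (norm (A x *v fn n y)) * ennreal (trunc_kernel \<alpha> n x y)) \<in> borel_measurable lborel" for n
      by measurable
    fix y
    have "eventually (\<lambda>n. g y \<le> real n) sequentially"
      using filterlim_real_sequentially by (auto simp: filterlim_at_top)
    with trunc_kernel_eventually[of \<alpha> x y]
    have "eventually (\<lambda>n. ennreal (norm (A x *v fn n y)) * ennreal (trunc_kernel \<alpha> n x y)
        = ennreal (norm (A x *v f y)) * ennreal (norm (x - y) powr (\<alpha> - CARD('d)))) sequentially"
      by eventually_elim (simp add: fn_def)
    then show "(\<lambda>n. ennreal (norm (A x *v fn n y)) * ennreal (trunc_kernel \<alpha> n x y)) \<longlonglongrightarrow>
        ennreal (norm (A x *v f y)) * ennreal (norm (x - y) powr (\<alpha> - CARD('d)))"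
      by (rule tendsto_eventually)
  qed
  \<comment> \<open>A measurable majorant for the \<open>q\<close>-th power of
    \<open>fractional_size\<close>. It is infinite wherever the latter is, so its finite integral
    yields finiteness almost everywhere.\<close>
  define Z where "Z x = (SUP n. ennreal (tau n x powr q))" for x
  have incs: "incseq (\<lambda>n x. ennreal (tau n x powr q))"
    unfolding incseq_def le_fun_def using q tau0 tau_mono by (intro allI impI ennreal_leI powr_mono2) auto
  show ?thesis
  proof (rule that[of Z])
    show "Z \<in> borel_measurable borel" unfolding Z_def[abs_def] by measurable
    have "(\<integral>\<^sup>+ x. Z x \<partial>lborel) = (SUP n. \<integral>\<^sup>+ x. ennreal (tau n x powr q) \<partial>lborel)"
      unfolding Z_def by (rule nn_integral_monotone_convergence_SUP[OF incs]) measurable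
    also have "\<dots> \<le> ennreal (C powr q)" by (intro SUP_least bound)
    finally show "(\<integral>\<^sup>+ x. Z x \<partial>lborel) \<le> ennreal (C powr q)" .
    fix x
    have "(\<lambda>n. mn n x) \<longlonglongrightarrow> min (fractional_size \<alpha> A f x) \<infinity>"
      unfolding mn_def
    proof (rule tendsto_min[OF lim])
      show "(\<lambda>n. ennreal (real n)) \<longlonglongrightarrow> \<infinity>"
        using of_nat_tendsto_top_ennreal by (simp add: ennreal_of_nat_eq_real_of_nat)
    qed
    then have ml: "(\<lambda>n. mn n x) \<longlonglongrightarrow> fractional_size \<alpha> A f x" by simp
    have "eventually (\<lambda>n. norm x \<le> real n) sequentially" "eventually (\<lambda>n. op_norm (A x) \<le> real n) sequentially"
      using filterlim_real_sequentially by (auto simp: filterlim_at_top)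
    then have ev: "eventually (\<lambda>n. tau n x = enn2real (mn n x)) sequentially"
      by eventually_elim (simp add: tau_def E_def)
    have ZU: "ennreal (tau n x powr q) \<le> Z x" for n unfolding Z_def by (rule SUP_upper) simp
    have "0 < q" using q by simp
    note * = ennreal_tendsto_top_or_real[OF ml ev mn_fin ZU this]
    show "fractional_size \<alpha> A f x < \<infinity> \<Longrightarrow> ennreal (enn2real (fractional_size \<alpha> A f x) powr q) \<le> Z x"
      "fractional_size \<alpha> A f x = \<infinity> \<Longrightarrow> Z x = \<infinity>"
      using * by blast+
  qed
qed

section \<open>Borel versions\<close>

text \<open>Each real coordinate has a Borel version, and the finitely many exceptional null sets
  can be united.\<close>

lemma lebesgue_borel_version:
  fixes f :: "'a::euclidean_space \<Rightarrow> 'b::euclidean_space"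
  assumes f: "f \<in> borel_measurable lebesgue"
  obtains g where "g \<in> borel_measurable borel" "AE x in lborel. f x = g x"
proof -
  have "\<exists>g'\<in>borel_measurable lborel. AE x in lborel. f x \<bullet> b = g' x" for b
  proof (rule completion_ex_borel_measurable_real)
    show "(\<lambda>x. f x \<bullet> b) \<in> borel_measurable lebesgue"
      by (intro borel_measurable_inner f borel_measurable_const)
  qed
  then obtain g' where g': "\<And>b. g' b \<in> borel_measurable lborel" "\<And>b. AE x in lborel. f x \<bullet> b = g' b x"
    by metis
  show ?thesis
  proof (rule that[of "\<lambda>x. \<Sum>b\<in>Basis. g' b x *\<^sub>R b"])
    show "(\<lambda>x. \<Sum>b\<in>Basis. g' b x *\<^sub>R b) \<in> borel_measurable borel"
      using g'(1) by (intro borel_measurable_sum borel_measurable_scaleR) auto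
    have "AE x in lborel. \<forall>b\<in>Basis. f x \<bullet> b = g' b x"
      by (rule AE_finite_allI[OF finite_Basis g'(2)])
    then show "AE x in lborel. f x = (\<Sum>b\<in>Basis. g' b x *\<^sub>R b)"
    proof eventually_elim
      case (elim x)
      have "f x = (\<Sum>b\<in>Basis. (f x \<bullet> b) *\<^sub>R b)" by (simp add: euclidean_representation)
      then show ?case using elim by simp
    qed
  qed
qed

lemma borel_measurable_vecI:
  fixes f :: "'a \<Rightarrow> 'b::euclidean_space ^ 'n"
  assumes "\<And>i. (\<lambda>x. f x $ i) \<in> borel_measurable M"
  shows "f \<in> borel_measurable M"
  unfolding borel_measurable_euclidean_space[of f]
proof
  fix b :: "'b ^ 'n" assume "b \<in> Basis"
  then obtain i u where "b = axis i u" by (auto simp: Basis_vec_def)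
  then have eq: "(\<lambda>x. f x \<bullet> b) = (\<lambda>x. f x $ i \<bullet> u)" by (simp add: inner_axis)
  show "(\<lambda>x. f x \<bullet> b) \<in> borel_measurable M"
    unfolding eq by (rule borel_measurable_inner[OF assms borel_measurable_const])
qed

text \<open>Integrability on balls gives measurability of the cut-offs, which converge pointwise as
  the balls exhaust the space.\<close>

lemma locally_integrable_measurable:
  assumes "locally_integrable (f :: real^'d \<Rightarrow> complex)"
  shows "f \<in> borel_measurable lebesgue"
proof (rule borel_measurable_LIMSEQ_metric)
  show "(\<lambda>x. indicat_real (cball 0 (real n)) x *\<^sub>R f x) \<in> borel_measurable lebesgue" for n
  proof -
    have "f absolutely_integrable_on cball 0 (real n)"
      using assms compact_cball[of "0 :: real^'d" "real n"] unfolding locally_integrable_def by blast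
    then show ?thesis unfolding set_integrable_def by (rule borel_measurable_integrable)
  qed
  show "(\<lambda>n. indicat_real (cball 0 (real n)) x *\<^sub>R f x) \<longlonglongrightarrow> f x" for x
  proof (rule tendsto_eventually)
    have "eventually (\<lambda>n. norm x \<le> real n) sequentially"
      using filterlim_real_sequentially by (auto simp: filterlim_at_top)
    then show "eventually (\<lambda>n. indicat_real (cball 0 (real n)) x *\<^sub>R f x = f x) sequentially"
      by eventually_elim simp
  qed
qed

lemma positive_definite_mat_1: "positive_definite (mat 1 :: complex^'n^'n)"
proof -
  have "adjoint_matrix (mat 1 :: complex^'n^'n) = mat 1"
    by (simp add: adjoint_matrix_def mat_def vec_eq_iff)
  then show ?thesis
    unfolding positive_definite_def self_adjoint_def matrix_vector_mul_lid by simp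
qed

text \<open>Putting \<open>mat 1\<close> on a Borel null set that contains all exceptional points
  makes the weight positive definite everywhere, as \<open>borel_measurable_matrix_powr\<close>
  requires.\<close>

lemma matrix_weight_borel_version:
  fixes U :: "real^'d \<Rightarrow> complex^'n^'n"
  assumes U: "matrix_weight U"
  obtains U1 where "U1 \<in> borel_measurable borel" "\<And>x. positive_definite (U1 x)" "AE x in lborel. U x = U1 x"
proof -
  have "U \<in> borel_measurable lebesgue"
    using U by (intro borel_measurable_vecI locally_integrable_measurable) (simp add: matrix_weight_def)
  then obtain U0 where U0: "U0 \<in> borel_measurable borel" "AE x in lborel. U x = U0 x"
    by (rule lebesgue_borel_version)
  have "AE x in lborel. positive_definite (U x)"
    using U unfolding matrix_weight_def AE_completion_iff by blast
  with U0(2) have ae: "AE x in lborel. U x = U0 x \<and> positive_definite (U0 x)"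
    by eventually_elim simp
  then obtain N where N: "N \<in> null_sets lborel" "{x. \<not> (U x = U0 x \<and> positive_definite (U0 x))} \<subseteq> N"
    using ae[unfolded eventually_ae_filter] by auto
  show ?thesis
  proof (rule that[of "\<lambda>x. if x \<in> N then mat 1 else U0 x"])
    show "(\<lambda>x. if x \<in> N then mat 1 else U0 x) \<in> borel_measurable borel"
      using N(1) U0(1) by (intro measurable_If_set) auto
    show "positive_definite (if x \<in> N then mat 1 else U0 x)" for x
      using N(2) by (auto simp: positive_definite_mat_1)
    have "AE x in lborel. x \<notin> N" by (rule AE_not_in[OF N(1)])
    then show "AE x in lborel. U x = (if x \<in> N then mat 1 else U0 x)"
      using N(2) by (auto elim!: eventually_mono)
  qed
qed

lemma orlicz_norm_cong_AE:
  assumes "AE x in lborel. f x = g x"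
  shows "orlicz_norm \<Phi> Q f = orlicz_norm \<Phi> Q g"
proof -
  have "(\<integral>\<^sup>+ x\<in>Q. young_ennreal \<Phi> (f x / ennreal c) \<partial>lebesgue) = (\<integral>\<^sup>+ x\<in>Q. young_ennreal \<Phi> (g x / ennreal c) \<partial>lebesgue)" for c
    unfolding nn_integral_lebesgue_eq using assms by (intro nn_integral_cong_AE) (auto elim!: eventually_mono)
  then show ?thesis by (simp add: orlicz_norm_def)
qed

text \<open>The null set of \<open>y\<close> is dealt with in the inner norm for each
  \<open>x\<close>, the null set of \<open>x\<close> afterwards in the outer norm.\<close>

lemma two_weight_bump_borel_version:
  fixes U V U1 V1 :: "real^'d \<Rightarrow> complex^'n^'n"
  assumes U: "AE x in lborel. U x = U1 x" and V: "AE x in lborel. V x = V1 x"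
  shows "two_weight_bump \<alpha> p q \<Phi> \<Psi> U V = two_weight_bump \<alpha> p q \<Phi> \<Psi> U1 V1"
proof -
  have "orlicz_norm \<Psi> Q (\<lambda>x. orlicz_norm \<Phi> Q (\<lambda>y. ennreal (op_norm (matrix_powr (U x) (1 / q) ** matrix_powr (V y) (- 1 / p)))))
      = orlicz_norm \<Psi> Q (\<lambda>x. orlicz_norm \<Phi> Q (\<lambda>y. ennreal (op_norm (matrix_powr (U1 x) (1 / q) ** matrix_powr (V1 y) (- 1 / p)))))" for Q
  proof (rule orlicz_norm_cong_AE)
    show "AE x in lborel. orlicz_norm \<Phi> Q (\<lambda>y. ennreal (op_norm (matrix_powr (U x) (1 / q) ** matrix_powr (V y) (- 1 / p))))
        = orlicz_norm \<Phi> Q (\<lambda>y. ennreal (op_norm (matrix_powr (U1 x) (1 / q) ** matrix_powr (V1 y) (- 1 / p))))"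
      using U
    proof eventually_elim
      case (elim x)
      show ?case unfolding elim
        by (rule orlicz_norm_cong_AE) (use V in \<open>auto elim!: eventually_mono\<close>)
    qed
  qed
  then show ?thesis by (simp add: two_weight_bump_def)
qed

text \<open>Holds at every \<open>x\<close> without exception, since \<open>f\<close> changes only
  on a null set of the integration variable.\<close>

lemma riesz_potential_borel_version:
  fixes f f0 :: "real^'d \<Rightarrow> complex^'n"
  assumes f: "f \<in> borel_measurable lebesgue" and f0 [measurable]: "f0 \<in> borel_measurable borel"
    and eq: "AE y in lborel. f y = f0 y"
  shows "riesz_defined \<alpha> f x \<longleftrightarrow> (\<forall>i. integrable lborel (riesz_integrand \<alpha> (\<lambda>y. f0 y $ i) x))"
    and "riesz_potential \<alpha> f x = (\<chi> i. LINT y|lborel. riesz_integrand \<alpha> (\<lambda>y. f0 y $ i) x y)"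
proof -
  have [measurable]: "(\<lambda>y. f0 y $ i) \<in> borel_measurable borel" for i
    by (rule measurable_compose[OF f0]) (rule borel_measurable_continuous_onI, intro continuous_intros)
  have m0: "riesz_integrand \<alpha> (\<lambda>y. f0 y $ i) x \<in> borel_measurable lborel" for i
    unfolding riesz_integrand_def[abs_def] by measurable
  have m0L: "riesz_integrand \<alpha> (\<lambda>y. f0 y $ i) x \<in> borel_measurable lebesgue" for i
    by (rule measurable_completion[OF m0])
  have fi: "(\<lambda>y. f y $ i) \<in> borel_measurable lebesgue" for i
    by (rule measurable_compose[OF f]) (rule borel_measurable_continuous_onI, intro continuous_intros)
  have k: "(\<lambda>y. complex_of_real (norm (x - y) powr (real CARD('d) - \<alpha>))) \<in> borel_measurable lborel"
    by measurable
  have m: "riesz_integrand \<alpha> (\<lambda>y. f y $ i) x \<in> borel_measurable lebesgue" for i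
    unfolding riesz_integrand_def[abs_def]
    by (rule borel_measurable_divide[OF fi measurable_completion[OF k]])
  have ae: "AE y in lebesgue. riesz_integrand \<alpha> (\<lambda>y. f y $ i) x y = riesz_integrand \<alpha> (\<lambda>y. f0 y $ i) x y" for i
    unfolding AE_completion_iff using eq by eventually_elim (simp add: riesz_integrand_def)
  have "integrable lebesgue (riesz_integrand \<alpha> (\<lambda>y. f y $ i) x) \<longleftrightarrow> integrable lborel (riesz_integrand \<alpha> (\<lambda>y. f0 y $ i) x)" for i
    using integrable_cong_AE[OF m m0L ae] integrable_completion[OF m0] by simp
  then show "riesz_defined \<alpha> f x \<longleftrightarrow> (\<forall>i. integrable lborel (riesz_integrand \<alpha> (\<lambda>y. f0 y $ i) x))"
    by (simp add: riesz_defined_def)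
  have "(LINT y|lebesgue. riesz_integrand \<alpha> (\<lambda>y. f y $ i) x y) = (LINT y|lborel. riesz_integrand \<alpha> (\<lambda>y. f0 y $ i) x y)" for i
    using integral_cong_AE[OF m m0L ae] integral_completion[OF m0] by simp
  then show "riesz_potential \<alpha> f x = (\<chi> i. LINT y|lborel. riesz_integrand \<alpha> (\<lambda>y. f0 y $ i) x y)"
    by (simp add: riesz_potential_def)
qed

lemma riesz_potential_measurable:
  fixes f :: "real^'d \<Rightarrow> complex^'n"
  assumes f: "f \<in> borel_measurable lebesgue"
  shows "riesz_potential \<alpha> f \<in> borel_measurable lebesgue"
proof -
  obtain f0 where f0 [measurable]: "f0 \<in> borel_measurable borel" and eq: "AE y in lborel. f y = f0 y"
    using lebesgue_borel_version[OF f] by blast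
  have [measurable]: "(\<lambda>y. f0 y $ i) \<in> borel_measurable borel" for i
    by (rule measurable_compose[OF f0]) (rule borel_measurable_continuous_onI, intro continuous_intros)
  have "(\<lambda>(x, y). riesz_integrand \<alpha> (\<lambda>y. f0 y $ i) x y) \<in> borel_measurable (lborel \<Otimes>\<^sub>M lborel)" for i
    unfolding riesz_integrand_def by measurable
  then have "(\<lambda>x. LINT y|lborel. riesz_integrand \<alpha> (\<lambda>y. f0 y $ i) x y) \<in> borel_measurable lborel" for i
    by (rule lborel.borel_measurable_lebesgue_integral)
  then have "(\<lambda>x. riesz_potential \<alpha> f x $ i) \<in> borel_measurable lborel" for i
    by (simp add: riesz_potential_borel_version(2)[OF f f0 eq])
  then show ?thesis
    by (intro measurable_completion borel_measurable_vecI)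
qed

text \<open>Finiteness of \<open>fractional_size\<close> makes \<open>A x *v F y\<close> integrable
  in \<open>y\<close>; applying the left inverse \<open>D\<close> recovers integrability of
  \<open>F\<close> and of its components. Only then may \<open>A x\<close> be moved inside the
  integral.\<close>

lemma riesz_potential_bound:
  fixes A :: "real^'d \<Rightarrow> complex^'n^'n" and f f0 :: "real^'d \<Rightarrow> complex^'n"
  assumes f: "f \<in> borel_measurable lebesgue" and f0 [measurable]: "f0 \<in> borel_measurable borel"
    and eq: "AE y in lborel. f y = f0 y" and inv: "D ** A x = mat 1"
    and fin: "fractional_size \<alpha> A f0 x < \<infinity>"
  shows "riesz_defined \<alpha> f x"
    and "norm (A x *v riesz_potential \<alpha> f x) \<le> enn2real (fractional_size \<alpha> A f0 x)"
proof -
  define F where "F y = (norm (x - y) powr (\<alpha> - CARD('d))) *\<^sub>R f0 y" for y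
  have [measurable]: "F \<in> borel_measurable borel" unfolding F_def[abs_def] by measurable
  have AF: "A x *v F y = (norm (x - y) powr (\<alpha> - CARD('d))) *\<^sub>R (A x *v f0 y)" for y
    unfolding F_def by (rule linear_cmul[OF bounded_linear.linear[OF matrix_vector_mul_bounded_linear]])
  have nAF: "ennreal (norm (A x *v F y)) = ennreal (norm (A x *v f0 y)) * ennreal (norm (x - y) powr (\<alpha> - CARD('d)))" for y
    by (simp add: AF ennreal_mult mult.commute)
  have T: "(\<integral>\<^sup>+ y. ennreal (norm (A x *v F y)) \<partial>lborel) = fractional_size \<alpha> A f0 x"
    by (simp add: nAF fractional_size_def)
  have mAF: "(\<lambda>y. A x *v F y) \<in> borel_measurable lborel" by measurable
  have iAF: "integrable lborel (\<lambda>y. A x *v F y)"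
    using fin T by (intro integrableI_bounded mAF) simp
  have "D *v (A x *v v) = v" for v by (simp add: matrix_vector_mul_assoc inv)
  then have iF: "integrable lborel F"
    using integrable_bounded_linear[OF matrix_vector_mul_bounded_linear[of D] iAF] by simp
  have comp: "riesz_integrand \<alpha> (\<lambda>y. f0 y $ i) x y = F y $ i" for i y
  proof -
    have "norm (x - y) powr (\<alpha> - CARD('d)) = inverse (norm (x - y) powr (CARD('d) - \<alpha>))"
      using powr_minus[of "norm (x - y)" "CARD('d) - \<alpha>"] by simp
    then show ?thesis
      by (simp add: F_def riesz_integrand_def scaleR_conv_of_real[where 'a = complex] divide_inverse mult.commute)
  qed
  have nth: "bounded_linear (\<lambda>v :: complex^'n. v $ i)" for i by (rule bounded_linear_vec_nth)
  note versions = riesz_potential_borel_version[OF f f0 eq, of \<alpha> x]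
  show "riesz_defined \<alpha> f x"
    unfolding versions(1) comp[abs_def] using integrable_bounded_linear[OF nth iF] by blast
  have "riesz_potential \<alpha> f x = (LINT y|lborel. F y)"
    unfolding versions(2) comp vec_eq_iff using integral_bounded_linear[OF nth iF] by simp
  then have "A x *v riesz_potential \<alpha> f x = (LINT y|lborel. A x *v F y)"
    using integral_bounded_linear[OF matrix_vector_mul_bounded_linear iF, of "A x"] by simp
  also have "norm \<dots> \<le> (LINT y|lborel. norm (A x *v F y))"
    by (rule integral_norm_bound)
  also have "\<dots> = enn2real (\<integral>\<^sup>+ y. ennreal (norm (A x *v F y)) \<partial>lborel)"
    using mAF by (intro integral_eq_nn_integral) auto
  finally show "norm (A x *v riesz_potential \<alpha> f x) \<le> enn2real (fractional_size \<alpha> A f0 x)"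
    by (simp add: T)
qed

lemma Lp_integral_eq_lborel:
  "Lp_integral p U f = (\<integral>\<^sup>+ x. ennreal (norm (matrix_powr (U x) (1 / p) *v f x) powr p) \<partial>lborel)"
  unfolding Lp_integral_def by (rule nn_integral_completion)

theorem theorem1p10:
  fixes \<alpha> p q :: real
    and \<Phi> \<Psi> :: "real \<Rightarrow> real"
    and U V :: "real^'d \<Rightarrow> complex^'n^'n"
  assumes "0 < \<alpha>" and "\<alpha> < real CARD('d)"
    and "1 < p" and "p \<le> q"
    and "1 / p - 1 / q \<le> \<alpha> / real CARD('d)"
    and "young_function \<Phi>" and "young_function \<Psi>"
    and "B_class2 p q (young_associate \<Phi>)"
    and "B_class (conj_exponent q) (young_associate \<Psi>)"
    and "matrix_weight U" and "matrix_weight V"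
    and "two_weight_bump \<alpha> p q \<Phi> \<Psi> U V < \<infinity>"
  shows "\<exists>C. \<forall>f \<in> Lp_space p V.
           (AE x in lebesgue. riesz_defined \<alpha> f x) \<and>
           riesz_potential \<alpha> f \<in> Lp_space q U \<and>
           Lp_norm q U (riesz_potential \<alpha> f) \<le> C * Lp_norm p V f"
proof -
  have p: "0 < p" and q: "1 < q" using assms(3,4) by auto
  obtain U1 where U1: "U1 \<in> borel_measurable borel" "\<And>x. positive_definite (U1 x)" "AE x in lborel. U x = U1 x"
    using matrix_weight_borel_version[OF assms(10)] by blast
  obtain V1 where V1: "V1 \<in> borel_measurable borel" "\<And>x. positive_definite (V1 x)" "AE x in lborel. V x = V1 x"
    using matrix_weight_borel_version[OF assms(11)] by blast
  define A where "A x = matrix_powr (U1 x) (1 / q)" for x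
  define B where "B y = matrix_powr (V1 y) (- 1 / p)" for y
  define B' where "B' y = matrix_powr (V1 y) (1 / p)" for y
  have A [measurable]: "A \<in> borel_measurable borel" and B [measurable]: "B \<in> borel_measurable borel"
    and B' [measurable]: "B' \<in> borel_measurable borel"
    unfolding A_def[abs_def] B_def[abs_def] B'_def[abs_def]
    by (intro borel_measurable_matrix_powr U1(1,2) V1(1,2))+
  have BB': "B y ** B' y = mat 1" for y
    by (simp add: B_def B'_def matrix_powr_add[OF V1(2)] matrix_powr_0[OF V1(2)])
  have Ainv: "matrix_powr (U1 x) (- (1 / q)) ** A x = mat 1" for x
    by (simp add: A_def matrix_powr_add[OF U1(2)] matrix_powr_0[OF U1(2)])
  \<comment> \<open>Adding 1 makes \<open>M\<close> positive and the bump inequality strict, as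
    \<open>bilinear_bound\<close> demands.\<close>
  define M where "M = enn2real (two_weight_bump \<alpha> p q \<Phi> \<Psi> U V) + 1"
  have M: "0 < M" by (simp add: M_def add_nonneg_pos)
  have bump: "ennreal (measure lebesgue Q powr (\<alpha> / CARD('d) + 1 / q - 1 / p)) *
        orlicz_norm \<Psi> Q (\<lambda>x. orlicz_norm \<Phi> Q (\<lambda>y. ennreal (op_norm (A x ** B y)))) < ennreal M"
    if "Q \<in> cubes" for Q
  proof -
    have "ennreal (measure lebesgue Q powr (\<alpha> / CARD('d) + 1 / q - 1 / p)) *
        orlicz_norm \<Psi> Q (\<lambda>x. orlicz_norm \<Phi> Q (\<lambda>y. ennreal (op_norm (A x ** B y)))) \<le> two_weight_bump \<alpha> p q \<Phi> \<Psi> U V"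
      unfolding two_weight_bump_borel_version[OF U1(3) V1(3)]
      unfolding two_weight_bump_def A_def B_def
      by (rule SUP_upper[OF that])
    also have "\<dots> < ennreal M"
    proof -
      have "two_weight_bump \<alpha> p q \<Phi> \<Psi> U V = ennreal (M - 1)" using assms(12) by (simp add: M_def)
      also have "\<dots> < ennreal M" using M by (simp add: ennreal_less_iff M_def)
      finally show ?thesis .
    qed
    finally show ?thesis .
  qed
  obtain C where est: "bilinear_estimate \<alpha> p q A B C"
    using bilinear_bound[OF assms(1-4) assms(6-9) A B M bump] by blast
  then have C: "0 \<le> C" by (simp add: bilinear_estimate_def)
  \<comment> \<open>Dividing \<open>f\<close> by a number \<open>c\<close> strictly above its norm
    also covers norm 0; at the end \<open>c\<close> decreases to the norm.\<close>
  have main: "(AE x in lebesgue. riesz_defined \<alpha> f x) \<and> riesz_potential \<alpha> f \<in> Lp_space q U \<and>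
      Lp_norm q U (riesz_potential \<alpha> f) \<le> C * c"
    if fL: "f \<in> Lp_space p V" and c: "Lp_norm p V f < c" for f :: "real^'d \<Rightarrow> complex^'n" and c
  proof -
    have f: "f \<in> borel_measurable lebesgue" and W: "Lp_integral p V f < \<infinity>"
      using fL by (auto simp: Lp_space_def)
    have c0: "0 < c" using c unfolding Lp_norm_def by (rule le_less_trans[OF powr_ge_zero])
    obtain f0 where f0 [measurable]: "f0 \<in> borel_measurable borel" and f_eq: "AE y in lborel. f y = f0 y"
      using lebesgue_borel_version[OF f] by blast
    define f1 where "f1 y = (1 / c) *\<^sub>R f0 y" for y
    define g where "g y = norm (B' y *v f1 y)" for y
    have f1m [measurable]: "f1 \<in> borel_measurable borel" unfolding f1_def[abs_def] by measurable
    have g0: "0 \<le> g y" for y by (simp add: g_def)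
    have gm: "g \<in> borel_measurable borel" unfolding g_def[abs_def] by measurable
    have scale: "X *v f1 y = (1 / c) *\<^sub>R (X *v f0 y)" for X :: "complex^'n^'n" and y
      unfolding f1_def by (rule linear_cmul[OF bounded_linear.linear[OF matrix_vector_mul_bounded_linear]])
    have dom: "norm (A x *v f1 y) \<le> op_norm (A x ** B y) * g y" for x y
    proof -
      have "A x *v f1 y = (A x ** B y) *v (B' y *v f1 y)"
        by (simp add: matrix_vector_mul_assoc matrix_mul_assoc[symmetric] BB')
      then show ?thesis using op_norm_bound[of "A x ** B y" "B' y *v f1 y"] by (simp add: g_def)
    qed
    have gnorm: "(\<integral>\<^sup>+ y. ennreal (g y powr p) \<partial>lborel) \<le> 1"
    proof -
      have "(\<integral>\<^sup>+ y. ennreal (g y powr p) \<partial>lborel) =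
          (\<integral>\<^sup>+ y. ennreal (1 / c powr p) * ennreal (norm (matrix_powr (V y) (1 / p) *v f y) powr p) \<partial>lborel)"
      proof (rule nn_integral_cong_AE)
        show "AE y in lborel. ennreal (g y powr p) =
            ennreal (1 / c powr p) * ennreal (norm (matrix_powr (V y) (1 / p) *v f y) powr p)"
          using V1(3) f_eq
        proof eventually_elim
          case (elim y)
          have "g y powr p = 1 / c powr p * norm (B' y *v f0 y) powr p"
            using c0 by (simp add: g_def scale powr_divide)
          then show ?case by (simp add: elim B'_def ennreal_mult[symmetric])
        qed
      qed
      also have "\<dots> = (\<integral>\<^sup>+ y. ennreal (1 / c powr p) * ennreal (norm (B' y *v f0 y) powr p) \<partial>lborel)"
        using V1(3) f_eq by (intro nn_integral_cong_AE) (auto simp: B'_def elim!: eventually_elim2)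
      also have "\<dots> = ennreal (1 / c powr p) * (\<integral>\<^sup>+ y. ennreal (norm (B' y *v f0 y) powr p) \<partial>lborel)"
        by (rule nn_integral_cmult) measurable
      also have "(\<integral>\<^sup>+ y. ennreal (norm (B' y *v f0 y) powr p) \<partial>lborel) = Lp_integral p V f"
        unfolding Lp_integral_eq_lborel using V1(3) f_eq
        by (intro nn_integral_cong_AE) (auto simp: B'_def elim!: eventually_elim2)
      also have "Lp_integral p V f \<le> ennreal (c powr p)"
      proof -
        define w where "w = enn2real (Lp_integral p V f)"
        have w: "Lp_integral p V f = ennreal w" "0 \<le> w" using W by (simp_all add: w_def)
        have "(w powr (1 / p)) powr p \<le> c powr p"
          using c p by (intro powr_mono2) (auto simp: Lp_norm_def w_def)
        then show ?thesis using w p by (simp add: powr_powr ennreal_leI)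
      qed
      also have "ennreal (1 / c powr p) * ennreal (c powr p) = 1"
        using c0 by (simp add: ennreal_mult[symmetric])
      finally show ?thesis by (simp add: mult_left_mono)
    qed
    obtain Z where Z: "Z \<in> borel_measurable borel" "(\<integral>\<^sup>+ x. Z x \<partial>lborel) \<le> ennreal (C powr q)"
      "\<And>x. fractional_size \<alpha> A f1 x < \<infinity> \<Longrightarrow> ennreal (enn2real (fractional_size \<alpha> A f1 x) powr q) \<le> Z x"
      "\<And>x. fractional_size \<alpha> A f1 x = \<infinity> \<Longrightarrow> Z x = \<infinity>"
      by (rule strong_bound[OF q est A f1m gm g0 dom gnorm p]) (rule that)
    have "(\<integral>\<^sup>+ x. Z x \<partial>lborel) \<noteq> \<infinity>"
      using Z(2) by (metis ennreal_less_top infinity_ennreal_def not_le)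
    then have "AE x in lborel. Z x \<noteq> \<infinity>"
      using Z(1) by (intro nn_integral_PInf_AE) auto
    then have Tfin: "AE x in lborel. fractional_size \<alpha> A f1 x < \<infinity>"
    proof eventually_elim
      case (elim x)
      then show ?case using Z(4)[of x] by (cases "fractional_size \<alpha> A f1 x") auto
    qed
    have size0: "fractional_size \<alpha> A f0 x = ennreal c * fractional_size \<alpha> A f1 x" for x
    proof -
      have "ennreal (norm (A x *v f0 y)) = ennreal c * ennreal (norm (A x *v f1 y))" for y
        using c0 by (simp add: scale ennreal_mult[symmetric])
      then have "fractional_size \<alpha> A f0 x = (\<integral>\<^sup>+ y. ennreal c *
          (ennreal (norm (A x *v f1 y)) * ennreal (norm (x - y) powr (\<alpha> - CARD('d)))) \<partial>lborel)"
        by (simp add: fractional_size_def mult.assoc)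
      also have "\<dots> = ennreal c * fractional_size \<alpha> A f1 x"
        unfolding fractional_size_def by (rule nn_integral_cmult) measurable
      finally show ?thesis .
    qed
    have pt: "riesz_defined \<alpha> f x \<and> ennreal (norm (A x *v riesz_potential \<alpha> f x) powr q) \<le> ennreal (c powr q) * Z x"
      if T: "fractional_size \<alpha> A f1 x < \<infinity>" for x
    proof -
      have T0: "fractional_size \<alpha> A f0 x < \<infinity>" using T by (simp add: size0 ennreal_mult_less_top)
      note b = riesz_potential_bound[where A = A, OF f f0 f_eq Ainv T0]
      have "norm (A x *v riesz_potential \<alpha> f x) powr q \<le> (c * enn2real (fractional_size \<alpha> A f1 x)) powr q"
        using b(2) q c0 by (intro powr_mono2) (auto simp: size0 enn2real_mult)
      also have "\<dots> = c powr q * enn2real (fractional_size \<alpha> A f1 x) powr q"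
        using c0 by (simp add: powr_mult)
      finally have "ennreal (norm (A x *v riesz_potential \<alpha> f x) powr q) \<le>
          ennreal (c powr q) * ennreal (enn2real (fractional_size \<alpha> A f1 x) powr q)"
        by (simp add: ennreal_mult[symmetric] ennreal_leI)
      also have "\<dots> \<le> ennreal (c powr q) * Z x" by (intro mult_left_mono Z(3) T) simp
      finally show ?thesis using b(1) by simp
    qed
    have def_ae: "AE x in lebesgue. riesz_defined \<alpha> f x"
      unfolding AE_completion_iff using Tfin by eventually_elim (use pt in blast)
    have int: "Lp_integral q U (riesz_potential \<alpha> f) \<le> ennreal ((C * c) powr q)"
    proof -
      have "Lp_integral q U (riesz_potential \<alpha> f) \<le> (\<integral>\<^sup>+ x. ennreal (c powr q) * Z x \<partial>lborel)"
        unfolding Lp_integral_eq_lborel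
      proof (rule nn_integral_mono_AE)
        show "AE x in lborel. ennreal (norm (matrix_powr (U x) (1 / q) *v riesz_potential \<alpha> f x) powr q) \<le> ennreal (c powr q) * Z x"
          using Tfin U1(3)
        proof eventually_elim
          case (elim x)
          then show ?case using pt[OF elim(1)] by (simp add: A_def)
        qed
      qed
      also have "\<dots> = ennreal (c powr q) * (\<integral>\<^sup>+ x. Z x \<partial>lborel)"
        using Z(1) by (intro nn_integral_cmult) simp
      also have "\<dots> \<le> ennreal (c powr q) * ennreal (C powr q)"
        by (intro mult_left_mono Z(2)) simp
      also have "\<dots> = ennreal ((C * c) powr q)"
        using c0 C by (simp add: ennreal_mult[symmetric] powr_mult mult.commute)
      finally show ?thesis .
    qed
    have "Lp_integral q U (riesz_potential \<alpha> f) < \<infinity>"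
      using int by (rule le_less_trans) simp
    then have "riesz_potential \<alpha> f \<in> Lp_space q U"
      using riesz_potential_measurable[OF f] by (simp add: Lp_space_def)
    moreover have "Lp_norm q U (riesz_potential \<alpha> f) \<le> C * c"
    proof -
      have "enn2real (Lp_integral q U (riesz_potential \<alpha> f)) \<le> (C * c) powr q"
        using int by (rule enn2real_leI[rotated]) simp
      then have "Lp_norm q U (riesz_potential \<alpha> f) \<le> ((C * c) powr q) powr (1 / q)"
        unfolding Lp_norm_def using q by (intro powr_mono2) auto
      then show ?thesis using q C c0 by (simp add: powr_powr)
    qed
    ultimately show ?thesis using def_ae by blast
  qed
  show ?thesis
  proof (intro exI[of _ C] ballI conjI)
    fix f :: "real^'d \<Rightarrow> complex^'n" assume f: "f \<in> Lp_space p V"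
    show "AE x in lebesgue. riesz_defined \<alpha> f x" "riesz_potential \<alpha> f \<in> Lp_space q U"
      using main[OF f, of "Lp_norm p V f + 1"] by simp_all
    have "ennreal (Lp_norm q U (riesz_potential \<alpha> f)) \<le> ennreal (C * Lp_norm p V f)"
    proof (rule ennreal_le_mult_limit[OF C])
      show "0 \<le> Lp_norm p V f" by (simp add: Lp_norm_def)
      show "ennreal (Lp_norm q U (riesz_potential \<alpha> f)) \<le> ennreal (C * c)" if "Lp_norm p V f < c" for c
        using main[OF f that] by (intro ennreal_leI) simp
    qed
    then show "Lp_norm q U (riesz_potential \<alpha> f) \<le> C * Lp_norm p V f"
      using C by (subst (asm) ennreal_le_iff) (simp_all add: Lp_norm_def)
  qed
qed

end
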